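(* Let $R$ be a noetherian domain, let $\tau_1,\tau_2$ be automorphisms of $R$, let $\delta_1$ be a left $\tau_1$-derivation of $R$ and $\delta_2$ a left $\tau_2$-derivation of $R$, let $S=R[x;\tau_1,\delta_1]*_RR[y;\tau_2,\delta_2]$, and let $X:=R\setminus\{0\}$. Then (i) $X$ is a right denominator set in $S$, and (ii) the ring of fractions $SX^{-1}$ is isomorphic to the amalgamated product $$(RX^{-1})[x;\tau_1,\delta_1]*_{RX^{-1}}(RX^{-1})[y;\tau_2,\delta_2],$$ where $\tau_1,\tau_2,\delta_1,\delta_2$ here denote the induced maps on the division ring of fractions $RX^{-1}$.
   Context: Rings are associative and unital; noetherian means left and right noetherian. For a ring endomorphism $\tau$ of $R$, a left $\tau$-derivation is a $\mathbb{Z}$-linear map $\delta:R\to R$ with $\delta(rs)=\tau(r)\delta(s)+\delta(r)s$ for all $r,s\in R$. The Ore extension $R[x;\tau,\delta]$ is the ring containing $R$ as a subring that is a free left $R$-module with basis $\{1,x,x^2,\dots\}$ and satisfies $xr=\tau(r)x+\delta(r)$ for all $r\in R$. The amalgamated product $S_1*_RS_2$ of two rings $S_1,S_2$ containing $R$ as a subring is the pushout, in the category of rings, of the inclusions $R\hookrightarrow S_1$ and $R\hookrightarrow S_2$. A right denominator set is a right Ore, right reversible multiplicative set; $SX^{-1}$ denotes the right ring of fractions. The induced maps on $RX^{-1}$ are the unique extensions of $\tau_i$ to an automorphism of $RX^{-1}$ and of $\delta_i$ to a left derivation of $RX^{-1}$ with respect to that automorphism. *)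

theory Defs
  imports "HOL-Algebra.QuotRing" "HOL-Algebra.UnivPoly"
begin

section \<open>Noetherian domains, automorphisms and skew derivations\<close>

text \<open>
  HOL-Algebra's \<open>domain\<close> and \<open>noetherian_ring\<close> are not used: the former is commutative and the
  latter only bounds two-sided ideals.
\<close>

definition left_ideal :: "'a set \<Rightarrow> ('a, 'm) ring_scheme \<Rightarrow> bool" where
  "left_ideal I R \<longleftrightarrow>
     additive_subgroup I R \<and> (\<forall>r\<in>carrier R. \<forall>a\<in>I. r \<otimes>\<^bsub>R\<^esub> a \<in> I)"

definition right_ideal :: "'a set \<Rightarrow> ('a, 'm) ring_scheme \<Rightarrow> bool" where
  "right_ideal I R \<longleftrightarrow>
     additive_subgroup I R \<and> (\<forall>r\<in>carrier R. \<forall>a\<in>I. a \<otimes>\<^bsub>R\<^esub> r \<in> I)"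

definition left_noetherian :: "('a, 'm) ring_scheme \<Rightarrow> bool" where
  "left_noetherian R \<longleftrightarrow>
     (\<forall>I :: nat \<Rightarrow> 'a set. (\<forall>n. left_ideal (I n) R \<and> I n \<subseteq> I (Suc n)) \<longrightarrow>
        (\<exists>N. \<forall>n\<ge>N. I n = I N))"

definition right_noetherian :: "('a, 'm) ring_scheme \<Rightarrow> bool" where
  "right_noetherian R \<longleftrightarrow>
     (\<forall>I :: nat \<Rightarrow> 'a set. (\<forall>n. right_ideal (I n) R \<and> I n \<subseteq> I (Suc n)) \<longrightarrow>
        (\<exists>N. \<forall>n\<ge>N. I n = I N))"

definition nc_noetherian_domain :: "('a, 'm) ring_scheme \<Rightarrow> bool" where
  "nc_noetherian_domain R \<longleftrightarrow>
     ring R \<and> \<one>\<^bsub>R\<^esub> \<noteq> \<zero>\<^bsub>R\<^esub> \<and>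
     (\<forall>a\<in>carrier R. \<forall>b\<in>carrier R. a \<otimes>\<^bsub>R\<^esub> b = \<zero>\<^bsub>R\<^esub> \<longrightarrow> a = \<zero>\<^bsub>R\<^esub> \<or> b = \<zero>\<^bsub>R\<^esub>) \<and>
     left_noetherian R \<and> right_noetherian R"

abbreviation ring_aut :: "('a, 'm) ring_scheme \<Rightarrow> ('a \<Rightarrow> 'a) set" where
  "ring_aut R \<equiv> ring_iso R R"

definition left_derivation :: "('a, 'm) ring_scheme \<Rightarrow> ('a \<Rightarrow> 'a) \<Rightarrow> ('a \<Rightarrow> 'a) \<Rightarrow> bool" where
  "left_derivation R \<tau> \<delta> \<longleftrightarrow>
     \<delta> \<in> carrier R \<rightarrow> carrier R \<and>
     (\<forall>r\<in>carrier R. \<forall>s\<in>carrier R. \<delta> (r \<oplus>\<^bsub>R\<^esub> s) = \<delta> r \<oplus>\<^bsub>R\<^esub> \<delta> s) \<and>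
     (\<forall>r\<in>carrier R. \<forall>s\<in>carrier R. \<delta> (r \<otimes>\<^bsub>R\<^esub> s) = \<tau> r \<otimes>\<^bsub>R\<^esub> \<delta> s \<oplus>\<^bsub>R\<^esub> \<delta> r \<otimes>\<^bsub>R\<^esub> s)"


section \<open>Ore extensions\<close>

text \<open>
  As a left \<open>R\<close>-module, \<open>R[x; \<tau>, \<delta>]\<close> is the module underlying the library's polynomials \<open>UP R\<close>;
  only the multiplication changes.  Left multiplication by \<open>x\<close> is forced by \<open>x r = \<tau>(r) x + \<delta>(r)\<close>:
  it sends \<open>\<Sum> q\<^sub>n x\<^sup>n\<close> to \<open>\<Sum> (\<tau>(q\<^sub>n) x\<^sup>n\<^sup>+\<^sup>1 + \<delta>(q\<^sub>n) x\<^sup>n)\<close>.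
  The properties characterising \<open>R[x; \<tau>, \<delta>]\<close> are \<open>ore_ext_ring\<close>, \<open>ore_const_hom\<close>, \<open>ore_const_inj\<close>,
  \<open>ore_ext_basis\<close> and \<open>ore_var_mult\<close> below.
\<close>

definition ore_shift ::
    "('a, 'm) ring_scheme \<Rightarrow> ('a \<Rightarrow> 'a) \<Rightarrow> ('a \<Rightarrow> 'a) \<Rightarrow> (nat \<Rightarrow> 'a) \<Rightarrow> (nat \<Rightarrow> 'a)" where
  "ore_shift R \<tau> \<delta> q = (\<lambda>n. (case n of 0 \<Rightarrow> \<zero>\<^bsub>R\<^esub> | Suc m \<Rightarrow> \<tau> (q m)) \<oplus>\<^bsub>R\<^esub> \<delta> (q n))"

definition ore_ext ::
    "('a, 'm) ring_scheme \<Rightarrow> ('a \<Rightarrow> 'a) \<Rightarrow> ('a \<Rightarrow> 'a) \<Rightarrow> (nat \<Rightarrow> 'a) ring" where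
  "ore_ext R \<tau> \<delta> =
     \<lparr> carrier = carrier (UP R),
       mult = (\<lambda>p q. \<Oplus>\<^bsub>UP R\<^esub> i\<in>{..deg R p}. p i \<odot>\<^bsub>UP R\<^esub> (ore_shift R \<tau> \<delta> ^^ i) q),
       one = monom (UP R) \<one>\<^bsub>R\<^esub> 0,
       zero = \<zero>\<^bsub>UP R\<^esub>,
       add = (\<lambda>p q. p \<oplus>\<^bsub>UP R\<^esub> q) \<rparr>"

definition ore_const :: "('a, 'm) ring_scheme \<Rightarrow> 'a \<Rightarrow> (nat \<Rightarrow> 'a)" where
  "ore_const R r = monom (UP R) r 0"

definition ore_var :: "('a, 'm) ring_scheme \<Rightarrow> (nat \<Rightarrow> 'a)" where
  "ore_var R = monom (UP R) \<one>\<^bsub>R\<^esub> 1"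


locale skew = UP_ring R P for R (structure) and P (structure) +
  fixes \<tau> \<delta> :: "'a \<Rightarrow> 'a"
  assumes tau: "\<tau> \<in> ring_hom R R"
    and delta: "left_derivation R \<tau> \<delta>"
begin

abbreviation X where "X \<equiv> ore_shift R \<tau> \<delta>"
abbreviation E where "E \<equiv> ore_ext R \<tau> \<delta>"

lemma carP: "p \<in> carrier P \<longleftrightarrow> p \<in> up R"
  by (simp add: P_def UP_def)

lemma coeffP [simp]: "p \<in> carrier P \<Longrightarrow> coeff P p n = p n"
  by (simp add: P_def UP_def)

lemma nth_closed: "p \<in> carrier P \<Longrightarrow> p n \<in> carrier R"
  using coeff_closed[of p n] by simp

lemma tau_closed: "a \<in> carrier R \<Longrightarrow> \<tau> a \<in> carrier R"
  by (rule ring_hom_closed[OF tau])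

lemma tau_add: "\<lbrakk>a \<in> carrier R; b \<in> carrier R\<rbrakk> \<Longrightarrow> \<tau> (a \<oplus> b) = \<tau> a \<oplus> \<tau> b"
  by (rule ring_hom_add[OF tau])

lemma tau_mult: "\<lbrakk>a \<in> carrier R; b \<in> carrier R\<rbrakk> \<Longrightarrow> \<tau> (a \<otimes> b) = \<tau> a \<otimes> \<tau> b"
  by (rule ring_hom_mult[OF tau])

lemma tau_one: "\<tau> \<one> = \<one>"
  by (rule ring_hom_one[OF tau])

lemma tau_zero: "\<tau> \<zero> = \<zero>"
  using ring_hom_zero[OF tau] R.ring_axioms by blast

lemma delta_closed: "a \<in> carrier R \<Longrightarrow> \<delta> a \<in> carrier R"
  using delta by (auto simp: left_derivation_def)

lemma delta_add: "\<lbrakk>a \<in> carrier R; b \<in> carrier R\<rbrakk> \<Longrightarrow> \<delta> (a \<oplus> b) = \<delta> a \<oplus> \<delta> b"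
  using delta by (auto simp: left_derivation_def)

lemma delta_mult: "\<lbrakk>a \<in> carrier R; b \<in> carrier R\<rbrakk> \<Longrightarrow> \<delta> (a \<otimes> b) = \<tau> a \<otimes> \<delta> b \<oplus> \<delta> a \<otimes> b"
  using delta by (auto simp: left_derivation_def)

lemma delta_zero: "\<delta> \<zero> = \<zero>"
proof -
  have "\<delta> \<zero> \<oplus> \<delta> \<zero> = \<delta> \<zero> \<oplus> \<zero>"
    using delta_add[of \<zero> \<zero>] delta_closed by simp
  then show ?thesis using delta_closed R.add.l_cancel_one by (metis R.zero_closed R.r_zero)
qed

lemma delta_one: "\<delta> \<one> = \<zero>"
proof -
  have "\<delta> \<one> \<oplus> \<delta> \<one> = \<delta> \<one> \<oplus> \<zero>"
    using delta_mult[of \<one> \<one>] delta_closed by (simp add: tau_one)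
  then show ?thesis using delta_closed R.add.l_cancel_one by (metis R.one_closed R.r_zero)
qed

lemmas td = tau_closed tau_add tau_mult tau_one tau_zero
  delta_closed delta_add delta_mult delta_zero delta_one nth_closed

lemma up_fun_eqI:
  assumes "p \<in> carrier P" "q \<in> carrier P" "\<And>n. p n = q n"
  shows "p = q"
  using assms by auto

lemma nth_add: "\<lbrakk>p \<in> carrier P; q \<in> carrier P\<rbrakk> \<Longrightarrow> (p \<oplus>\<^bsub>P\<^esub> q) n = p n \<oplus> q n"
  by (metis coeff_add UP_a_closed coeffP)

lemma nth_smult: "\<lbrakk>a \<in> carrier R; q \<in> carrier P\<rbrakk> \<Longrightarrow> (a \<odot>\<^bsub>P\<^esub> q) n = a \<otimes> q n"
  by (metis coeff_smult UP_smult_closed coeffP)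

lemma nth_zero: "\<zero>\<^bsub>P\<^esub> n = \<zero>"
  by (metis coeff_zero UP_zero_closed coeffP)

lemma nth_monom: "a \<in> carrier R \<Longrightarrow> monom P a m n = (if m = n then a else \<zero>)"
  by (metis coeff_monom monom_closed coeffP)

lemma X_closed: "q \<in> carrier P \<Longrightarrow> X q \<in> carrier P"
proof -
  assume q: "q \<in> carrier P"
  then obtain n where n: "bound \<zero> n q" by (auto simp: carP)
  have "bound \<zero> (Suc n) (X q)"
  proof
    fix m assume "Suc n < m"
    then obtain m' where m': "m = Suc m'" "n < m'" by (cases m) auto
    then have "q m = \<zero>" "q m' = \<zero>" using n by (simp_all add: bound.bound)
    then show "X q m = \<zero>" by (simp add: ore_shift_def m' td)
  qed
  moreover have "X q m \<in> carrier R" for m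
    using q by (auto simp: ore_shift_def td split: nat.split)
  ultimately show ?thesis by (auto simp: carP)
qed

lemma Xn_closed: "q \<in> carrier P \<Longrightarrow> (X ^^ n) q \<in> carrier P"
  by (induction n) (auto intro: X_closed)

lemma X_0: "X q 0 = \<zero> \<oplus> \<delta> (q 0)"
  by (simp add: ore_shift_def)

lemma X_Suc: "X q (Suc n) = \<tau> (q n) \<oplus> \<delta> (q (Suc n))"
  by (simp add: ore_shift_def)

lemma X_add: "\<lbrakk>p \<in> carrier P; q \<in> carrier P\<rbrakk> \<Longrightarrow> X (p \<oplus>\<^bsub>P\<^esub> q) = X p \<oplus>\<^bsub>P\<^esub> X q"
  by (rule up_fun_eqI; (simp add: X_closed)?; case_tac n)
     (simp_all add: X_closed nth_add X_0 X_Suc td R.a_assoc R.a_comm R.a_lcomm)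

lemma X_zero: "X \<zero>\<^bsub>P\<^esub> = \<zero>\<^bsub>P\<^esub>"
  by (rule up_fun_eqI; (simp add: X_closed)?; case_tac n) (simp_all add: nth_zero X_0 X_Suc td)

lemma X_smult:
  "\<lbrakk>a \<in> carrier R; q \<in> carrier P\<rbrakk> \<Longrightarrow> X (a \<odot>\<^bsub>P\<^esub> q) = \<tau> a \<odot>\<^bsub>P\<^esub> X q \<oplus>\<^bsub>P\<^esub> \<delta> a \<odot>\<^bsub>P\<^esub> q"
  by (rule up_fun_eqI; (simp add: X_closed td)?; case_tac n)
     (simp_all add: X_closed td nth_add nth_smult X_0 X_Suc R.r_distr R.a_assoc)

lemma Xn_add: "\<lbrakk>p \<in> carrier P; q \<in> carrier P\<rbrakk> \<Longrightarrow> (X ^^ n) (p \<oplus>\<^bsub>P\<^esub> q) = (X ^^ n) p \<oplus>\<^bsub>P\<^esub> (X ^^ n) q"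
  by (induction n) (auto simp: X_add Xn_closed)

lemma Xn_monom: "(X ^^ n) (monom P \<one> 0) = monom P \<one> n"
proof (induction n)
  case (Suc n)
  have "X (monom P \<one> n) = monom P \<one> (Suc n)"
  proof (rule up_fun_eqI)
    fix m
    show "X (monom P \<one> n) m = monom P \<one> (Suc n) m"
      by (cases m) (auto simp: nth_monom X_0 X_Suc td)
  qed (simp_all add: X_closed)
  with Suc show ?case by simp
qed simp

text \<open>Left multiplication, with a redundant upper summation bound.\<close>

definition L :: "nat \<Rightarrow> (nat \<Rightarrow> 'a) \<Rightarrow> (nat \<Rightarrow> 'a) \<Rightarrow> (nat \<Rightarrow> 'a)" where
  "L N p q = (\<Oplus>\<^bsub>P\<^esub> i\<in>{..N}. p i \<odot>\<^bsub>P\<^esub> (X ^^ i) q)"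

lemma L_closed: "\<lbrakk>p \<in> carrier P; q \<in> carrier P\<rbrakk> \<Longrightarrow> L N p q \<in> carrier P"
  unfolding L_def by (rule P.finsum_closed) (auto simp: td Xn_closed)

lemma L_0: "\<lbrakk>p \<in> carrier P; q \<in> carrier P\<rbrakk> \<Longrightarrow> L 0 p q = p 0 \<odot>\<^bsub>P\<^esub> q"
  by (simp add: L_def td)

lemma L_Suc:
  "\<lbrakk>p \<in> carrier P; q \<in> carrier P\<rbrakk> \<Longrightarrow>
    L (Suc N) p q = p (Suc N) \<odot>\<^bsub>P\<^esub> (X ^^ Suc N) q \<oplus>\<^bsub>P\<^esub> L N p q"
  by (simp add: L_def td Xn_closed X_closed Pi_def)

lemma L_bound:
  assumes "p \<in> carrier P" "q \<in> carrier P" "deg R p \<le> N"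
  shows "L N p q = p \<otimes>\<^bsub>E\<^esub> q"
proof -
  have "L N p q = L (deg R p) p q" using assms(3)
  proof (induction N)
    case (Suc N)
    show ?case
    proof (cases "deg R p \<le> N")
      case True
      then have "p (Suc N) = \<zero>" using deg_aboveD[of p "Suc N"] assms by simp
      then have "L (Suc N) p q = L N p q"
        using assms L_closed[of p q N] by (simp add: L_Suc Xn_closed X_closed)
      with Suc True show ?thesis by simp
    next
      case False
      then have "deg R p = Suc N" using Suc.prems by simp
      then show ?thesis by simp
    qed
  qed simp
  then show ?thesis by (simp add: L_def ore_ext_def P_def)
qed

lemma E_simps: "carrier E = carrier P" "\<one>\<^bsub>E\<^esub> = monom P \<one> 0" "\<zero>\<^bsub>E\<^esub> = \<zero>\<^bsub>P\<^esub>" "p \<oplus>\<^bsub>E\<^esub> q = p \<oplus>\<^bsub>P\<^esub> q"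
  by (simp_all add: ore_ext_def P_def)

lemma E_closed: "\<lbrakk>p \<in> carrier P; q \<in> carrier P\<rbrakk> \<Longrightarrow> p \<otimes>\<^bsub>E\<^esub> q \<in> carrier P"
  using L_bound[of p q "deg R p"] L_closed[of p q "deg R p"] by simp

lemma L_r_add:
  assumes "p \<in> carrier P" "q \<in> carrier P" "r \<in> carrier P"
  shows "L N p (q \<oplus>\<^bsub>P\<^esub> r) = L N p q \<oplus>\<^bsub>P\<^esub> L N p r"
  unfolding L_def using assms
  by (subst P.finsum_addf[symmetric])
     (auto simp: td Xn_closed Xn_add UP_smult_r_distr intro!: P.finsum_cong)

lemma L_l_add:
  assumes "p \<in> carrier P" "q \<in> carrier P" "r \<in> carrier P"
  shows "L N (p \<oplus>\<^bsub>P\<^esub> q) r = L N p r \<oplus>\<^bsub>P\<^esub> L N q r"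
  unfolding L_def using assms
  by (subst P.finsum_addf[symmetric])
     (auto simp: td Xn_closed nth_add UP_smult_l_distr intro!: P.finsum_cong)

lemma L_smult:
  assumes "a \<in> carrier R" "p \<in> carrier P" "q \<in> carrier P"
  shows "L N (a \<odot>\<^bsub>P\<^esub> p) q = a \<odot>\<^bsub>P\<^esub> L N p q"
proof (induction N)
  case 0
  then show ?case using assms by (simp add: L_0 td nth_smult[of _ _ 0] UP_smult_assoc1)
next
  case (Suc N)
  show ?case using assms Suc
    by (simp add: L_Suc td nth_smult[of _ _ "Suc N"] Xn_closed X_closed UP_smult_assoc1 UP_smult_r_distr L_closed del: funpow.simps)
qed

lemma L_X:
  assumes "p \<in> carrier P" "q \<in> carrier P" "deg R p \<le> N"
  shows "L (Suc N) (X p) q = X (L N p q)"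
proof -
  have "L (Suc N) (X p) q = X (L N p q) \<oplus>\<^bsub>P\<^esub> \<delta> (p (Suc N)) \<odot>\<^bsub>P\<^esub> (X ^^ Suc N) q" for N
  proof (induction N)
    case 0
    have "L 0 (X p) q = \<delta> (p 0) \<odot>\<^bsub>P\<^esub> q" "L 0 p q = p 0 \<odot>\<^bsub>P\<^esub> q"
      using assms by (simp_all add: L_0 X_closed X_0 td)
    then show ?case using assms
      by (simp add: L_Suc X_closed X_smult td)
         (simp add: X_0 X_Suc td X_closed UP_smult_l_distr P.a_assoc P.a_comm P.a_lcomm)
  next
    case (Suc N)
    have "X p (Suc (Suc N)) = \<tau> (p (Suc N)) \<oplus> \<delta> (p (Suc (Suc N)))"
      by (simp add: X_Suc)
    then show ?case
      using assms Suc
      by (simp add: L_Suc X_closed Xn_closed td L_closed X_add X_smult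
          UP_smult_l_distr P.a_assoc P.a_comm P.a_lcomm)
  qed
  moreover have "p (Suc N) = \<zero>" using deg_aboveD[of p "Suc N"] assms by simp
  ultimately show ?thesis
    using assms by (simp add: td X_closed Xn_closed L_closed)
qed

lemma E_X: "\<lbrakk>p \<in> carrier P; q \<in> carrier P\<rbrakk> \<Longrightarrow> X p \<otimes>\<^bsub>E\<^esub> q = X (p \<otimes>\<^bsub>E\<^esub> q)"
  using L_X[of p q "max (deg R p) (deg R (X p))"] 
  by (simp add: L_bound X_closed)

lemma E_smult: "\<lbrakk>a \<in> carrier R; p \<in> carrier P; q \<in> carrier P\<rbrakk> \<Longrightarrow> (a \<odot>\<^bsub>P\<^esub> p) \<otimes>\<^bsub>E\<^esub> q = a \<odot>\<^bsub>P\<^esub> (p \<otimes>\<^bsub>E\<^esub> q)"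
  using L_smult[of a p q "max (deg R p) (deg R (a \<odot>\<^bsub>P\<^esub> p))"]
  by (simp add: L_bound)

lemma E_l_distr: "\<lbrakk>p \<in> carrier P; q \<in> carrier P; r \<in> carrier P\<rbrakk> \<Longrightarrow>
    (p \<oplus>\<^bsub>P\<^esub> q) \<otimes>\<^bsub>E\<^esub> r = p \<otimes>\<^bsub>E\<^esub> r \<oplus>\<^bsub>P\<^esub> q \<otimes>\<^bsub>E\<^esub> r"
  using L_l_add[of p q r "max (deg R (p \<oplus>\<^bsub>P\<^esub> q)) (max (deg R p) (deg R q))"]
  by (simp add: L_bound)

lemma E_r_distr: "\<lbrakk>p \<in> carrier P; q \<in> carrier P; r \<in> carrier P\<rbrakk> \<Longrightarrow>
    p \<otimes>\<^bsub>E\<^esub> (q \<oplus>\<^bsub>P\<^esub> r) = p \<otimes>\<^bsub>E\<^esub> q \<oplus>\<^bsub>P\<^esub> p \<otimes>\<^bsub>E\<^esub> r"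
  using L_r_add[of p q r "deg R p"] by (simp add: L_bound)

lemma E_Xn: "\<lbrakk>p \<in> carrier P; q \<in> carrier P\<rbrakk> \<Longrightarrow> (X ^^ n) p \<otimes>\<^bsub>E\<^esub> q = (X ^^ n) (p \<otimes>\<^bsub>E\<^esub> q)"
  by (induction n) (simp_all add: E_X Xn_closed)

lemma E_zero_l: "q \<in> carrier P \<Longrightarrow> \<zero>\<^bsub>P\<^esub> \<otimes>\<^bsub>E\<^esub> q = \<zero>\<^bsub>P\<^esub>"
  using E_smult[of \<zero> "\<zero>\<^bsub>P\<^esub>" q] by (simp add: E_closed)

lemma E_assoc:
  assumes "p \<in> carrier P" "q \<in> carrier P" "r \<in> carrier P"
  shows "(p \<otimes>\<^bsub>E\<^esub> q) \<otimes>\<^bsub>E\<^esub> r = p \<otimes>\<^bsub>E\<^esub> (q \<otimes>\<^bsub>E\<^esub> r)"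
proof -
  have "L N p q \<otimes>\<^bsub>E\<^esub> r = L N p (q \<otimes>\<^bsub>E\<^esub> r)" for N
  proof (induction N)
    case 0
    then show ?case using assms by (simp add: L_0 td E_smult E_closed)
  next
    case (Suc N)
    show ?case using assms Suc
      by (simp add: L_Suc E_l_distr E_closed L_closed td Xn_closed E_smult E_Xn del: funpow.simps)
  qed
  from this[of "deg R p"] show ?thesis using assms by (simp add: L_bound E_closed)
qed

lemma E_one_l: "p \<in> carrier P \<Longrightarrow> monom P \<one> 0 \<otimes>\<^bsub>E\<^esub> p = p"
  using L_bound[of "monom P \<one> 0" p 0] deg_monom_le[of \<one> 0]
  by (simp add: L_0 nth_monom[of _ 0 0] del: monom_one)

lemma E_monom: "a \<in> carrier R \<Longrightarrow> ore_const R a \<otimes>\<^bsub>E\<^esub> q = a \<odot>\<^bsub>P\<^esub> q" if "q \<in> carrier P"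
  using that L_bound[of "monom P a 0" q 0] deg_monom_le[of a 0]
  by (simp add: L_0 nth_monom[of _ 0 0] ore_const_def P_def[symmetric] del: monom_one)

lemma L_one: 
  assumes "p \<in> carrier P" 
  shows "L N p (monom P \<one> 0) n = (if n \<le> N then p n else \<zero>)"
proof (induction N)
  case 0
  show ?case using assms by (simp add: L_0 td nth_smult[of _ _ n] nth_monom[of _ _ n] del: monom_one)
next
  case (Suc N)
  then show ?case using assms
    by (simp add: L_Suc Xn_monom nth_add[of _ _ n] L_closed nth_smult[of _ _ n] nth_monom[of _ _ n] td del: funpow.simps monom_one)
       (auto simp: le_Suc_eq)
qed

lemma E_one_r: "p \<in> carrier P \<Longrightarrow> p \<otimes>\<^bsub>E\<^esub> monom P \<one> 0 = p"
proof (rule up_fun_eqI)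
  fix n assume p: "p \<in> carrier P"
  show "(p \<otimes>\<^bsub>E\<^esub> monom P \<one> 0) n = p n"
    using L_one[OF p, of "deg R p" n] deg_aboveD[of p n] p by (simp add: L_bound del: monom_one split: if_splits)
qed (auto simp: E_closed)

theorem ore_ext_ring: "ring E"
proof (rule ringI)
  show "abelian_group E"
    by (rule abelian_groupI)
       (auto simp: E_simps P.a_assoc P.l_neg intro: P.a_comm bexI[of _ "\<ominus>\<^bsub>P\<^esub> _"])
  show "Group.monoid E"
    by (rule monoidI) (auto simp: E_simps E_closed E_assoc E_one_l E_one_r simp del: monom_one)
qed (auto simp: E_simps E_l_distr E_r_distr)

lemma ore_const_closed: "a \<in> carrier R \<Longrightarrow> ore_const R a \<in> carrier P"
  by (simp add: ore_const_def P_def[symmetric])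

theorem ore_const_hom: "ore_const R \<in> ring_hom R E"
  by (rule ring_hom_memI)
     (simp_all add: E_simps E_monom ore_const_closed, simp_all add: ore_const_def P_def[symmetric] monom_mult_smult)

theorem ore_const_inj: "inj_on (ore_const R) (carrier R)"
  unfolding ore_const_def P_def[symmetric] by (rule monom_inj)

lemma ore_var_X: "ore_var R = X (monom P \<one> 0)"
  using Xn_monom[of 1] by (simp add: ore_var_def P_def[symmetric])

lemma E_var: "q \<in> carrier P \<Longrightarrow> ore_var R \<otimes>\<^bsub>E\<^esub> q = X q"
  using E_X[of "monom P \<one> 0" q] by (simp add: ore_var_X E_one_l del: monom_one)

theorem ore_var_mult:
  assumes "r \<in> carrier R"
  shows "ore_var R \<otimes>\<^bsub>E\<^esub> ore_const R r =
    ore_const R (\<tau> r) \<otimes>\<^bsub>E\<^esub> ore_var R \<oplus>\<^bsub>E\<^esub> ore_const R (\<delta> r)"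
proof (rule up_fun_eqI)
  fix n
  have c: "ore_const R a = monom P a 0" for a
    by (simp add: ore_const_def P_def)
  have v: "ore_var R = monom P \<one> 1"
    by (simp add: ore_var_def P_def)
  have 1: "ore_var R \<otimes>\<^bsub>E\<^esub> ore_const R r = X (monom P r 0)"
    using assms by (simp add: E_var c)
  have 2: "ore_const R (\<tau> r) \<otimes>\<^bsub>E\<^esub> ore_var R \<oplus>\<^bsub>E\<^esub> ore_const R (\<delta> r) =
      \<tau> r \<odot>\<^bsub>P\<^esub> monom P \<one> 1 \<oplus>\<^bsub>P\<^esub> monom P (\<delta> r) 0"
    using assms by (simp add: E_simps E_monom td v) (simp add: c)
  show "(ore_var R \<otimes>\<^bsub>E\<^esub> ore_const R r) n =
      (ore_const R (\<tau> r) \<otimes>\<^bsub>E\<^esub> ore_var R \<oplus>\<^bsub>E\<^esub> ore_const R (\<delta> r)) n"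
    unfolding 1 2 using assms
    by (cases n) (auto simp: X_0 X_Suc nth_monom nth_add nth_smult td)
  show "ore_var R \<otimes>\<^bsub>E\<^esub> ore_const R r \<in> carrier P"
    unfolding 1 using assms by (simp add: X_closed)
  show "ore_const R (\<tau> r) \<otimes>\<^bsub>E\<^esub> ore_var R \<oplus>\<^bsub>E\<^esub> ore_const R (\<delta> r) \<in> carrier P"
    unfolding 2 using assms by (simp add: td)
qed

lemma ore_var_pow: "ore_var R [^]\<^bsub>E\<^esub> n = monom P \<one> n" for n :: nat
proof (induction n)
  case 0
  show ?case by (simp add: E_simps nat_pow_def)
next
  case (Suc n)
  have "ore_var R [^]\<^bsub>E\<^esub> Suc n = (X ^^ n) (monom P \<one> 0) \<otimes>\<^bsub>E\<^esub> ore_var R"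
    using Suc by (simp add: nat_pow_def Xn_monom del: monom_one)
  also have "\<dots> = (X ^^ n) (X (monom P \<one> 0))"
    by (simp add: E_Xn E_one_l ore_var_X X_closed del: monom_one)
  also have "\<dots> = monom P \<one> (Suc n)"
    using Xn_monom[of "Suc n"] by (simp add: funpow_swap1)
  finally show ?case .
qed

theorem ore_ext_basis:
  assumes "s \<in> carrier E"
  shows "\<exists>!a. a \<in> up R \<and> s = (\<Oplus>\<^bsub>E\<^esub> i\<in>{..deg R a}. ore_const R (a i) \<otimes>\<^bsub>E\<^esub> ore_var R [^]\<^bsub>E\<^esub> i)"
proof -
  have fs: "finsum E = finsum P"
    by (intro ext) (simp add: finsum_def finprod_def ore_ext_def P_def)
  have "(\<Oplus>\<^bsub>E\<^esub> i\<in>{..deg R a}. ore_const R (a i) \<otimes>\<^bsub>E\<^esub> ore_var R [^]\<^bsub>E\<^esub> i) = a" if "a \<in> up R" for a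
  proof -
    have a: "a \<in> carrier P" using that by (simp add: carP)
    have "(\<Oplus>\<^bsub>E\<^esub> i\<in>{..deg R a}. ore_const R (a i) \<otimes>\<^bsub>E\<^esub> ore_var R [^]\<^bsub>E\<^esub> i) = L (deg R a) a (monom P \<one> 0)"
      using a by (simp add: fs L_def ore_var_pow E_monom Xn_monom td del: monom_one)
    also have "\<dots> = a" using a by (simp add: L_bound E_one_r del: monom_one)
    finally show ?thesis .
  qed
  then show ?thesis using assms by (auto simp: E_simps carP)
qed

end


section \<open>Amalgamated products\<close>

text \<open>
  The pushout of \<open>f : R \<rightarrow> S\<^sub>1\<close> and \<open>g : R \<rightarrow> S\<^sub>2\<close> in the category of rings, by generators and relations:
  ring expressions in the elements of \<open>S\<^sub>1\<close> and \<open>S\<^sub>2\<close> modulo the congruence generated by the ring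
  axioms, by \<open>S\<^sub>1\<close> and \<open>S\<^sub>2\<close> mapping homomorphically, and by \<open>f r = g r\<close>.  The universal property,
  for test rings of arbitrary type, is \<open>amalgam_universal\<close> below.
\<close>

datatype ('a, 'b) aterm =
    InL 'a | InR 'b | AZero | AOne
  | AAdd "('a, 'b) aterm" "('a, 'b) aterm"
  | ANeg "('a, 'b) aterm"
  | AMul "('a, 'b) aterm" "('a, 'b) aterm"

inductive_set aterms :: "('a, 'm) ring_scheme \<Rightarrow> ('b, 'n) ring_scheme \<Rightarrow> ('a, 'b) aterm set"
  for S1 :: "('a, 'm) ring_scheme" and S2 :: "('b, 'n) ring_scheme" where
  "a \<in> carrier S1 \<Longrightarrow> InL a \<in> aterms S1 S2"
| "b \<in> carrier S2 \<Longrightarrow> InR b \<in> aterms S1 S2"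
| "AZero \<in> aterms S1 S2"
| "AOne \<in> aterms S1 S2"
| "\<lbrakk>t \<in> aterms S1 S2; u \<in> aterms S1 S2\<rbrakk> \<Longrightarrow> AAdd t u \<in> aterms S1 S2"
| "t \<in> aterms S1 S2 \<Longrightarrow> ANeg t \<in> aterms S1 S2"
| "\<lbrakk>t \<in> aterms S1 S2; u \<in> aterms S1 S2\<rbrakk> \<Longrightarrow> AMul t u \<in> aterms S1 S2"

inductive aeq ::
    "('r, 'k) ring_scheme \<Rightarrow> ('a, 'm) ring_scheme \<Rightarrow> ('b, 'n) ring_scheme \<Rightarrow>
     ('r \<Rightarrow> 'a) \<Rightarrow> ('r \<Rightarrow> 'b) \<Rightarrow> ('a, 'b) aterm \<Rightarrow> ('a, 'b) aterm \<Rightarrow> bool"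
  for R :: "('r, 'k) ring_scheme" and S1 :: "('a, 'm) ring_scheme" and S2 :: "('b, 'n) ring_scheme"
    and f :: "'r \<Rightarrow> 'a" and g :: "'r \<Rightarrow> 'b" where
  refl: "t \<in> aterms S1 S2 \<Longrightarrow> aeq R S1 S2 f g t t"
| sym: "aeq R S1 S2 f g t u \<Longrightarrow> aeq R S1 S2 f g u t"
| trans: "\<lbrakk>aeq R S1 S2 f g t u; aeq R S1 S2 f g u v\<rbrakk> \<Longrightarrow> aeq R S1 S2 f g t v"
| cong_add: "\<lbrakk>aeq R S1 S2 f g t t'; aeq R S1 S2 f g u u'\<rbrakk> \<Longrightarrow>
    aeq R S1 S2 f g (AAdd t u) (AAdd t' u')"
| cong_neg: "aeq R S1 S2 f g t t' \<Longrightarrow> aeq R S1 S2 f g (ANeg t) (ANeg t')"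
| cong_mul: "\<lbrakk>aeq R S1 S2 f g t t'; aeq R S1 S2 f g u u'\<rbrakk> \<Longrightarrow>
    aeq R S1 S2 f g (AMul t u) (AMul t' u')"
| add_assoc: "\<lbrakk>t \<in> aterms S1 S2; u \<in> aterms S1 S2; v \<in> aterms S1 S2\<rbrakk> \<Longrightarrow>
    aeq R S1 S2 f g (AAdd (AAdd t u) v) (AAdd t (AAdd u v))"
| add_comm: "\<lbrakk>t \<in> aterms S1 S2; u \<in> aterms S1 S2\<rbrakk> \<Longrightarrow>
    aeq R S1 S2 f g (AAdd t u) (AAdd u t)"
| add_zero: "t \<in> aterms S1 S2 \<Longrightarrow> aeq R S1 S2 f g (AAdd AZero t) t"
| add_neg: "t \<in> aterms S1 S2 \<Longrightarrow> aeq R S1 S2 f g (AAdd (ANeg t) t) AZero"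
| mul_assoc: "\<lbrakk>t \<in> aterms S1 S2; u \<in> aterms S1 S2; v \<in> aterms S1 S2\<rbrakk> \<Longrightarrow>
    aeq R S1 S2 f g (AMul (AMul t u) v) (AMul t (AMul u v))"
| one_mul: "t \<in> aterms S1 S2 \<Longrightarrow> aeq R S1 S2 f g (AMul AOne t) t"
| mul_one: "t \<in> aterms S1 S2 \<Longrightarrow> aeq R S1 S2 f g (AMul t AOne) t"
| add_mul: "\<lbrakk>t \<in> aterms S1 S2; u \<in> aterms S1 S2; v \<in> aterms S1 S2\<rbrakk> \<Longrightarrow>
    aeq R S1 S2 f g (AMul (AAdd t u) v) (AAdd (AMul t v) (AMul u v))"
| mul_add: "\<lbrakk>t \<in> aterms S1 S2; u \<in> aterms S1 S2; v \<in> aterms S1 S2\<rbrakk> \<Longrightarrow>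
    aeq R S1 S2 f g (AMul t (AAdd u v)) (AAdd (AMul t u) (AMul t v))"
| inl_add: "\<lbrakk>a \<in> carrier S1; a' \<in> carrier S1\<rbrakk> \<Longrightarrow>
    aeq R S1 S2 f g (InL (a \<oplus>\<^bsub>S1\<^esub> a')) (AAdd (InL a) (InL a'))"
| inl_mul: "\<lbrakk>a \<in> carrier S1; a' \<in> carrier S1\<rbrakk> \<Longrightarrow>
    aeq R S1 S2 f g (InL (a \<otimes>\<^bsub>S1\<^esub> a')) (AMul (InL a) (InL a'))"
| inl_one: "aeq R S1 S2 f g (InL \<one>\<^bsub>S1\<^esub>) AOne"
| inr_add: "\<lbrakk>b \<in> carrier S2; b' \<in> carrier S2\<rbrakk> \<Longrightarrow>
    aeq R S1 S2 f g (InR (b \<oplus>\<^bsub>S2\<^esub> b')) (AAdd (InR b) (InR b'))"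
| inr_mul: "\<lbrakk>b \<in> carrier S2; b' \<in> carrier S2\<rbrakk> \<Longrightarrow>
    aeq R S1 S2 f g (InR (b \<otimes>\<^bsub>S2\<^esub> b')) (AMul (InR b) (InR b'))"
| inr_one: "aeq R S1 S2 f g (InR \<one>\<^bsub>S2\<^esub>) AOne"
| amalg: "r \<in> carrier R \<Longrightarrow> aeq R S1 S2 f g (InL (f r)) (InR (g r))"

definition aclass ::
    "('r, 'k) ring_scheme \<Rightarrow> ('a, 'm) ring_scheme \<Rightarrow> ('b, 'n) ring_scheme \<Rightarrow>
     ('r \<Rightarrow> 'a) \<Rightarrow> ('r \<Rightarrow> 'b) \<Rightarrow> ('a, 'b) aterm \<Rightarrow> ('a, 'b) aterm set" where
  "aclass R S1 S2 f g t = {u. aeq R S1 S2 f g t u}"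

definition amalgam ::
    "('r, 'k) ring_scheme \<Rightarrow> ('a, 'm) ring_scheme \<Rightarrow> ('b, 'n) ring_scheme \<Rightarrow>
     ('r \<Rightarrow> 'a) \<Rightarrow> ('r \<Rightarrow> 'b) \<Rightarrow> ('a, 'b) aterm set ring" where
  "amalgam R S1 S2 f g =
     \<lparr> carrier = aclass R S1 S2 f g ` aterms S1 S2,
       mult = (\<lambda>A B. \<Union>t\<in>A. \<Union>u\<in>B. aclass R S1 S2 f g (AMul t u)),
       one = aclass R S1 S2 f g AOne,
       zero = aclass R S1 S2 f g AZero,
       add = (\<lambda>A B. \<Union>t\<in>A. \<Union>u\<in>B. aclass R S1 S2 f g (AAdd t u)) \<rparr>"

definition amalgam_inl where
  "amalgam_inl R S1 S2 f g a = aclass R S1 S2 f g (InL a)"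

definition amalgam_inr where
  "amalgam_inr R S1 S2 f g b = aclass R S1 S2 f g (InR b)"


lemma UN2_const:
  "\<lbrakk>t \<in> A; u \<in> B; \<And>t' u'. \<lbrakk>t' \<in> A; u' \<in> B\<rbrakk> \<Longrightarrow> F t' u' = C\<rbrakk> \<Longrightarrow> (\<Union>t'\<in>A. \<Union>u'\<in>B. F t' u') = C"
  by fastforce

lemmas aeq_axioms =
  aeq.add_assoc aeq.add_comm aeq.add_zero aeq.add_neg 
  aeq.mul_assoc aeq.one_mul aeq.mul_one aeq.add_mul aeq.mul_add 
  aeq.inl_add aeq.inl_mul aeq.inl_one aeq.inr_add aeq.inr_mul aeq.inr_one

lemma aclass_eq_iff:
  assumes "t \<in> aterms S1 S2"
  shows "aclass R S1 S2 f g t = aclass R S1 S2 f g u \<longleftrightarrow> aeq R S1 S2 f g t u"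
proof
  assume "aclass R S1 S2 f g t = aclass R S1 S2 f g u"
  moreover have "t \<in> aclass R S1 S2 f g t"
    using assms by (simp add: aclass_def aeq.refl)
  ultimately show "aeq R S1 S2 f g t u" by (auto simp: aclass_def intro: aeq.sym)
next
  assume "aeq R S1 S2 f g t u"
  then show "aclass R S1 S2 f g t = aclass R S1 S2 f g u"
    unfolding aclass_def by (blast intro: aeq.sym aeq.trans)
qed

lemma amalgam_mult:
  assumes "t \<in> aterms S1 S2" "u \<in> aterms S1 S2"
  shows "aclass R S1 S2 f g t \<otimes>\<^bsub>amalgam R S1 S2 f g\<^esub> aclass R S1 S2 f g u = aclass R S1 S2 f g (AMul t u)"
proof -
  have "aclass R S1 S2 f g (AMul t' u') = aclass R S1 S2 f g (AMul t u)"
    if "t' \<in> aclass R S1 S2 f g t" "u' \<in> aclass R S1 S2 f g u" for t' u'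
  proof -
    have "aeq R S1 S2 f g (AMul t u) (AMul t' u')"
      using that unfolding aclass_def mem_Collect_eq by (rule aeq.cong_mul)
    then show ?thesis using aclass_eq_iff[of "AMul t u"] aterms.intros(7)[OF assms] by metis
  qed
  moreover have "t \<in> aclass R S1 S2 f g t" "u \<in> aclass R S1 S2 f g u"
    using assms by (simp_all add: aclass_def aeq.refl)
  ultimately have "(\<Union>t'\<in>aclass R S1 S2 f g t. \<Union>u'\<in>aclass R S1 S2 f g u.
      aclass R S1 S2 f g (AMul t' u')) = aclass R S1 S2 f g (AMul t u)"
    by (intro UN2_const)
  then show ?thesis by (simp add: amalgam_def)
qed

lemma amalgam_add:
  assumes "t \<in> aterms S1 S2" "u \<in> aterms S1 S2"
  shows "aclass R S1 S2 f g t \<oplus>\<^bsub>amalgam R S1 S2 f g\<^esub> aclass R S1 S2 f g u = aclass R S1 S2 f g (AAdd t u)"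
proof -
  have "aclass R S1 S2 f g (AAdd t' u') = aclass R S1 S2 f g (AAdd t u)"
    if "t' \<in> aclass R S1 S2 f g t" "u' \<in> aclass R S1 S2 f g u" for t' u'
  proof -
    have "aeq R S1 S2 f g (AAdd t u) (AAdd t' u')"
      using that unfolding aclass_def mem_Collect_eq by (rule aeq.cong_add)
    then show ?thesis using aclass_eq_iff[of "AAdd t u"] aterms.intros(5)[OF assms] by metis
  qed
  moreover have "t \<in> aclass R S1 S2 f g t" "u \<in> aclass R S1 S2 f g u"
    using assms by (simp_all add: aclass_def aeq.refl)
  ultimately have "(\<Union>t'\<in>aclass R S1 S2 f g t. \<Union>u'\<in>aclass R S1 S2 f g u.
      aclass R S1 S2 f g (AAdd t' u')) = aclass R S1 S2 f g (AAdd t u)"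
    by (intro UN2_const)
  then show ?thesis by (simp add: amalgam_def)
qed

lemma amalgam_ring: "ring (amalgam R S1 S2 f g)" (is "ring ?A")
proof -
  let ?c = "aclass R S1 S2 f g"
  have car: "carrier ?A = ?c ` aterms S1 S2"
    and one: "\<one>\<^bsub>?A\<^esub> = ?c AOne" and zero: "\<zero>\<^bsub>?A\<^esub> = ?c AZero"
    by (simp_all add: amalgam_def)
  note S = amalgam_mult amalgam_add aterms.intros aclass_eq_iff aeq_axioms
  show ?thesis
  proof (rule ringI)
    show "abelian_group ?A"
    proof (rule abelian_groupI)
      fix x assume "x \<in> carrier ?A"
      then obtain t where "t \<in> aterms S1 S2" "x = ?c t" by (auto simp: car)
      then show "\<exists>y\<in>carrier ?A. y \<oplus>\<^bsub>?A\<^esub> x = \<zero>\<^bsub>?A\<^esub>"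
        by (intro bexI[of _ "?c (ANeg t)"]) (simp_all add: car zero S imageI)
    qed (((unfold car zero)?; (elim imageE)?; simp add: S imageI)+)
    show "Group.monoid ?A"
      by (rule monoidI; unfold car one; (elim imageE)?; simp add: S imageI)
  qed (((unfold car)?; (elim imageE)?; simp add: S)+)
qed

lemma amalgam_inl_hom: "amalgam_inl R S1 S2 f g \<in> ring_hom S1 (amalgam R S1 S2 f g)"
proof (rule ring_hom_memI)
  have "aeq R S1 S2 f g AOne (InL \<one>\<^bsub>S1\<^esub>)" by (intro aeq.sym[OF aeq.inl_one])
  then show "amalgam_inl R S1 S2 f g \<one>\<^bsub>S1\<^esub> = \<one>\<^bsub>amalgam R S1 S2 f g\<^esub>"
    by (simp add: aclass_eq_iff[OF aterms.intros(4), symmetric] amalgam_inl_def amalgam_def)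
  fix x assume x: "x \<in> carrier S1"
  then show "amalgam_inl R S1 S2 f g x \<in> carrier (amalgam R S1 S2 f g)"
    by (simp add: amalgam_inl_def amalgam_def aterms.intros imageI)
  fix y assume y: "y \<in> carrier S1"
  have "aeq R S1 S2 f g (AMul (InL x) (InL y)) (InL (x \<otimes>\<^bsub>S1\<^esub> y))"
    "aeq R S1 S2 f g (AAdd (InL x) (InL y)) (InL (x \<oplus>\<^bsub>S1\<^esub> y))"
    using x y by (auto intro!: aeq.sym[OF aeq.inl_mul] aeq.sym[OF aeq.inl_add])
  then show "amalgam_inl R S1 S2 f g (x \<otimes>\<^bsub>S1\<^esub> y) =
      amalgam_inl R S1 S2 f g x \<otimes>\<^bsub>amalgam R S1 S2 f g\<^esub> amalgam_inl R S1 S2 f g y"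
    "amalgam_inl R S1 S2 f g (x \<oplus>\<^bsub>S1\<^esub> y) =
      amalgam_inl R S1 S2 f g x \<oplus>\<^bsub>amalgam R S1 S2 f g\<^esub> amalgam_inl R S1 S2 f g y"
    using x y by (simp_all add: imageI amalgam_inl_def amalgam_mult amalgam_add aterms.intros
        aclass_eq_iff[symmetric])
qed

lemma amalgam_inr_hom: "amalgam_inr R S1 S2 f g \<in> ring_hom S2 (amalgam R S1 S2 f g)"
proof (rule ring_hom_memI)
  have "aeq R S1 S2 f g AOne (InR \<one>\<^bsub>S2\<^esub>)" by (intro aeq.sym[OF aeq.inr_one])
  then show "amalgam_inr R S1 S2 f g \<one>\<^bsub>S2\<^esub> = \<one>\<^bsub>amalgam R S1 S2 f g\<^esub>"
    by (simp add: aclass_eq_iff[OF aterms.intros(4), symmetric] amalgam_inr_def amalgam_def)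
  fix x assume x: "x \<in> carrier S2"
  then show "amalgam_inr R S1 S2 f g x \<in> carrier (amalgam R S1 S2 f g)"
    by (simp add: amalgam_inr_def amalgam_def aterms.intros imageI)
  fix y assume y: "y \<in> carrier S2"
  have "aeq R S1 S2 f g (AMul (InR x) (InR y)) (InR (x \<otimes>\<^bsub>S2\<^esub> y))"
    "aeq R S1 S2 f g (AAdd (InR x) (InR y)) (InR (x \<oplus>\<^bsub>S2\<^esub> y))"
    using x y by (auto intro!: aeq.sym[OF aeq.inr_mul] aeq.sym[OF aeq.inr_add])
  then show "amalgam_inr R S1 S2 f g (x \<otimes>\<^bsub>S2\<^esub> y) =
      amalgam_inr R S1 S2 f g x \<otimes>\<^bsub>amalgam R S1 S2 f g\<^esub> amalgam_inr R S1 S2 f g y"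
    "amalgam_inr R S1 S2 f g (x \<oplus>\<^bsub>S2\<^esub> y) =
      amalgam_inr R S1 S2 f g x \<oplus>\<^bsub>amalgam R S1 S2 f g\<^esub> amalgam_inr R S1 S2 f g y"
    using x y by (simp_all add: imageI amalgam_inr_def amalgam_mult amalgam_add aterms.intros
        aclass_eq_iff[symmetric])
qed

lemma amalgam_commutes:
  assumes "f r \<in> carrier S1" "r \<in> carrier R" 
  shows "amalgam_inl R S1 S2 f g (f r) = amalgam_inr R S1 S2 f g (g r)"
  using assms by (simp add: amalgam_inl_def amalgam_inr_def aclass_eq_iff aterms.intros aeq.amalg)

primrec aeval ::
    "('c, 'k) ring_scheme \<Rightarrow> ('a \<Rightarrow> 'c) \<Rightarrow> ('b \<Rightarrow> 'c) \<Rightarrow> ('a, 'b) aterm \<Rightarrow> 'c" where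
  "aeval T h k (InL a) = h a"
| "aeval T h k (InR b) = k b"
| "aeval T h k AZero = \<zero>\<^bsub>T\<^esub>"
| "aeval T h k AOne = \<one>\<^bsub>T\<^esub>"
| "aeval T h k (AAdd t u) = aeval T h k t \<oplus>\<^bsub>T\<^esub> aeval T h k u"
| "aeval T h k (ANeg t) = \<ominus>\<^bsub>T\<^esub> aeval T h k t"
| "aeval T h k (AMul t u) = aeval T h k t \<otimes>\<^bsub>T\<^esub> aeval T h k u"

lemma aeval_closed:
  assumes "ring T" "h \<in> ring_hom S1 T" "k \<in> ring_hom S2 T" "t \<in> aterms S1 S2"
  shows "aeval T h k t \<in> carrier T"
proof -
  interpret T: ring T by fact
  show ?thesis using assms(4)
    by induction (auto simp: ring_hom_closed[OF assms(2)] ring_hom_closed[OF assms(3)])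
qed

lemma aeval_cong:
  assumes "ring T" "h \<in> ring_hom S1 T" "k \<in> ring_hom S2 T"
    and "\<And>r. r \<in> carrier R \<Longrightarrow> h (f r) = k (g r)"
    and "aeq R S1 S2 f g t u"
  shows "aeval T h k t = aeval T h k u"
proof -
  interpret T: ring T by fact
  note cl = aeval_closed[OF assms(1-3)]
  show ?thesis using assms(5)
    by (induction rule: aeq.induct)
       (simp_all add: cl assms(4) T.a_assoc T.m_assoc T.l_distr T.r_distr T.l_neg T.a_comm T.a_lcomm T.r_neg
          ring_hom_add[OF assms(2)] ring_hom_mult[OF assms(2)] ring_hom_one[OF assms(2)]
          ring_hom_add[OF assms(3)] ring_hom_mult[OF assms(3)] ring_hom_one[OF assms(3)])
qed

theorem amalgam_universal:
  assumes "ring T" "h \<in> ring_hom S1 T" "k \<in> ring_hom S2 T"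
    and "\<And>r. r \<in> carrier R \<Longrightarrow> h (f r) = k (g r)"
  shows "\<exists>!\<phi>. \<phi> \<in> extensional (carrier (amalgam R S1 S2 f g)) \<and>
           \<phi> \<in> ring_hom (amalgam R S1 S2 f g) T \<and>
           (\<forall>a\<in>carrier S1. \<phi> (amalgam_inl R S1 S2 f g a) = h a) \<and>
           (\<forall>b\<in>carrier S2. \<phi> (amalgam_inr R S1 S2 f g b) = k b)"
    (is "\<exists>!\<phi>. ?P \<phi>")
proof -
  let ?A = "amalgam R S1 S2 f g" and ?c = "aclass R S1 S2 f g"
  interpret T: ring T by fact
  interpret A: ring ?A by (rule amalgam_ring)
  note cl = aeval_closed[OF assms(1-3)]
  have car: "carrier ?A = ?c ` aterms S1 S2"
    and one: "\<one>\<^bsub>?A\<^esub> = ?c AOne" and zero: "\<zero>\<^bsub>?A\<^esub> = ?c AZero"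
    by (simp_all add: amalgam_def)
  define \<phi> where "\<phi> = restrict (\<lambda>A. aeval T h k (SOME t. t \<in> A)) (carrier ?A)"
  have \<phi>: "\<phi> (?c t) = aeval T h k t" if t: "t \<in> aterms S1 S2" for t
  proof -
    have "t \<in> ?c t" using t by (simp add: aclass_def aeq.refl)
    then have "(SOME t'. t' \<in> ?c t) \<in> ?c t" by (rule someI)
    then have "aeq R S1 S2 f g t (SOME t'. t' \<in> ?c t)" by (simp add: aclass_def)
    then have "aeval T h k t = aeval T h k (SOME t'. t' \<in> ?c t)"
      by (rule aeval_cong[OF assms(1-3), rotated]) (rule assms(4))
    then show ?thesis using t by (simp add: \<phi>_def car)
  qed
  have "?P \<phi>"
  proof (intro conjI ballI)
    show "\<phi> \<in> ring_hom ?A T"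
      by (rule ring_hom_memI)
         (auto simp: car one \<phi> cl amalgam_mult amalgam_add aterms.intros)
    show "\<phi> \<in> extensional (carrier ?A)" by (simp add: \<phi>_def)
  qed (auto simp: \<phi> amalgam_inl_def amalgam_inr_def aterms.intros)
  moreover have "\<psi> = \<phi>" if \<psi>: "?P \<psi>" for \<psi>
  proof -
    have hom: "\<psi> \<in> ring_hom ?A T" using \<psi> by blast
    have "\<psi> (?c t) = aeval T h k t" if "t \<in> aterms S1 S2" for t
      using that
    proof induction
      case (3)
      have "\<psi> \<zero>\<^bsub>?A\<^esub> = \<zero>\<^bsub>T\<^esub>" using hom A.ring_axioms T.ring_axioms by (rule ring_hom_zero)
      then show ?case by (simp add: zero)
    next
      case (4)
      show ?case using ring_hom_one[OF hom] by (simp add: one)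
    next
      case (5 t u)
      then show ?case using ring_hom_add[OF hom, of "?c t" "?c u"] by (simp add: car amalgam_add)
    next
      case (7 t u)
      then show ?case using ring_hom_mult[OF hom, of "?c t" "?c u"] by (simp add: car amalgam_mult)
    next
      case (6 t)
      have "?c (ANeg t) \<oplus>\<^bsub>?A\<^esub> ?c t = \<zero>\<^bsub>?A\<^esub>"
        using 6 by (simp add: amalgam_add zero aclass_eq_iff aterms.intros aeq.add_neg)
      moreover have "\<psi> \<zero>\<^bsub>?A\<^esub> = \<zero>\<^bsub>T\<^esub>" using hom A.ring_axioms T.ring_axioms by (rule ring_hom_zero)
      ultimately have "\<psi> (?c (ANeg t)) \<oplus>\<^bsub>T\<^esub> \<psi> (?c t) = \<zero>\<^bsub>T\<^esub>"
        using ring_hom_add[OF hom, of "?c (ANeg t)" "?c t"] 6 by (simp add: car aterms.intros)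
      moreover have "\<psi> (?c (ANeg t)) \<in> carrier T"
        using ring_hom_closed[OF hom] 6 by (simp add: car aterms.intros)
      ultimately show ?case using 6 by (simp add: T.minus_equality cl)
    qed (use \<psi> in \<open>auto simp: amalgam_inl_def amalgam_inr_def\<close>)
    then have "\<psi> A = \<phi> A" if "A \<in> carrier ?A" for A
      using that by (auto simp: car \<phi>)
    moreover have "\<phi> \<in> extensional (carrier ?A)" by (simp add: \<phi>_def)
    ultimately show "\<psi> = \<phi>"
      using \<psi> by (blast intro: extensionalityI)
  qed
  ultimately show ?thesis by blast
qed


section \<open>Right rings of fractions\<close>

definition right_denominator_set :: "'a set \<Rightarrow> ('a, 'm) ring_scheme \<Rightarrow> bool" where
  "right_denominator_set X S \<longleftrightarrow>
     submonoid X S \<and>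
     (\<forall>s\<in>carrier S. \<forall>x\<in>X. \<exists>s'\<in>carrier S. \<exists>x'\<in>X. s \<otimes>\<^bsub>S\<^esub> x' = x \<otimes>\<^bsub>S\<^esub> s') \<and>
     (\<forall>s\<in>carrier S. \<forall>x\<in>X. x \<otimes>\<^bsub>S\<^esub> s = \<zero>\<^bsub>S\<^esub> \<longrightarrow> (\<exists>x'\<in>X. s \<otimes>\<^bsub>S\<^esub> x' = \<zero>\<^bsub>S\<^esub>))"

text \<open>
  \<open>rfrac S X s x\<close> is the fraction \<open>s x\<^sup>-\<^sup>1\<close>, i.e. the set of all pairs that agree with \<open>(s, x)\<close>
  after bringing both to a common denominator in \<open>X\<close>.
\<close>

definition rfrac :: "('a, 'm) ring_scheme \<Rightarrow> 'a set \<Rightarrow> 'a \<Rightarrow> 'a \<Rightarrow> ('a \<times> 'a) set" where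
  "rfrac S X s x =
     {(t, y). t \<in> carrier S \<and> y \<in> X \<and>
        (\<exists>c\<in>carrier S. \<exists>d\<in>carrier S.
           s \<otimes>\<^bsub>S\<^esub> c = t \<otimes>\<^bsub>S\<^esub> d \<and> x \<otimes>\<^bsub>S\<^esub> c = y \<otimes>\<^bsub>S\<^esub> d \<and> x \<otimes>\<^bsub>S\<^esub> c \<in> X)}"

text \<open>
  Ore's construction of \<open>S X\<^sup>-\<^sup>1\<close>.  The products are \<open>a x\<^sup>-\<^sup>1 \<cdot> b y\<^sup>-\<^sup>1 = (a c) (y z)\<^sup>-\<^sup>1\<close> where \<open>x c = b z\<close>
  with \<open>z \<in> X\<close>, the sums \<open>a x\<^sup>-\<^sup>1 + b y\<^sup>-\<^sup>1 = (a c + b d) (x c)\<^sup>-\<^sup>1\<close> where \<open>x c = y d \<in> X\<close>.  The unions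
  below range over all choices; for a right denominator set every choice gives the same class
  (\<open>rfrac_mult\<close>, \<open>rfrac_add\<close>).
\<close>

definition right_fractions :: "('a, 'm) ring_scheme \<Rightarrow> 'a set \<Rightarrow> ('a \<times> 'a) set ring" where
  "right_fractions S X =
     \<lparr> carrier = {rfrac S X s x | s x. s \<in> carrier S \<and> x \<in> X},
       mult = (\<lambda>A B. \<Union>{rfrac S X (a \<otimes>\<^bsub>S\<^esub> c) (y \<otimes>\<^bsub>S\<^esub> z) | a x b y c z.
                 (a, x) \<in> A \<and> (b, y) \<in> B \<and> c \<in> carrier S \<and> z \<in> X \<and> x \<otimes>\<^bsub>S\<^esub> c = b \<otimes>\<^bsub>S\<^esub> z}),
       one = rfrac S X \<one>\<^bsub>S\<^esub> \<one>\<^bsub>S\<^esub>,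
       zero = rfrac S X \<zero>\<^bsub>S\<^esub> \<one>\<^bsub>S\<^esub>,
       add = (\<lambda>A B. \<Union>{rfrac S X (a \<otimes>\<^bsub>S\<^esub> c \<oplus>\<^bsub>S\<^esub> b \<otimes>\<^bsub>S\<^esub> d) (x \<otimes>\<^bsub>S\<^esub> c) | a x b y c d.
                 (a, x) \<in> A \<and> (b, y) \<in> B \<and> c \<in> carrier S \<and> d \<in> carrier S \<and>
                 x \<otimes>\<^bsub>S\<^esub> c = y \<otimes>\<^bsub>S\<^esub> d \<and> x \<otimes>\<^bsub>S\<^esub> c \<in> X}) \<rparr>"

definition rfrac_emb :: "('a, 'm) ring_scheme \<Rightarrow> 'a set \<Rightarrow> 'a \<Rightarrow> ('a \<times> 'a) set" where
  "rfrac_emb S X s = rfrac S X s \<one>\<^bsub>S\<^esub>"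

text \<open>
  The defining properties of a right ring of fractions: \<open>S \<rightarrow> S X\<^sup>-\<^sup>1\<close> is a ring homomorphism inverting \<open>X\<close>,
  every element is \<open>s x\<^sup>-\<^sup>1\<close>, and the kernel consists of the elements killed on the right by \<open>X\<close>;
  see \<open>rfrac_emb_hom\<close>, \<open>rfrac_emb_unit\<close>, \<open>rfrac_eq\<close> and \<open>rfrac_emb_kernel\<close>.
\<close>

locale right_denom = ring S for S (structure) +
  fixes X :: "'a set"
  assumes denom: "right_denominator_set X S"
begin

abbreviation F where "F \<equiv> rfrac S X"
abbreviation Q where "Q \<equiv> right_fractions S X"

lemma X_sub: "x \<in> X \<Longrightarrow> x \<in> carrier S"
  using denom submonoid.subset by (auto simp: right_denominator_set_def)

lemma X_one: "\<one> \<in> X"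
  using denom submonoid.one_closed by (auto simp: right_denominator_set_def)

lemma X_mult: "\<lbrakk>x \<in> X; y \<in> X\<rbrakk> \<Longrightarrow> x \<otimes> y \<in> X"
  using denom submonoid.m_closed by (auto simp: right_denominator_set_def)

lemma right_ore:
  assumes "s \<in> carrier S" "x \<in> X"
  obtains s' x' where "s' \<in> carrier S" "x' \<in> X" "s \<otimes> x' = x \<otimes> s'"
  using denom assms unfolding right_denominator_set_def by blast

lemma right_rev:
  assumes "s \<in> carrier S" "t \<in> carrier S" "x \<in> X" "x \<otimes> s = x \<otimes> t"
  obtains w where "w \<in> X" "s \<otimes> w = t \<otimes> w"
proof -
  have c: "x \<in> carrier S" using assms X_sub by simp
  have "x \<otimes> (s \<ominus> t) = \<zero>"
    using assms c by (simp add: a_minus_def r_distr r_minus r_neg)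
  then obtain w where w: "w \<in> X" "(s \<ominus> t) \<otimes> w = \<zero>"
    using denom assms unfolding right_denominator_set_def by blast
  have "s = (s \<ominus> t) \<oplus> t"
    using assms by (simp add: a_minus_def a_assoc l_neg)
  then have "s \<otimes> w = (s \<ominus> t) \<otimes> w \<oplus> t \<otimes> w"
    using assms X_sub[OF w(1)] by (metis l_distr minus_closed)
  then have "s \<otimes> w = t \<otimes> w"
    using w assms X_sub[OF w(1)] by simp
  with w that show thesis by blast
qed

definition rel where
  "rel s x t y \<longleftrightarrow> (\<exists>c\<in>carrier S. \<exists>d\<in>carrier S. s \<otimes> c = t \<otimes> d \<and> x \<otimes> c = y \<otimes> d \<and> x \<otimes> c \<in> X)"

lemma F_iff: "(t, y) \<in> F s x \<longleftrightarrow> t \<in> carrier S \<and> y \<in> X \<and> rel s x t y"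
  by (simp add: rfrac_def rel_def)

lemma rel_refl: "\<lbrakk>s \<in> carrier S; x \<in> X\<rbrakk> \<Longrightarrow> rel s x s x"
  unfolding rel_def by (intro bexI[of _ \<one>]) (simp_all add: X_sub)

lemma rel_sym: "rel s x t y \<Longrightarrow> rel t y s x"
  unfolding rel_def by metis

text \<open>Two pairs of fractions with denominators \<open>z\<close> and \<open>z'\<close> can be compared simultaneously.\<close>

lemma rel_simult:
  assumes "p \<in> carrier S" "p' \<in> carrier S" "q \<in> carrier S" "q' \<in> carrier S" "z \<in> X" "z' \<in> X"
    and "rel p z p' z'" "rel q z q' z'"
  obtains k l where "k \<in> carrier S" "l \<in> carrier S" "p \<otimes> k = p' \<otimes> l" "q \<otimes> k = q' \<otimes> l"
    "z \<otimes> k = z' \<otimes> l" "z \<otimes> k \<in> X"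
proof -
  obtain c d where cd: "c \<in> carrier S" "d \<in> carrier S" "p \<otimes> c = p' \<otimes> d" "z \<otimes> c = z' \<otimes> d" "z \<otimes> c \<in> X"
    using assms(7) rel_def by auto
  obtain e f where ef: "e \<in> carrier S" "f \<in> carrier S" "q \<otimes> e = q' \<otimes> f" "z \<otimes> e = z' \<otimes> f" "z \<otimes> e \<in> X"
    using assms(8) rel_def by auto
  have zc: "z \<in> carrier S" "z' \<in> carrier S" using assms X_sub by auto
  obtain g h where gh: "g \<in> X" "h \<in> carrier S" "(z \<otimes> c) \<otimes> g = (z \<otimes> e) \<otimes> h"
    using right_ore[of "z \<otimes> c" "z \<otimes> e"] zc cd ef by (metis m_closed)
  note cl = zc cd(1,2) ef(1,2) gh(2) X_sub[OF gh(1)] assms(1-4)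
  obtain w where w: "w \<in> X" "(c \<otimes> g) \<otimes> w = (e \<otimes> h) \<otimes> w"
    using right_rev[of "c \<otimes> g" "e \<otimes> h" z] gh(3) cl assms(5) by (auto simp: m_assoc)
  note cl = cl X_sub[OF w(1)]
  have "z' \<otimes> (d \<otimes> g \<otimes> w) = z \<otimes> (c \<otimes> g \<otimes> w)"
    using cl cd(4) by (simp add: m_assoc[symmetric])
  also have "\<dots> = z' \<otimes> (f \<otimes> h \<otimes> w)"
    unfolding w(2) using cl ef(4) by (simp add: m_assoc[symmetric])
  finally obtain v where v: "v \<in> X" "(d \<otimes> g \<otimes> w) \<otimes> v = (f \<otimes> h \<otimes> w) \<otimes> v"
    using right_rev[of "d \<otimes> g \<otimes> w" "f \<otimes> h \<otimes> w" z'] cl assms(6) by auto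
  note cl = cl X_sub[OF v(1)]
  show thesis
  proof (rule that[of "c \<otimes> g \<otimes> w \<otimes> v" "d \<otimes> g \<otimes> w \<otimes> v"])
    show "p \<otimes> (c \<otimes> g \<otimes> w \<otimes> v) = p' \<otimes> (d \<otimes> g \<otimes> w \<otimes> v)"
      using cl cd(3) by (simp add: m_assoc[symmetric])
    show "q \<otimes> (c \<otimes> g \<otimes> w \<otimes> v) = q' \<otimes> (d \<otimes> g \<otimes> w \<otimes> v)"
      unfolding w(2) v(2) using cl ef(3) by (simp add: m_assoc[symmetric])
    show "z \<otimes> (c \<otimes> g \<otimes> w \<otimes> v) = z' \<otimes> (d \<otimes> g \<otimes> w \<otimes> v)"
      using cl cd(4) by (simp add: m_assoc[symmetric])
    have "z \<otimes> c \<otimes> g \<otimes> w \<otimes> v \<in> X" using cd(5) gh(1) w(1) v(1) X_mult by blast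
    then show "z \<otimes> (c \<otimes> g \<otimes> w \<otimes> v) \<in> X"
      using cl by (simp add: m_assoc[symmetric])
  qed (use cl in auto)
qed

lemma rel_trans:
  assumes "s \<in> carrier S" "t \<in> carrier S" "u \<in> carrier S" "x \<in> X" "y \<in> X" "z \<in> X"
    and "rel s x t y" "rel t y u z"
  shows "rel s x u z"
proof -
  obtain c d where cd: "c \<in> carrier S" "d \<in> carrier S" "s \<otimes> c = t \<otimes> d" "x \<otimes> c = y \<otimes> d" "x \<otimes> c \<in> X"
    using assms(7) rel_def by auto
  obtain e f where ef: "e \<in> carrier S" "f \<in> carrier S" "t \<otimes> e = u \<otimes> f" "y \<otimes> e = z \<otimes> f" "y \<otimes> e \<in> X"
    using assms(8) rel_def by auto
  have xc: "x \<in> carrier S" "y \<in> carrier S" "z \<in> carrier S" using assms X_sub by auto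
  obtain g h where gh: "g \<in> X" "h \<in> carrier S" "(y \<otimes> d) \<otimes> g = (y \<otimes> e) \<otimes> h"
    using right_ore[of "y \<otimes> d" "y \<otimes> e"] xc cd ef by (metis m_closed)
  note cl = xc cd(1,2) ef(1,2) gh(2) X_sub[OF gh(1)] assms(1-3)
  obtain w where w: "w \<in> X" "(d \<otimes> g) \<otimes> w = (e \<otimes> h) \<otimes> w"
    using right_rev[of "d \<otimes> g" "e \<otimes> h" y] gh(3) cl assms(5) by (auto simp: m_assoc)
  note cl = cl X_sub[OF w(1)]
  have "s \<otimes> (c \<otimes> g \<otimes> w) = t \<otimes> (d \<otimes> g \<otimes> w)"
    using cl cd(3) by (simp add: m_assoc[symmetric])
  also have "\<dots> = u \<otimes> (f \<otimes> h \<otimes> w)"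
    unfolding w(2) using cl ef(3) by (simp add: m_assoc[symmetric])
  finally have 1: "s \<otimes> (c \<otimes> g \<otimes> w) = u \<otimes> (f \<otimes> h \<otimes> w)" .
  have "x \<otimes> (c \<otimes> g \<otimes> w) = y \<otimes> (d \<otimes> g \<otimes> w)"
    using cl cd(4) by (simp add: m_assoc[symmetric])
  also have "\<dots> = z \<otimes> (f \<otimes> h \<otimes> w)"
    unfolding w(2) using cl ef(4) by (simp add: m_assoc[symmetric])
  finally have 2: "x \<otimes> (c \<otimes> g \<otimes> w) = z \<otimes> (f \<otimes> h \<otimes> w)" .
  have "x \<otimes> c \<otimes> g \<otimes> w \<in> X" using cd(5) gh(1) w(1) X_mult by blast
  then have 3: "x \<otimes> (c \<otimes> g \<otimes> w) \<in> X" using cl by (simp add: m_assoc)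
  show ?thesis unfolding rel_def
    using 1 2 3 cl by (intro bexI[of _ "c \<otimes> g \<otimes> w"] bexI[of _ "f \<otimes> h \<otimes> w"]) auto
qed

lemma F_eq_iff:
  assumes "s \<in> carrier S" "t \<in> carrier S" "x \<in> X" "y \<in> X"
  shows "F s x = F t y \<longleftrightarrow> rel s x t y"
proof
  assume "F s x = F t y"
  moreover have "(t, y) \<in> F t y" using assms by (simp add: F_iff rel_refl)
  ultimately show "rel s x t y" using F_iff by blast
next
  assume r: "rel s x t y"
  show "F s x = F t y"
  proof -
    have "(u, z) \<in> F s x \<longleftrightarrow> (u, z) \<in> F t y" for u z
      using r assms rel_sym rel_trans F_iff by metis
    then show ?thesis by auto
  qed
qed

lemma F_self: "\<lbrakk>s \<in> carrier S; x \<in> X\<rbrakk> \<Longrightarrow> (s, x) \<in> F s x"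
  by (simp add: F_iff rel_refl)

lemma F_mem: 
  assumes "s \<in> carrier S" "x \<in> X" "(t, y) \<in> F s x"
  shows "t \<in> carrier S" "y \<in> X" "F t y = F s x"
  using assms F_iff F_eq_iff[of s t x y] by auto

lemma F_expand:
  assumes "s \<in> carrier S" "x \<in> X" "c \<in> carrier S" "x \<otimes> c \<in> X"
  shows "F (s \<otimes> c) (x \<otimes> c) = F s x"
proof -
  have "rel s x (s \<otimes> c) (x \<otimes> c)"
    unfolding rel_def using assms X_sub by (intro bexI[of _ c] bexI[of _ \<one>]) auto
  then show ?thesis using assms F_eq_iff rel_sym by simp
qed

lemma F_add_cong:
  assumes "p \<in> carrier S" "p' \<in> carrier S" "q \<in> carrier S" "q' \<in> carrier S" "z \<in> X" "z' \<in> X"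
    and "F p z = F p' z'" "F q z = F q' z'"
  shows "F (p \<oplus> q) z = F (p' \<oplus> q') z'"
proof -
  have "rel p z p' z'" "rel q z q' z'" using assms F_eq_iff by auto
  then obtain k l where kl: "k \<in> carrier S" "l \<in> carrier S" "p \<otimes> k = p' \<otimes> l" "q \<otimes> k = q' \<otimes> l"
    "z \<otimes> k = z' \<otimes> l" "z \<otimes> k \<in> X"
    using rel_simult assms by metis
  then have "rel (p \<oplus> q) z (p' \<oplus> q') z'"
    unfolding rel_def using assms by (intro bexI[of _ k] bexI[of _ l]) (simp_all add: l_distr)
  then show ?thesis using assms F_eq_iff rel_sym by simp
qed

lemma F_mult_cong:
  assumes "a \<in> carrier S" "a' \<in> carrier S" "c \<in> carrier S" "c' \<in> carrier S"
    "x \<in> X" "x' \<in> X" "v \<in> X" "v' \<in> X"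
    and "F a x = F a' x'" "F (x \<otimes> c) v = F (x' \<otimes> c') v'"
  shows "F (a \<otimes> c) v = F (a' \<otimes> c') v'"
proof -
  have xc: "x \<in> carrier S" "x' \<in> carrier S" "v \<in> carrier S" "v' \<in> carrier S" using assms X_sub by auto
  have "rel a x a' x'" "rel (x \<otimes> c) v (x' \<otimes> c') v'" using assms xc F_eq_iff by auto
  then obtain e f k l where
    ef: "e \<in> carrier S" "f \<in> carrier S" "a \<otimes> e = a' \<otimes> f" "x \<otimes> e = x' \<otimes> f" "x \<otimes> e \<in> X" and
    kl: "k \<in> carrier S" "l \<in> carrier S" "x \<otimes> c \<otimes> k = x' \<otimes> c' \<otimes> l" "v \<otimes> k = v' \<otimes> l" "v \<otimes> k \<in> X"
    unfolding rel_def by auto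
  obtain m n where mn: "m \<in> X" "n \<in> carrier S" "(x \<otimes> c \<otimes> k) \<otimes> m = (x \<otimes> e) \<otimes> n"
    using right_ore[of "x \<otimes> c \<otimes> k" "x \<otimes> e"] xc assms ef kl by (metis m_closed)
  note cl = xc ef(1,2) kl(1,2) mn(2) X_sub[OF mn(1)] assms(1-4)
  obtain w where w: "w \<in> X" "(c \<otimes> k \<otimes> m) \<otimes> w = (e \<otimes> n) \<otimes> w"
    using right_rev[of "c \<otimes> k \<otimes> m" "e \<otimes> n" x] mn(3) cl assms(5) by (auto simp: m_assoc)
  note cl = cl X_sub[OF w(1)]
  have "x' \<otimes> (c' \<otimes> l \<otimes> m \<otimes> w) = x \<otimes> (c \<otimes> k \<otimes> m \<otimes> w)"
    using cl kl(3) by (simp add: m_assoc[symmetric])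
  also have "\<dots> = x' \<otimes> (f \<otimes> n \<otimes> w)"
    unfolding w(2) using cl ef(4) by (simp add: m_assoc[symmetric])
  finally obtain u where u: "u \<in> X" "(c' \<otimes> l \<otimes> m \<otimes> w) \<otimes> u = (f \<otimes> n \<otimes> w) \<otimes> u"
    using right_rev[of "c' \<otimes> l \<otimes> m \<otimes> w" "f \<otimes> n \<otimes> w" x'] cl assms(6) by auto
  note cl = cl X_sub[OF u(1)]
  have "(a \<otimes> c) \<otimes> (k \<otimes> m \<otimes> w \<otimes> u) = a \<otimes> (c \<otimes> k \<otimes> m \<otimes> w) \<otimes> u"
    using cl by (simp add: m_assoc)
  also have "\<dots> = a' \<otimes> (f \<otimes> n \<otimes> w \<otimes> u)"
    unfolding w(2) using cl ef(3) by (simp add: m_assoc[symmetric])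
  also have "\<dots> = (a' \<otimes> c') \<otimes> (l \<otimes> m \<otimes> w \<otimes> u)"
    unfolding u(2)[symmetric] using cl by (simp add: m_assoc)
  finally have 1: "(a \<otimes> c) \<otimes> (k \<otimes> m \<otimes> w \<otimes> u) = (a' \<otimes> c') \<otimes> (l \<otimes> m \<otimes> w \<otimes> u)" .
  have 2: "v \<otimes> (k \<otimes> m \<otimes> w \<otimes> u) = v' \<otimes> (l \<otimes> m \<otimes> w \<otimes> u)"
    using cl kl(4) by (simp add: m_assoc[symmetric])
  have "v \<otimes> k \<otimes> m \<otimes> w \<otimes> u \<in> X" using kl(5) mn(1) w(1) u(1) X_mult by blast
  then have 3: "v \<otimes> (k \<otimes> m \<otimes> w \<otimes> u) \<in> X" using cl by (simp add: m_assoc)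
  have "rel (a \<otimes> c) v (a' \<otimes> c') v'" unfolding rel_def
    using 1 2 3 cl by (intro bexI[of _ "k \<otimes> m \<otimes> w \<otimes> u"] bexI[of _ "l \<otimes> m \<otimes> w \<otimes> u"]) auto
  then show ?thesis using assms F_eq_iff rel_sym by simp
qed

theorem rfrac_add:
  assumes "a \<in> carrier S" "b \<in> carrier S" "x \<in> X" "y \<in> X"
    and "c \<in> carrier S" "d \<in> carrier S" "x \<otimes> c = y \<otimes> d" "x \<otimes> c \<in> X"
  shows "F a x \<oplus>\<^bsub>Q\<^esub> F b y = F (a \<otimes> c \<oplus> b \<otimes> d) (x \<otimes> c)"
proof -
  have "{F (a' \<otimes> c' \<oplus> b' \<otimes> d') (x' \<otimes> c') | a' x' b' y' c' d'.
      (a', x') \<in> F a x \<and> (b', y') \<in> F b y \<and> c' \<in> carrier S \<and> d' \<in> carrier S \<and>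
      x' \<otimes> c' = y' \<otimes> d' \<and> x' \<otimes> c' \<in> X} = {F (a \<otimes> c \<oplus> b \<otimes> d) (x \<otimes> c)}" (is "?L = _")
  proof (rule antisym)
    show "{F (a \<otimes> c \<oplus> b \<otimes> d) (x \<otimes> c)} \<subseteq> ?L" using assms F_self by blast
    show "?L \<subseteq> {F (a \<otimes> c \<oplus> b \<otimes> d) (x \<otimes> c)}"
    proof clarsimp
      fix a' x' b' y' c' d'
      assume h: "(a', x') \<in> F a x" "(b', y') \<in> F b y" "c' \<in> carrier S" "d' \<in> carrier S"
        "x' \<otimes> c' = y' \<otimes> d'" "y' \<otimes> d' \<in> X"
      note A = F_mem[OF assms(1,3) h(1)] and B = F_mem[OF assms(2,4) h(2)]
      have "F (a' \<otimes> c') (x' \<otimes> c') = F (a \<otimes> c) (x \<otimes> c)"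
        using F_expand[of a' x' c'] F_expand[of a x c] A h assms by simp
      moreover have "F (b' \<otimes> d') (x' \<otimes> c') = F (b \<otimes> d) (x \<otimes> c)"
        using F_expand[of b' y' d'] F_expand[of b y d] B h assms by simp
      ultimately show "F (a' \<otimes> c' \<oplus> b' \<otimes> d') (y' \<otimes> d') = F (a \<otimes> c \<oplus> b \<otimes> d) (x \<otimes> c)"
        using F_add_cong[of "a' \<otimes> c'" "a \<otimes> c" "b' \<otimes> d'" "b \<otimes> d" "x' \<otimes> c'" "x \<otimes> c"] A B h assms by simp
    qed
  qed
  then show ?thesis by (simp add: right_fractions_def)
qed

theorem rfrac_mult:
  assumes "a \<in> carrier S" "b \<in> carrier S" "x \<in> X" "y \<in> X"
    and "c \<in> carrier S" "z \<in> X" "x \<otimes> c = b \<otimes> z"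
  shows "F a x \<otimes>\<^bsub>Q\<^esub> F b y = F (a \<otimes> c) (y \<otimes> z)"
proof -
  have "{F (a' \<otimes> c') (y' \<otimes> z') | a' x' b' y' c' z'.
      (a', x') \<in> F a x \<and> (b', y') \<in> F b y \<and> c' \<in> carrier S \<and> z' \<in> X \<and>
      x' \<otimes> c' = b' \<otimes> z'} = {F (a \<otimes> c) (y \<otimes> z)}" (is "?L = _")
  proof (rule antisym)
    show "{F (a \<otimes> c) (y \<otimes> z)} \<subseteq> ?L" using assms F_self by blast
    show "?L \<subseteq> {F (a \<otimes> c) (y \<otimes> z)}"
    proof clarsimp
      fix a' x' b' y' c' z'
      assume h: "(a', x') \<in> F a x" "(b', y') \<in> F b y" "c' \<in> carrier S" "z' \<in> X" "x' \<otimes> c' = b' \<otimes> z'"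
      note A = F_mem[OF assms(1,3) h(1)] and B = F_mem[OF assms(2,4) h(2)]
      have "F (x' \<otimes> c') (y' \<otimes> z') = F (x \<otimes> c) (y \<otimes> z)"
        using F_expand[of b' y' z'] F_expand[of b y z] B h assms X_mult X_sub by simp
      then show "F (a' \<otimes> c') (y' \<otimes> z') = F (a \<otimes> c) (y \<otimes> z)"
        using F_mult_cong[of a' a c' c x' x "y' \<otimes> z'" "y \<otimes> z"] A B h assms X_mult by simp
    qed
  qed
  then show ?thesis by (simp add: right_fractions_def)
qed

lemma Q_simps: "carrier Q = {F s x | s x. s \<in> carrier S \<and> x \<in> X}" "\<one>\<^bsub>Q\<^esub> = F \<one> \<one>" "\<zero>\<^bsub>Q\<^esub> = F \<zero> \<one>"
  by (simp_all add: right_fractions_def)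

lemma F_closed: "\<lbrakk>s \<in> carrier S; x \<in> X\<rbrakk> \<Longrightarrow> F s x \<in> carrier Q"
  by (auto simp: Q_simps)

lemma F_add_same: "\<lbrakk>a \<in> carrier S; b \<in> carrier S; x \<in> X\<rbrakk> \<Longrightarrow> F a x \<oplus>\<^bsub>Q\<^esub> F b x = F (a \<oplus> b) x"
  using rfrac_add[of a b x x \<one> \<one>] X_sub by simp

lemma F_mult_same: "\<lbrakk>a \<in> carrier S; c \<in> carrier S; x \<in> X; y \<in> X\<rbrakk> \<Longrightarrow> F a x \<otimes>\<^bsub>Q\<^esub> F (x \<otimes> c) y = F (a \<otimes> c) y"
  using rfrac_mult[of a "x \<otimes> c" x y c \<one>] X_sub X_one by simp

lemma F_zero: "x \<in> X \<Longrightarrow> F \<zero> x = \<zero>\<^bsub>Q\<^esub>"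
  using F_expand[of \<zero> \<one> x] X_sub X_one by (simp add: Q_simps)

lemma F_unit: "x \<in> X \<Longrightarrow> F x x = \<one>\<^bsub>Q\<^esub>"
  using F_expand[of \<one> \<one> x] X_sub X_one by (simp add: Q_simps)

text \<open>Common denominators, and denominators of one fraction absorbed in the numerator of the next.\<close>

lemma common2:
  assumes "A \<in> carrier Q" "B \<in> carrier Q"
  obtains a b x where "a \<in> carrier S" "b \<in> carrier S" "x \<in> X" "A = F a x" "B = F b x"
proof -
  obtain a x b y where ab: "a \<in> carrier S" "x \<in> X" "A = F a x" "b \<in> carrier S" "y \<in> X" "B = F b y"
    using assms by (auto simp: Q_simps)
  obtain c d where cd: "c \<in> X" "d \<in> carrier S" "x \<otimes> c = y \<otimes> d"
    using right_ore[of x y] ab X_sub by metis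
  have "x \<otimes> c \<in> X" using ab(2) cd(1) by (rule X_mult)
  then show thesis
    using that[of "a \<otimes> c" "b \<otimes> d" "x \<otimes> c"] F_expand[of a x c] F_expand[of b y d] ab cd X_sub by simp
qed

lemma common3:
  assumes "A \<in> carrier Q" "B \<in> carrier Q" "C \<in> carrier Q"
  obtains a b c x where "a \<in> carrier S" "b \<in> carrier S" "c \<in> carrier S" "x \<in> X"
    "A = F a x" "B = F b x" "C = F c x"
proof -
  obtain a b x where ab: "a \<in> carrier S" "b \<in> carrier S" "x \<in> X" "A = F a x" "B = F b x"
    using common2 assms by metis
  obtain c y where c: "c \<in> carrier S" "y \<in> X" "C = F c y"
    using assms by (auto simp: Q_simps)
  obtain e d where ed: "e \<in> X" "d \<in> carrier S" "x \<otimes> e = y \<otimes> d"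
    using right_ore[of x y] ab c X_sub by metis
  have "x \<otimes> e \<in> X" using ab(3) ed(1) by (rule X_mult)
  then show thesis
    using that[of "a \<otimes> e" "b \<otimes> e" "c \<otimes> d" "x \<otimes> e"] F_expand[of a x e] F_expand[of b x e]
      F_expand[of c y d] ab c ed X_sub by simp
qed

lemma absorb:
  assumes "B \<in> carrier Q" "x \<in> X"
  obtains c y where "c \<in> carrier S" "y \<in> X" "B = F (x \<otimes> c) y"
proof -
  obtain b y where b: "b \<in> carrier S" "y \<in> X" "B = F b y"
    using assms by (auto simp: Q_simps)
  obtain z c where zc: "z \<in> X" "c \<in> carrier S" "b \<otimes> z = x \<otimes> c"
    using right_ore[of b x] b assms by metis
  have "y \<otimes> z \<in> X" using b(2) zc(1) by (rule X_mult)
  then show thesis using that[of c "y \<otimes> z"] F_expand[of b y z] b zc X_sub by simp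
qed

lemma absorb2:
  assumes "B \<in> carrier Q" "C \<in> carrier Q" "x \<in> X"
  obtains c d y where "c \<in> carrier S" "d \<in> carrier S" "y \<in> X" "B = F (x \<otimes> c) y" "C = F (x \<otimes> d) y"
proof -
  obtain c y where c: "c \<in> carrier S" "y \<in> X" "B = F (x \<otimes> c) y" using absorb assms by metis
  obtain d z where d: "d \<in> carrier S" "z \<in> X" "C = F (x \<otimes> d) z" using absorb assms by metis
  obtain e f where ef: "e \<in> X" "f \<in> carrier S" "y \<otimes> e = z \<otimes> f"
    using right_ore[of y z] c d X_sub by metis
  have "y \<otimes> e \<in> X" using c(2) ef(1) by (rule X_mult)
  then show thesis
    using that[of "c \<otimes> e" "d \<otimes> f" "y \<otimes> e"] F_expand[of "x \<otimes> c" y e] F_expand[of "x \<otimes> d" z f]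
      c d ef assms X_sub by (simp add: m_assoc)
qed

theorem right_fractions_ring: "ring Q"
proof (rule ringI)
  show "abelian_group Q"
  proof (rule abelian_groupI)
    fix A B assume AB: "A \<in> carrier Q" "B \<in> carrier Q"
    obtain a b x where ab: "a \<in> carrier S" "b \<in> carrier S" "x \<in> X" "A = F a x" "B = F b x"
      using common2[OF AB] by metis
    show "A \<oplus>\<^bsub>Q\<^esub> B \<in> carrier Q" "A \<oplus>\<^bsub>Q\<^esub> B = B \<oplus>\<^bsub>Q\<^esub> A"
      using ab by (simp_all add: F_add_same F_closed a_comm)
  next
    fix A B C assume ABC: "A \<in> carrier Q" "B \<in> carrier Q" "C \<in> carrier Q"
    obtain a b c x where ab: "a \<in> carrier S" "b \<in> carrier S" "c \<in> carrier S" "x \<in> X" "A = F a x" "B = F b x" "C = F c x"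
      using common3[OF ABC] by metis
    show "A \<oplus>\<^bsub>Q\<^esub> B \<oplus>\<^bsub>Q\<^esub> C = A \<oplus>\<^bsub>Q\<^esub> (B \<oplus>\<^bsub>Q\<^esub> C)"
      using ab by (simp add: F_add_same a_assoc)
  next
    fix A assume "A \<in> carrier Q"
    then obtain a x where a: "a \<in> carrier S" "x \<in> X" "A = F a x" by (auto simp: Q_simps)
    show "\<zero>\<^bsub>Q\<^esub> \<oplus>\<^bsub>Q\<^esub> A = A"
      using a F_zero[of x, symmetric] by (simp add: F_add_same)
    show "\<exists>B\<in>carrier Q. B \<oplus>\<^bsub>Q\<^esub> A = \<zero>\<^bsub>Q\<^esub>"
      using a F_zero[of x, symmetric]
      by (intro bexI[of _ "F (\<ominus> a) x"]) (simp_all add: F_add_same l_neg F_closed)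
  qed (simp add: Q_simps(3) F_closed X_one)
  show "Group.monoid Q"
  proof (rule monoidI)
    fix A B assume AB: "A \<in> carrier Q" "B \<in> carrier Q"
    obtain a x where a: "a \<in> carrier S" "x \<in> X" "A = F a x" using AB by (auto simp: Q_simps)
    obtain c y where c: "c \<in> carrier S" "y \<in> X" "B = F (x \<otimes> c) y" using absorb AB a by metis
    show "A \<otimes>\<^bsub>Q\<^esub> B \<in> carrier Q" using a c by (simp add: F_mult_same F_closed)
  next
    fix A B C assume ABC: "A \<in> carrier Q" "B \<in> carrier Q" "C \<in> carrier Q"
    obtain a x where a: "a \<in> carrier S" "x \<in> X" "A = F a x" using ABC by (auto simp: Q_simps)
    obtain b y where b: "b \<in> carrier S" "y \<in> X" "B = F (x \<otimes> b) y" using absorb ABC a by metis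
    obtain c z where c: "c \<in> carrier S" "z \<in> X" "C = F (y \<otimes> c) z" using absorb ABC b by metis
    show "A \<otimes>\<^bsub>Q\<^esub> B \<otimes>\<^bsub>Q\<^esub> C = A \<otimes>\<^bsub>Q\<^esub> (B \<otimes>\<^bsub>Q\<^esub> C)"
      using a b c X_sub by (simp add: F_mult_same m_assoc)
  next
    fix A assume A: "A \<in> carrier Q"
    then obtain a x where a: "a \<in> carrier S" "x \<in> X" "A = F a x" by (auto simp: Q_simps)
    show "\<one>\<^bsub>Q\<^esub> \<otimes>\<^bsub>Q\<^esub> A = A"
      using F_mult_same[of \<one> a \<one> x] a X_one by (simp add: Q_simps)
    show "A \<otimes>\<^bsub>Q\<^esub> \<one>\<^bsub>Q\<^esub> = A"
      using F_mult_same[of a \<one> x x] a X_sub F_unit[of x] by simp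
  qed (simp add: Q_simps(2) F_closed X_one)
next
  fix A B C assume ABC: "A \<in> carrier Q" "B \<in> carrier Q" "C \<in> carrier Q"
  obtain a b x where ab: "a \<in> carrier S" "b \<in> carrier S" "x \<in> X" "A = F a x" "B = F b x"
    using common2 ABC by metis
  obtain c y where c: "c \<in> carrier S" "y \<in> X" "C = F (x \<otimes> c) y" using absorb ABC ab by metis
  show "(A \<oplus>\<^bsub>Q\<^esub> B) \<otimes>\<^bsub>Q\<^esub> C = A \<otimes>\<^bsub>Q\<^esub> C \<oplus>\<^bsub>Q\<^esub> B \<otimes>\<^bsub>Q\<^esub> C"
    using ab c by (simp add: F_add_same F_mult_same l_distr)
next
  fix A B C assume ABC: "A \<in> carrier Q" "B \<in> carrier Q" "C \<in> carrier Q"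
  obtain c z where c: "c \<in> carrier S" "z \<in> X" "C = F c z" using ABC by (auto simp: Q_simps)
  obtain a b y where ab: "a \<in> carrier S" "b \<in> carrier S" "y \<in> X" "A = F (z \<otimes> a) y" "B = F (z \<otimes> b) y"
    using absorb2 ABC c by metis
  have "C \<otimes>\<^bsub>Q\<^esub> (A \<oplus>\<^bsub>Q\<^esub> B) = C \<otimes>\<^bsub>Q\<^esub> F (z \<otimes> (a \<oplus> b)) y"
    using ab c X_sub by (simp add: F_add_same r_distr)
  also have "\<dots> = C \<otimes>\<^bsub>Q\<^esub> A \<oplus>\<^bsub>Q\<^esub> C \<otimes>\<^bsub>Q\<^esub> B"
    using ab c by (simp add: F_add_same F_mult_same r_distr)
  finally show "C \<otimes>\<^bsub>Q\<^esub> (A \<oplus>\<^bsub>Q\<^esub> B) = C \<otimes>\<^bsub>Q\<^esub> A \<oplus>\<^bsub>Q\<^esub> C \<otimes>\<^bsub>Q\<^esub> B" .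
qed

theorem rfrac_emb_hom: "rfrac_emb S X \<in> ring_hom S Q"
proof (rule ring_hom_memI)
  fix s t assume st: "s \<in> carrier S" "t \<in> carrier S"
  show "rfrac_emb S X s \<in> carrier Q"
    using st by (simp add: rfrac_emb_def F_closed X_one)
  show "rfrac_emb S X (s \<otimes> t) = rfrac_emb S X s \<otimes>\<^bsub>Q\<^esub> rfrac_emb S X t"
    using st F_mult_same[of s t \<one> \<one>] by (simp add: rfrac_emb_def X_one)
  show "rfrac_emb S X (s \<oplus> t) = rfrac_emb S X s \<oplus>\<^bsub>Q\<^esub> rfrac_emb S X t"
    using st by (simp add: rfrac_emb_def X_one F_add_same)
qed (simp add: rfrac_emb_def Q_simps)

theorem rfrac_emb_unit:
  assumes "x \<in> X"
  shows "F \<one> x \<in> carrier Q" "rfrac_emb S X x \<otimes>\<^bsub>Q\<^esub> F \<one> x = \<one>\<^bsub>Q\<^esub>" "F \<one> x \<otimes>\<^bsub>Q\<^esub> rfrac_emb S X x = \<one>\<^bsub>Q\<^esub>"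
  using assms F_mult_same[of x \<one> \<one> x] F_mult_same[of \<one> \<one> x \<one>] X_one X_sub F_unit
  by (simp_all add: rfrac_emb_def F_closed)

theorem rfrac_eq: "\<lbrakk>s \<in> carrier S; x \<in> X\<rbrakk> \<Longrightarrow> F s x = rfrac_emb S X s \<otimes>\<^bsub>Q\<^esub> F \<one> x"
  using F_mult_same[of s \<one> \<one> x] X_one by (simp add: rfrac_emb_def)

theorem rfrac_emb_kernel:
  assumes "s \<in> carrier S"
  shows "rfrac_emb S X s = \<zero>\<^bsub>Q\<^esub> \<longleftrightarrow> (\<exists>x\<in>X. s \<otimes> x = \<zero>)"
proof -
  have "rfrac_emb S X s = \<zero>\<^bsub>Q\<^esub> \<longleftrightarrow> rel s \<one> \<zero> \<one>"
    using assms X_one by (simp add: rfrac_emb_def Q_simps F_eq_iff)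
  also have "\<dots> \<longleftrightarrow> (\<exists>x\<in>X. s \<otimes> x = \<zero>)"
    unfolding rel_def using X_sub by auto
  finally show ?thesis .
qed

end

text \<open>
  Functions between carriers are determined on the carrier only, so \<open>extensional\<close> is needed for
  uniqueness.
\<close>

definition induced_aut ::
    "('a, 'm) ring_scheme \<Rightarrow> 'a set \<Rightarrow> ('a \<Rightarrow> 'a) \<Rightarrow> ('a \<times> 'a) set \<Rightarrow> ('a \<times> 'a) set" where
  "induced_aut R X \<tau> =
     (THE \<sigma>. \<sigma> \<in> extensional (carrier (right_fractions R X)) \<and>
             \<sigma> \<in> ring_aut (right_fractions R X) \<and>
             (\<forall>r\<in>carrier R. \<sigma> (rfrac_emb R X r) = rfrac_emb R X (\<tau> r)))"

definition induced_der ::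
    "('a, 'm) ring_scheme \<Rightarrow> 'a set \<Rightarrow> ('a \<Rightarrow> 'a) \<Rightarrow> ('a \<Rightarrow> 'a) \<Rightarrow> ('a \<times> 'a) set \<Rightarrow> ('a \<times> 'a) set" where
  "induced_der R X \<tau> \<delta> =
     (THE \<epsilon>. \<epsilon> \<in> extensional (carrier (right_fractions R X)) \<and>
             left_derivation (right_fractions R X) (induced_aut R X \<tau>) \<epsilon> \<and>
             (\<forall>r\<in>carrier R. \<epsilon> (rfrac_emb R X r) = rfrac_emb R X (\<delta> r)))"


section \<open>Amalgamated products of two Ore extensions\<close>

definition ore_amalgam ::
    "('a, 'm) ring_scheme \<Rightarrow> ('a \<Rightarrow> 'a) \<Rightarrow> ('a \<Rightarrow> 'a) \<Rightarrow> ('a \<Rightarrow> 'a) \<Rightarrow> ('a \<Rightarrow> 'a) \<Rightarrow>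
     (nat \<Rightarrow> 'a, nat \<Rightarrow> 'a) aterm set ring" where
  "ore_amalgam R \<tau>1 \<delta>1 \<tau>2 \<delta>2 =
     amalgam R (ore_ext R \<tau>1 \<delta>1) (ore_ext R \<tau>2 \<delta>2) (ore_const R) (ore_const R)"

definition ore_amalgam_emb where
  "ore_amalgam_emb R \<tau>1 \<delta>1 \<tau>2 \<delta>2 r =
     amalgam_inl R (ore_ext R \<tau>1 \<delta>1) (ore_ext R \<tau>2 \<delta>2) (ore_const R) (ore_const R) (ore_const R r)"

end

theory Submission
  imports Defs
begin

text \<open>
  Write \<open>S = R[x] *\<^sub>R R[y]\<close>, \<open>D = R X\<^sup>-\<^sup>1\<close> and \<open>T = D[x] *\<^sub>D D[y]\<close>, with the twists understood.  The proof rests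
  on two facts: the elements of \<open>S\<close> are determined by coordinates in \<open>R\<close> with respect to the words in \<open>x\<close>
  and \<open>y\<close>, and those of \<open>T\<close> by coordinates in \<open>D\<close> with respect to the same words, so that \<open>S\<close> sits inside \<open>T\<close>;
  and denominators can be moved past \<open>x\<close> and \<open>y\<close>.

  The coordinates come from van der Waerden's trick.  Let \<open>M\<close> be the free left module on the words.  The
  formula \<open>x (r w) = \<tau>(r) x w + \<delta>(r) w\<close> lets \<open>x\<close> and \<open>y\<close> act on \<open>M\<close> by additive maps that satisfy the
  commutation rules, hence \<open>S\<close> acts on \<open>M\<close> by its universal property
  (\<open>amalgam_of_ore_universal\<close>, \<open>word_action\<close>).  Applying \<open>s\<close> to the empty word gives
  coordinates of \<open>s\<close>, from which \<open>s\<close> is recovered as a sum of words (\<open>word_sum_coords\<close>).  Two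
  consequences are drawn.  A nonzero \<open>r\<close> kills no nonzero element of \<open>S\<close>, because it kills no coordinate
  (\<open>emb_mult_eq_zero\<close>).  And an injection \<open>R \<rightarrow> D\<close> compatible with the twists induces an injection
  \<open>S \<rightarrow> T\<close>, because it maps coordinates to coordinates (\<open>ore_pair_base_change\<close>).

  The Ore condition in \<open>S\<close> is closed under sums and products, so it is enough to check it on \<open>R\<close>, where
  it is the classical theorem about right noetherian domains, and on \<open>x\<close> and \<open>y\<close>.  To move a
  denominator \<open>a\<close> past \<open>x\<close>, take \<open>z\<close> with \<open>\<tau>(z) = a\<close>, so that \<open>x z = a x + \<delta>(z)\<close>, and then multiply by \<open>c\<close>
  such that \<open>\<delta>(z) c \<in> a R\<close>.  This gives (i).

  For (ii), \<open>\<tau>\<close> and \<open>\<delta>\<close> extend uniquely to \<open>D\<close> (\<open>induced_aut\<close>, \<open>induced_der\<close>), so \<open>T\<close> makes sense and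
  \<open>S\<close> embeds into it.  The elements of \<open>X\<close> are invertible in \<open>T\<close>, so the embedding extends to \<open>S X\<^sup>-\<^sup>1\<close>.
  The extension is still injective, and it is onto since \<open>T\<close> is generated by \<open>D\<close>, \<open>x\<close> and \<open>y\<close>.
\<close>

section \<open>Right noetherian domains are right Ore\<close>

text \<open>
  Goldie's argument: if \<open>a R \<inter> b R = 0\<close> for nonzero \<open>a\<close> and \<open>b\<close>, then the sum of the right ideals \<open>a\<^sup>n b R\<close> is direct, and its
  partial sums form a strictly increasing chain.
\<close>

lemma right_noetherian_imp_right_ore:
  fixes R (structure)
  assumes "ring R" and "\<one> \<noteq> \<zero>"
    and nzd: "\<And>a b. \<lbrakk>a \<in> carrier R; b \<in> carrier R; a \<otimes> b = \<zero>\<rbrakk> \<Longrightarrow> a = \<zero> \<or> b = \<zero>"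
    and noeth: "right_noetherian R"
    and a: "a \<in> carrier R" and b: "b \<in> carrier R" "b \<noteq> \<zero>"
  shows "\<exists>u\<in>carrier R - {\<zero>}. \<exists>v\<in>carrier R. a \<otimes> u = b \<otimes> v"
proof (cases "a = \<zero>")
  case True
  interpret ring R by fact
  show ?thesis using True assms(2) b by (intro bexI[of _ \<one>] bexI[of _ \<zero>]) auto
next
  case False
  interpret ring R by fact
  show ?thesis
  proof (rule ccontr)
    assume "\<not> ?thesis"
    then have disjoint: "a \<otimes> u \<noteq> b \<otimes> v" if "u \<in> carrier R" "u \<noteq> \<zero>" "v \<in> carrier R" for u v
      using that by auto
    \<comment> \<open>\<open>I\<^sub>n = b R + a b R + \<dots> + a\<^sup>n\<^sup>-\<^sup>1 b R\<close>, in the recursive form \<open>I\<^sub>n\<^sub>+\<^sub>1 = b R + a I\<^sub>n\<close>\<close>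
    define I where
      "I = rec_nat {\<zero>} (\<lambda>_ J. {b \<otimes> r \<oplus> a \<otimes> t | r t. r \<in> carrier R \<and> t \<in> J})"
    have I0: "I 0 = {\<zero>}"
      and ISuc: "I (Suc n) = {b \<otimes> r \<oplus> a \<otimes> t | r t. r \<in> carrier R \<and> t \<in> I n}" for n
      by (simp_all add: I_def)
    have carr: "t \<in> carrier R" if "t \<in> I n" for n t
      using that by (induction n arbitrary: t) (auto simp: I0 ISuc a b)
    have zero: "\<zero> \<in> I n" for n
      by (induction n) (auto simp: I0 ISuc a b intro!: exI[of _ "\<zero>"])
    have add: "s \<oplus> t \<in> I n" if "s \<in> I n" "t \<in> I n" for n s t
      using that
    proof (induction n arbitrary: s t)
      case (Suc n)
      obtain r u r' u' where *: "r \<in> carrier R" "u \<in> I n" "s = b \<otimes> r \<oplus> a \<otimes> u"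
        "r' \<in> carrier R" "u' \<in> I n" "t = b \<otimes> r' \<oplus> a \<otimes> u'"
        using Suc.prems by (auto simp: ISuc)
      have "s \<oplus> t = b \<otimes> (r \<oplus> r') \<oplus> a \<otimes> (u \<oplus> u')"
        using * a b carr by (simp add: r_distr a_assoc a_lcomm)
      then show ?case using * Suc.IH[of u u'] by (auto simp: ISuc)
    qed (simp add: I0)
    have mult: "t \<otimes> r \<in> I n" if "t \<in> I n" "r \<in> carrier R" for n t r
      using that
    proof (induction n arbitrary: t)
      case (Suc n)
      obtain r' u where *: "r' \<in> carrier R" "u \<in> I n" "t = b \<otimes> r' \<oplus> a \<otimes> u"
        using Suc.prems by (auto simp: ISuc)
      have "t \<otimes> r = b \<otimes> (r' \<otimes> r) \<oplus> a \<otimes> (u \<otimes> r)"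
        using * a b carr Suc.prems by (simp add: l_distr m_assoc)
      then show ?case using * Suc.IH[of u] Suc.prems by (auto simp: ISuc)
    qed (simp add: I0)
    have "right_ideal (I n) R" for n
    proof -
      have "\<ominus> t \<in> I n" if "t \<in> I n" for t
        using mult[OF that, of "\<ominus> \<one>"] carr[OF that] by (simp add: r_minus)
      then have "subgroup (I n) (add_monoid R)"
        using zero[of n] add carr by (intro add.subgroupI) (auto simp: a_inv_def[symmetric])
      then show ?thesis
        using mult by (auto simp: right_ideal_def intro!: additive_subgroupI)
    qed
    moreover have "I n \<subseteq> I (Suc n)" for n
    proof (induction n)
      case (Suc n)
      show ?case unfolding ISuc[of "Suc n"] using Suc by (subst ISuc) blast
    qed (simp add: I0 zero)
    ultimately obtain N where N: "\<And>n. n \<ge> N \<Longrightarrow> I n = I N"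
      using noeth unfolding right_noetherian_def by metis
    have pow: "a [^] Suc n \<otimes> b = a \<otimes> (a [^] n \<otimes> b)" for n
      using a b nat_pow_Suc2[of a n] m_assoc[of a "a [^] n" b] by simp
    have "a [^] n \<otimes> b \<in> I (Suc n)" for n
    proof (induction n)
      case 0
      show ?case unfolding ISuc using a b zero
        by (intro CollectI exI[of _ \<one>] exI[of _ \<zero>]) simp
    next
      case (Suc n)
      have "a [^] Suc n \<otimes> b = b \<otimes> \<zero> \<oplus> a \<otimes> (a [^] n \<otimes> b)"
        using a b pow by simp
      then show ?case using Suc by (subst ISuc) blast
    qed
    \<comment> \<open>a representation of \<open>a\<^sup>n\<^sup>+\<^sup>1 b\<close> in \<open>I\<^sub>n\<^sub>+\<^sub>1\<close> has vanishing component in \<open>b R\<close>, and cancelling \<open>a\<close> lowers \<open>n\<close>\<close>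
    moreover have "a [^] n \<otimes> b \<notin> I n" for n
    proof (induction n)
      case (Suc n)
      show ?case
      proof
        assume "a [^] Suc n \<otimes> b \<in> I (Suc n)"
        then obtain r t where *: "r \<in> carrier R" "t \<in> I n" "a [^] Suc n \<otimes> b = b \<otimes> r \<oplus> a \<otimes> t"
          by (auto simp: ISuc)
        have t: "t \<in> carrier R" using * carr by blast
        have "a \<otimes> (a [^] n \<otimes> b) = b \<otimes> r \<oplus> a \<otimes> t"
          using *(3) pow by simp
        then have eq: "a \<otimes> (a [^] n \<otimes> b \<ominus> t) = b \<otimes> r"
          using a b t *(1) by (simp add: a_minus_def r_distr r_minus a_assoc r_neg)
        have "a [^] n \<otimes> b \<noteq> t" using * Suc by blast
        moreover have "a [^] n \<otimes> b = a [^] n \<otimes> b \<ominus> t \<oplus> t"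
          using a b t by (simp add: a_minus_def a_assoc l_neg)
        ultimately have "a [^] n \<otimes> b \<ominus> t \<noteq> \<zero>"
          using t by auto
        then show False
          using eq disjoint[of "a [^] n \<otimes> b \<ominus> t" r] a b t *(1) by simp
      qed
    qed (use b in \<open>simp add: I0\<close>)
    ultimately show False using N[of "Suc N"] by auto
  qed
qed

lemma noetherian_domain_right_denominator_set:
  assumes "nc_noetherian_domain R"
  shows "right_denominator_set (carrier R - {\<zero>\<^bsub>R\<^esub>}) R"
proof -
  interpret ring R using assms by (simp add: nc_noetherian_domain_def)
  have dom: "\<one>\<^bsub>R\<^esub> \<noteq> \<zero>\<^bsub>R\<^esub>" "right_noetherian R"
    "\<And>a b. \<lbrakk>a \<in> carrier R; b \<in> carrier R; a \<otimes>\<^bsub>R\<^esub> b = \<zero>\<^bsub>R\<^esub>\<rbrakk> \<Longrightarrow> a = \<zero>\<^bsub>R\<^esub> \<or> b = \<zero>\<^bsub>R\<^esub>"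
    using assms by (auto simp: nc_noetherian_domain_def)
  show ?thesis unfolding right_denominator_set_def
  proof (intro conjI ballI impI)
    show "submonoid (carrier R - {\<zero>\<^bsub>R\<^esub>}) R"
      using dom(1,3) by (intro submonoid.intro) auto
    fix s x assume s: "s \<in> carrier R" and x: "x \<in> carrier R - {\<zero>\<^bsub>R\<^esub>}"
    show "\<exists>s'\<in>carrier R. \<exists>x'\<in>carrier R - {\<zero>\<^bsub>R\<^esub>}. s \<otimes>\<^bsub>R\<^esub> x' = x \<otimes>\<^bsub>R\<^esub> s'"
      using right_noetherian_imp_right_ore[OF ring_axioms dom(1,3,2) s, of x] x by blast
    show "\<exists>x'\<in>carrier R - {\<zero>\<^bsub>R\<^esub>}. s \<otimes>\<^bsub>R\<^esub> x' = \<zero>\<^bsub>R\<^esub>" if "x \<otimes>\<^bsub>R\<^esub> s = \<zero>\<^bsub>R\<^esub>"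
      using that dom(1) dom(3)[of x s] s x by (intro bexI[of _ "\<one>\<^bsub>R\<^esub>"]) auto
  qed
qed


section \<open>The universal property of right fractions\<close>

lemma ring_hom_Units:
  assumes "Group.monoid R" "Group.monoid S" "h \<in> ring_hom R S" "x \<in> Units R"
  shows "h x \<in> Units S" "inv\<^bsub>S\<^esub> (h x) = h (inv\<^bsub>R\<^esub> x)"
proof -
  interpret R: Group.monoid R by fact
  interpret S: Group.monoid S by fact
  have *: "h x \<in> carrier S" "h (inv\<^bsub>R\<^esub> x) \<in> carrier S"
    "h x \<otimes>\<^bsub>S\<^esub> h (inv\<^bsub>R\<^esub> x) = \<one>\<^bsub>S\<^esub>" "h (inv\<^bsub>R\<^esub> x) \<otimes>\<^bsub>S\<^esub> h x = \<one>\<^bsub>S\<^esub>"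
    using assms(4) ring_hom_one[OF assms(3)]
    by (simp_all add: ring_hom_closed[OF assms(3)] ring_hom_mult[OF assms(3), symmetric] R.Units_closed)
  then show "h x \<in> Units S" by (auto simp: Units_def)
  show "inv\<^bsub>S\<^esub> (h x) = h (inv\<^bsub>R\<^esub> x)" using * S.inv_unique' by metis
qed

context right_denom
begin

abbreviation emb where "emb \<equiv> rfrac_emb S X"

sublocale Q: ring Q by (rule right_fractions_ring)

lemma emb_Units: "x \<in> X \<Longrightarrow> emb x \<in> Units Q"
  using rfrac_emb_unit[of x] ring_hom_closed[OF rfrac_emb_hom X_sub[of x]] by (auto simp: Units_def)

lemma F_eq_emb_inv: "\<lbrakk>s \<in> carrier S; x \<in> X\<rbrakk> \<Longrightarrow> F s x = emb s \<otimes>\<^bsub>Q\<^esub> inv\<^bsub>Q\<^esub> (emb x)"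
  using rfrac_emb_unit[of x] ring_hom_closed[OF rfrac_emb_hom X_sub[of x]] Q.inv_unique'[of "emb x" "F \<one> x"]
    rfrac_eq[of s x] by simp

text \<open>
  The value at \<open>s x\<^sup>-\<^sup>1\<close> can only be \<open>h(s) h(x)\<^sup>-\<^sup>1\<close>.  It respects a common expansion of two fractions, and
  sums and products reduce to fractions with a common denominator and to products
  \<open>b x\<^sup>-\<^sup>1 \<cdot> x c y\<^sup>-\<^sup>1\<close>.
\<close>

lemma right_fractions_universal:
  assumes A: "ring A" and h: "h \<in> ring_hom S A" and u: "\<And>x. x \<in> X \<Longrightarrow> h x \<in> Units A"
  obtains H where "H \<in> ring_hom Q A"
    "\<And>s x. \<lbrakk>s \<in> carrier S; x \<in> X\<rbrakk> \<Longrightarrow> H (F s x) = h s \<otimes>\<^bsub>A\<^esub> inv\<^bsub>A\<^esub> h x"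
    "\<And>s. s \<in> carrier S \<Longrightarrow> H (emb s) = h s"
proof -
  interpret A: ring A by fact
  note hom = ring_hom_closed[OF h] ring_hom_mult[OF h] ring_hom_add[OF h] ring_hom_one[OF h]
  \<comment> \<open>\<open>c\<close> need not lie in \<open>X\<close>, but \<open>h(c)\<close> is a unit all the same, as \<open>h(c) = h(x)\<^sup>-\<^sup>1 h(x c)\<close>\<close>
  have expand: "h (s \<otimes>\<^bsub>S\<^esub> c) \<otimes>\<^bsub>A\<^esub> inv\<^bsub>A\<^esub> h (x \<otimes>\<^bsub>S\<^esub> c) = h s \<otimes>\<^bsub>A\<^esub> inv\<^bsub>A\<^esub> h x"
    if "s \<in> carrier S" "x \<in> X" "c \<in> carrier S" "x \<otimes>\<^bsub>S\<^esub> c \<in> X" for s x c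
  proof -
    note cl = hom(1)[OF that(1)] hom(1)[OF that(3)] u[OF that(2)] u[OF that(4)] A.Units_closed[OF u[OF that(2)]]
    have "h c = inv\<^bsub>A\<^esub> h x \<otimes>\<^bsub>A\<^esub> h (x \<otimes>\<^bsub>S\<^esub> c)"
      using that X_sub cl by (simp add: hom A.m_assoc[symmetric])
    then have "h c \<otimes>\<^bsub>A\<^esub> inv\<^bsub>A\<^esub> h (x \<otimes>\<^bsub>S\<^esub> c) = inv\<^bsub>A\<^esub> h x"
      using cl by (simp add: A.m_assoc A.Units_closed)
    then show ?thesis using that cl by (simp add: hom A.m_assoc)
  qed
  have wd: "h s \<otimes>\<^bsub>A\<^esub> inv\<^bsub>A\<^esub> h x = h t \<otimes>\<^bsub>A\<^esub> inv\<^bsub>A\<^esub> h y"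
    if st: "s \<in> carrier S" "x \<in> X" "t \<in> carrier S" "y \<in> X" "rel s x t y" for s x t y
  proof -
    obtain c d where "c \<in> carrier S" "d \<in> carrier S" "s \<otimes>\<^bsub>S\<^esub> c = t \<otimes>\<^bsub>S\<^esub> d"
      "x \<otimes>\<^bsub>S\<^esub> c = y \<otimes>\<^bsub>S\<^esub> d" "x \<otimes>\<^bsub>S\<^esub> c \<in> X"
      using st(5) by (auto simp: rel_def)
    then show ?thesis using expand[of s x c] expand[of t y d] st by simp
  qed
  define H where "H B = (case (SOME p. p \<in> B) of (s, x) \<Rightarrow> h s \<otimes>\<^bsub>A\<^esub> inv\<^bsub>A\<^esub> h x)" for B
  have H: "H (F s x) = h s \<otimes>\<^bsub>A\<^esub> inv\<^bsub>A\<^esub> h x" if "s \<in> carrier S" "x \<in> X" for s x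
  proof -
    obtain t y where ty: "(SOME p. p \<in> F s x) = (t, y)" by fastforce
    then have "(t, y) \<in> F s x" using someI[of "\<lambda>p. p \<in> F s x" "(s, x)"] F_self[OF that] by simp
    then show ?thesis using wd[of s x t y] that F_iff by (simp add: H_def ty)
  qed
  note cl = A.Units_closed[OF u] A.Units_inv_closed[OF u] hom
  have "H \<in> ring_hom Q A"
  proof (rule ring_hom_memI)
    fix B assume B: "B \<in> carrier Q"
    then obtain b x where b: "b \<in> carrier S" "x \<in> X" "B = F b x" by (auto simp: Q_simps)
    show "H B \<in> carrier A" using b by (simp add: H cl)
    fix C assume C: "C \<in> carrier Q"
    obtain c y where c: "c \<in> carrier S" "y \<in> X" "C = F (x \<otimes>\<^bsub>S\<^esub> c) y" using absorb[OF C b(2)] by metis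
    have "inv\<^bsub>A\<^esub> h x \<otimes>\<^bsub>A\<^esub> (h x \<otimes>\<^bsub>A\<^esub> (h c \<otimes>\<^bsub>A\<^esub> inv\<^bsub>A\<^esub> h y)) = h c \<otimes>\<^bsub>A\<^esub> inv\<^bsub>A\<^esub> h y"
      using b c by (simp add: A.m_assoc[symmetric] cl u)
    then show "H (B \<otimes>\<^bsub>Q\<^esub> C) = H B \<otimes>\<^bsub>A\<^esub> H C"
      using b c X_sub by (simp add: F_mult_same H cl A.m_assoc)
    obtain b' c' z where d: "b' \<in> carrier S" "c' \<in> carrier S" "z \<in> X" "B = F b' z" "C = F c' z"
      using common2[OF B C] by metis
    then show "H (B \<oplus>\<^bsub>Q\<^esub> C) = H B \<oplus>\<^bsub>A\<^esub> H C" by (simp add: F_add_same H cl A.l_distr)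
  next
    show "H \<one>\<^bsub>Q\<^esub> = \<one>\<^bsub>A\<^esub>" using H[of "\<one>\<^bsub>S\<^esub>" "\<one>\<^bsub>S\<^esub>"] X_one by (simp add: Q_simps hom)
  qed
  moreover have "H (emb s) = h s" if "s \<in> carrier S" for s
    using H[of s "\<one>\<^bsub>S\<^esub>"] that X_one by (simp add: rfrac_emb_def hom)
  ultimately show thesis using that H by blast
qed

text \<open>A homomorphism maps \<open>s x\<^sup>-\<^sup>1\<close> to its value at \<open>s\<close> times the inverse of its value at \<open>x\<close>.\<close>

lemma right_fractions_hom_eqI:
  assumes "ring A" "h \<in> ring_hom Q A" "k \<in> ring_hom Q A"
    and eq: "\<And>s. s \<in> carrier S \<Longrightarrow> h (emb s) = k (emb s)"
    and "B \<in> carrier Q"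
  shows "h B = k B"
proof -
  interpret A: ring A by fact
  obtain s x where b: "s \<in> carrier S" "x \<in> X" "B = F s x" using assms(5) by (auto simp: Q_simps)
  note c = ring_hom_closed[OF rfrac_emb_hom]
  have "l B = l (emb s) \<otimes>\<^bsub>A\<^esub> inv\<^bsub>A\<^esub> (l (emb x))" if "l \<in> ring_hom Q A" for l
    using ring_hom_Units[OF Q.monoid_axioms A.monoid_axioms that emb_Units[OF b(2)]] b c
    by (simp add: F_eq_emb_inv ring_hom_mult[OF that] emb_Units)
  from this[OF assms(2)] this[OF assms(3)] show ?thesis using eq b X_sub by simp
qed

end


section \<open>Extension of automorphisms and skew derivations to fractions\<close>

text \<open>
  The upper triangular matrices with rows \<open>(a, b)\<close> and \<open>(0, c)\<close>.  They turn skew derivations into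
  homomorphisms: \<open>\<delta>\<close> is a left \<open>\<tau>\<close>-derivation exactly if mapping \<open>r\<close> to the matrix with rows
  \<open>(\<tau>(r), \<delta>(r))\<close> and \<open>(0, r)\<close> is a homomorphism, so that extending \<open>\<delta>\<close> to fractions becomes an instance of
  the universal property.
\<close>

definition triangular :: "('a, 'm) ring_scheme \<Rightarrow> ('a \<times> 'a \<times> 'a) ring" where
  "triangular A =
     \<lparr> carrier = carrier A \<times> carrier A \<times> carrier A,
       mult = (\<lambda>(a, b, c) (a', b', c').
         (a \<otimes>\<^bsub>A\<^esub> a', a \<otimes>\<^bsub>A\<^esub> b' \<oplus>\<^bsub>A\<^esub> b \<otimes>\<^bsub>A\<^esub> c', c \<otimes>\<^bsub>A\<^esub> c')),
       one = (\<one>\<^bsub>A\<^esub>, \<zero>\<^bsub>A\<^esub>, \<one>\<^bsub>A\<^esub>),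
       zero = (\<zero>\<^bsub>A\<^esub>, \<zero>\<^bsub>A\<^esub>, \<zero>\<^bsub>A\<^esub>),
       add = (\<lambda>(a, b, c) (a', b', c'). (a \<oplus>\<^bsub>A\<^esub> a', b \<oplus>\<^bsub>A\<^esub> b', c \<oplus>\<^bsub>A\<^esub> c')) \<rparr>"

lemma triangular_simps:
  "carrier (triangular A) = carrier A \<times> carrier A \<times> carrier A"
  "(a, b, c) \<otimes>\<^bsub>triangular A\<^esub> (a', b', c') =
    (a \<otimes>\<^bsub>A\<^esub> a', a \<otimes>\<^bsub>A\<^esub> b' \<oplus>\<^bsub>A\<^esub> b \<otimes>\<^bsub>A\<^esub> c', c \<otimes>\<^bsub>A\<^esub> c')"
  "(a, b, c) \<oplus>\<^bsub>triangular A\<^esub> (a', b', c') = (a \<oplus>\<^bsub>A\<^esub> a', b \<oplus>\<^bsub>A\<^esub> b', c \<oplus>\<^bsub>A\<^esub> c')"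
  "\<one>\<^bsub>triangular A\<^esub> = (\<one>\<^bsub>A\<^esub>, \<zero>\<^bsub>A\<^esub>, \<one>\<^bsub>A\<^esub>)"
  "\<zero>\<^bsub>triangular A\<^esub> = (\<zero>\<^bsub>A\<^esub>, \<zero>\<^bsub>A\<^esub>, \<zero>\<^bsub>A\<^esub>)"
  by (simp_all add: triangular_def)

context ring
begin

lemma triangular_ring: "ring (triangular R)"
proof (rule ringI)
  show "abelian_group (triangular R)"
  proof (rule abelian_groupI)
    fix p assume "p \<in> carrier (triangular R)"
    then obtain a b c where "p = (a, b, c)" "a \<in> carrier R" "b \<in> carrier R" "c \<in> carrier R"
      by (auto simp: triangular_simps)
    then show "\<exists>q\<in>carrier (triangular R). q \<oplus>\<^bsub>triangular R\<^esub> p = \<zero>\<^bsub>triangular R\<^esub>"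
      by (intro bexI[of _ "(\<ominus> a, \<ominus> b, \<ominus> c)"]) (auto simp: triangular_simps l_neg)
  qed (auto simp: triangular_simps a_assoc a_comm a_lcomm)
  show "Group.monoid (triangular R)"
    by (rule monoidI)
       (auto simp: triangular_simps m_assoc l_distr r_distr a_assoc)
qed (auto simp: triangular_simps l_distr r_distr a_assoc a_lcomm)

lemma triangular_Units:
  assumes "p \<in> Units R" "b \<in> carrier R" "q \<in> Units R"
  shows "(p, b, q) \<in> Units (triangular R)"
proof -
  have cl: "p \<in> carrier R" "q \<in> carrier R" "inv p \<in> carrier R" "inv q \<in> carrier R"
    using assms by auto
  \<comment> \<open>the inverse is \<open>(p\<inverse>, - p\<inverse> b q\<inverse>, q\<inverse>)\<close>\<close>
  have "p \<otimes> (inv p \<otimes> (b \<otimes> inv q)) = b \<otimes> inv q"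
    using assms cl by (simp add: m_assoc[symmetric])
  moreover have "inv p \<otimes> b \<otimes> inv q \<otimes> q = inv p \<otimes> b"
    using assms cl by (simp add: m_assoc)
  moreover define i where "i = (inv p, \<ominus> (inv p \<otimes> b \<otimes> inv q), inv q)"
  ultimately have "i \<in> carrier (triangular R)"
    "i \<otimes>\<^bsub>triangular R\<^esub> (p, b, q) = \<one>\<^bsub>triangular R\<^esub>"
    "(p, b, q) \<otimes>\<^bsub>triangular R\<^esub> i = \<one>\<^bsub>triangular R\<^esub>"
    using assms cl by (auto simp: triangular_simps l_minus r_minus l_neg r_neg m_assoc)
  then show ?thesis
    using assms(2) cl by (auto simp: Units_def triangular_simps(1))
qed

end

lemma triangular_hom_iff:
  assumes "ring A" "ring B"
  shows "(\<lambda>r. (f r, d r, g r)) \<in> ring_hom A (triangular B) \<longleftrightarrow>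
    f \<in> ring_hom A B \<and> g \<in> ring_hom A B \<and> d \<in> carrier A \<rightarrow> carrier B \<and> d \<one>\<^bsub>A\<^esub> = \<zero>\<^bsub>B\<^esub> \<and>
    (\<forall>r\<in>carrier A. \<forall>s\<in>carrier A. d (r \<oplus>\<^bsub>A\<^esub> s) = d r \<oplus>\<^bsub>B\<^esub> d s) \<and>
    (\<forall>r\<in>carrier A. \<forall>s\<in>carrier A. d (r \<otimes>\<^bsub>A\<^esub> s) = f r \<otimes>\<^bsub>B\<^esub> d s \<oplus>\<^bsub>B\<^esub> d r \<otimes>\<^bsub>B\<^esub> g s)"
  by (auto simp: ring_hom_def triangular_simps Pi_def)

lemma left_derivation_one:
  assumes "ring R" "\<tau> \<in> ring_hom R R" "left_derivation R \<tau> \<delta>"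
  shows "\<delta> \<one>\<^bsub>R\<^esub> = \<zero>\<^bsub>R\<^esub>"
proof -
  interpret ring R by fact
  interpret skew R "UP R" \<tau> \<delta>
    using assms by unfold_locales (auto simp: UP_ring_def)
  show ?thesis by (rule delta_one)
qed

context right_denom
begin

lemma emb_closed: "s \<in> carrier S \<Longrightarrow> emb s \<in> carrier Q"
  by (rule ring_hom_closed[OF rfrac_emb_hom])

lemma derivation_eqI:
  assumes \<sigma>: "\<sigma> \<in> ring_hom Q Q"
    and \<epsilon>: "left_derivation Q \<sigma> \<epsilon>" and \<epsilon>': "left_derivation Q \<sigma> \<epsilon>'"
    and eq: "\<And>s. s \<in> carrier S \<Longrightarrow> \<epsilon> (emb s) = \<epsilon>' (emb s)"
    and B: "B \<in> carrier Q"
  shows "\<epsilon> B = \<epsilon>' B"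
proof -
  obtain s x where b: "s \<in> carrier S" "x \<in> X" "B = F s x" using B by (auto simp: Q_simps)
  note x = emb_Units[OF b(2)] and cl = emb_closed[OF X_sub[OF b(2)]] emb_closed[OF b(1)]
  have Bx: "B \<otimes>\<^bsub>Q\<^esub> emb x = emb s"
    using b x cl by (simp add: F_eq_emb_inv Q.m_assoc)
  \<comment> \<open>solve \<open>\<epsilon>(s) = \<epsilon>(B x) = \<sigma>(B) \<epsilon>(x) + \<epsilon>(B) x\<close> for \<open>\<epsilon>(B)\<close>\<close>
  have "d B = (d (emb s) \<ominus>\<^bsub>Q\<^esub> \<sigma> B \<otimes>\<^bsub>Q\<^esub> d (emb x)) \<otimes>\<^bsub>Q\<^esub> inv\<^bsub>Q\<^esub> (emb x)"
    if d: "left_derivation Q \<sigma> d" for d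
  proof -
    have dc: "d C \<in> carrier Q" if "C \<in> carrier Q" for C
      using d that by (auto simp: left_derivation_def)
    have "d (emb s) = \<sigma> B \<otimes>\<^bsub>Q\<^esub> d (emb x) \<oplus>\<^bsub>Q\<^esub> d B \<otimes>\<^bsub>Q\<^esub> emb x"
      using d B cl unfolding Bx[symmetric] left_derivation_def by blast
    then have "d (emb s) \<ominus>\<^bsub>Q\<^esub> \<sigma> B \<otimes>\<^bsub>Q\<^esub> d (emb x) = d B \<otimes>\<^bsub>Q\<^esub> emb x"
      using B cl dc ring_hom_closed[OF \<sigma> B]
      by (simp add: a_minus_def Q.a_ac Q.r_neg Q.r_neg1 Q.r_neg2)
    then show ?thesis using x cl dc B by (simp add: Q.m_assoc)
  qed
  from this[OF \<epsilon>] this[OF \<epsilon>'] show ?thesis using eq b X_sub by simp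
qed

text \<open>
  The extension maps \<open>s x\<^sup>-\<^sup>1\<close> to \<open>\<tau>(s) \<tau>(x)\<^sup>-\<^sup>1\<close>; it is bijective because \<open>\<tau>\<close> can be undone in every
  relation between fractions.
\<close>

lemma right_fractions_aut:
  assumes \<tau>: "\<tau> \<in> ring_aut S" and X: "\<tau> ` X = X"
  obtains \<sigma> where "\<sigma> \<in> ring_aut Q" "\<And>s. s \<in> carrier S \<Longrightarrow> \<sigma> (emb s) = emb (\<tau> s)"
proof -
  have hom: "\<tau> \<in> ring_hom S S" and bij: "bij_betw \<tau> (carrier S) (carrier S)"
    using \<tau> by (auto simp: ring_iso_def)
  note \<tau>cl = ring_hom_closed[OF hom]
  have "emb \<circ> \<tau> \<in> ring_hom S Q" using hom rfrac_emb_hom by (rule ring_hom_trans)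
  moreover have "(emb \<circ> \<tau>) x \<in> Units Q" if "x \<in> X" for x
    using emb_Units[of "\<tau> x"] that X by auto
  ultimately obtain \<sigma> where \<sigma>: "\<sigma> \<in> ring_hom Q Q"
      "\<And>s x. \<lbrakk>s \<in> carrier S; x \<in> X\<rbrakk> \<Longrightarrow> \<sigma> (F s x) = (emb \<circ> \<tau>) s \<otimes>\<^bsub>Q\<^esub> inv\<^bsub>Q\<^esub> ((emb \<circ> \<tau>) x)"
      "\<And>s. s \<in> carrier S \<Longrightarrow> \<sigma> (emb s) = (emb \<circ> \<tau>) s"
    using right_fractions_universal[OF right_fractions_ring, of "emb \<circ> \<tau>"] by metis
  have F: "\<sigma> (F s x) = F (\<tau> s) (\<tau> x)" if "s \<in> carrier S" "x \<in> X" for s x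
    using \<sigma>(2)[OF that] F_eq_emb_inv[of "\<tau> s" "\<tau> x"] that X \<tau>cl by auto
  have "inj_on \<sigma> (carrier Q)"
  proof (rule inj_onI)
    fix B C assume BC: "B \<in> carrier Q" "C \<in> carrier Q" "\<sigma> B = \<sigma> C"
    obtain b c x where b: "b \<in> carrier S" "c \<in> carrier S" "x \<in> X" "B = F b x" "C = F c x"
      using common2 BC by metis
    have "rel (\<tau> b) (\<tau> x) (\<tau> c) (\<tau> x)"
    proof -
      have "\<tau> x \<in> X" using b X by blast
      moreover have "F (\<tau> b) (\<tau> x) = F (\<tau> c) (\<tau> x)" using BC(3) b F by simp
      ultimately show ?thesis using F_eq_iff b \<tau>cl by metis
    qed
    then obtain k l where kl: "k \<in> carrier S" "l \<in> carrier S" "\<tau> b \<otimes> k = \<tau> c \<otimes> l"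
      "\<tau> x \<otimes> k = \<tau> x \<otimes> l" "\<tau> x \<otimes> k \<in> X" by (auto simp: rel_def)
    obtain k' l' where k': "k' \<in> carrier S" "\<tau> k' = k" "l' \<in> carrier S" "\<tau> l' = l"
      using kl bij by (metis bij_betw_imp_surj_on imageE)
    have xc: "x \<in> carrier S" using b X_sub by simp
    have inj: "s = t" if "\<tau> s = \<tau> t" "s \<in> carrier S" "t \<in> carrier S" for s t
      using bij that by (meson bij_betw_imp_inj_on inj_onD)
    have "b \<otimes> k' = c \<otimes> l'" "x \<otimes> k' = x \<otimes> l'"
      using inj[of "b \<otimes> k'" "c \<otimes> l'"] inj[of "x \<otimes> k'" "x \<otimes> l'"] kl k' b xc
      by (simp_all add: ring_hom_mult[OF hom])
    moreover have "x \<otimes> k' \<in> X"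
    proof -
      have "\<tau> (x \<otimes> k') \<in> \<tau> ` X" using kl k' xc X by (simp add: ring_hom_mult[OF hom])
      then obtain z where "z \<in> X" "\<tau> (x \<otimes> k') = \<tau> z" by auto
      then show ?thesis using inj[of "x \<otimes> k'" z] xc k' X_sub by simp
    qed
    ultimately have "rel b x c x" using k' unfolding rel_def by metis
    then show "B = C" using b F_eq_iff by simp
  qed
  moreover have "\<sigma> ` carrier Q = carrier Q"
  proof
    show "\<sigma> ` carrier Q \<subseteq> carrier Q" using ring_hom_closed[OF \<sigma>(1)] by auto
    show "carrier Q \<subseteq> \<sigma> ` carrier Q"
    proof
      fix B assume "B \<in> carrier Q"
      then obtain s x where b: "s \<in> carrier S" "x \<in> X" "B = F s x" by (auto simp: Q_simps)
      obtain s' where "s' \<in> carrier S" "\<tau> s' = s"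
        using b bij by (metis bij_betw_imp_surj_on imageE)
      moreover obtain x' where "x' \<in> X" "\<tau> x' = x" using X b by (metis imageE)
      ultimately show "B \<in> \<sigma> ` carrier Q" using b F[of s' x'] F_closed by (metis imageI)
    qed
  qed
  ultimately have "\<sigma> \<in> ring_aut Q" using \<sigma>(1) by (simp add: ring_iso_def bij_betw_def)
  then show thesis using that \<sigma>(3) by simp
qed

text \<open>
  The homomorphism from \<open>S\<close> to triangular matrices over \<open>S X\<^sup>-\<^sup>1\<close> given by \<open>\<delta>\<close> inverts \<open>X\<close>, since its diagonal
  entries \<open>\<tau>(x)\<close> and \<open>x\<close> are invertible there.  It therefore extends to the fractions; by
  uniqueness the diagonal entries of the extension are \<open>\<sigma>\<close> and the identity, which makes the
  off-diagonal entry a \<open>\<sigma>\<close>-derivation.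
\<close>

lemma right_fractions_der:
  assumes \<tau>: "\<tau> \<in> ring_hom S S" and \<delta>: "left_derivation S \<tau> \<delta>" and X: "\<tau> ` X \<subseteq> X"
    and \<sigma>: "\<sigma> \<in> ring_hom Q Q" and \<sigma>\<tau>: "\<And>s. s \<in> carrier S \<Longrightarrow> \<sigma> (emb s) = emb (\<tau> s)"
  obtains \<epsilon> where "left_derivation Q \<sigma> \<epsilon>" "\<And>s. s \<in> carrier S \<Longrightarrow> \<epsilon> (emb s) = emb (\<delta> s)"
proof -
  note e = rfrac_emb_hom and T = Q.triangular_ring
  have \<delta>1: "\<delta> \<one> = \<zero>" by (rule left_derivation_one[OF ring_axioms \<tau> \<delta>])
  let ?h = "\<lambda>s. (emb (\<tau> s), emb (\<delta> s), emb s)"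
  have "emb \<circ> \<tau> \<in> ring_hom S Q" using \<tau> e by (rule ring_hom_trans)
  then have "emb (\<tau> s) \<in> carrier Q" "s \<in> carrier S \<Longrightarrow> \<tau> s \<in> carrier S" "(\<lambda>s. emb (\<tau> s)) \<in> ring_hom S Q"
    if "s \<in> carrier S" for s
    using ring_hom_closed[OF \<tau>] emb_closed that by (auto simp: comp_def)
  moreover have "\<delta> s \<in> carrier S" if "s \<in> carrier S" for s
    using \<delta> that by (auto simp: left_derivation_def)
  moreover have "emb \<zero> = \<zero>\<^bsub>Q\<^esub>" by (simp add: rfrac_emb_def Q_simps)
  moreover have "emb \<in> ring_hom S Q" by (rule e)
  ultimately have h: "?h \<in> ring_hom S (triangular Q)"
    unfolding triangular_hom_iff[OF ring_axioms right_fractions_ring]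
    using \<delta> \<delta>1 \<open>emb \<circ> \<tau> \<in> ring_hom S Q\<close>
    by (auto simp: left_derivation_def ring_hom_add[OF e] ring_hom_mult[OF e] emb_closed comp_def)
  have "?h x \<in> Units (triangular Q)" if "x \<in> X" for x
    using that X X_sub \<delta> by (intro Q.triangular_Units emb_Units emb_closed)
      (auto simp: left_derivation_def)
  then obtain H where H: "H \<in> ring_hom Q (triangular Q)"
      "\<And>s. s \<in> carrier S \<Longrightarrow> H (emb s) = ?h s"
    using right_fractions_universal[OF T h] by metis
  define f d g where "f B = fst (H B)" and "d B = fst (snd (H B))" and "g B = snd (snd (H B))" for B
  have "H = (\<lambda>B. (f B, d B, g B))" by (simp add: f_def d_def g_def)
  then have fdg: "f \<in> ring_hom Q Q" "g \<in> ring_hom Q Q" "d \<in> carrier Q \<rightarrow> carrier Q"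
      "\<And>B C. \<lbrakk>B \<in> carrier Q; C \<in> carrier Q\<rbrakk> \<Longrightarrow> d (B \<oplus>\<^bsub>Q\<^esub> C) = d B \<oplus>\<^bsub>Q\<^esub> d C"
      "\<And>B C. \<lbrakk>B \<in> carrier Q; C \<in> carrier Q\<rbrakk> \<Longrightarrow> d (B \<otimes>\<^bsub>Q\<^esub> C) = f B \<otimes>\<^bsub>Q\<^esub> d C \<oplus>\<^bsub>Q\<^esub> d B \<otimes>\<^bsub>Q\<^esub> g C"
    using H(1) triangular_hom_iff[OF right_fractions_ring right_fractions_ring, of f d g] by simp_all
  have "f B = \<sigma> B" if "B \<in> carrier Q" for B
    using right_fractions_hom_eqI[OF right_fractions_ring fdg(1) \<sigma> _ that] H(2) \<sigma>\<tau> by (simp add: f_def)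
  moreover have "g B = B" if "B \<in> carrier Q" for B
    using right_fractions_hom_eqI[OF right_fractions_ring fdg(2) _ _ that, of "\<lambda>x. x"] H(2)
    by (simp add: g_def ring_hom_def)
  ultimately have "left_derivation Q \<sigma> d" using fdg unfolding left_derivation_def by simp
  moreover have "d (emb s) = emb (\<delta> s)" if "s \<in> carrier S" for s using H(2)[OF that] by (simp add: d_def)
  ultimately show thesis using that by blast
qed

lemma induced_aut:
  assumes "\<tau> \<in> ring_aut S" and "\<tau> ` X = X"
  shows "induced_aut S X \<tau> \<in> ring_aut Q"
    and "s \<in> carrier S \<Longrightarrow> induced_aut S X \<tau> (emb s) = emb (\<tau> s)"
proof -
  obtain \<sigma> where \<sigma>: "\<sigma> \<in> ring_aut Q" "\<And>s. s \<in> carrier S \<Longrightarrow> \<sigma> (emb s) = emb (\<tau> s)"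
    using right_fractions_aut[OF assms] by metis
  let ?P = "\<lambda>\<sigma>. \<sigma> \<in> extensional (carrier Q) \<and> \<sigma> \<in> ring_aut Q \<and>
    (\<forall>r\<in>carrier S. \<sigma> (emb r) = emb (\<tau> r))"
  have restr: "?P (restrict \<sigma> (carrier Q))"
    using \<sigma> emb_closed
    by (auto simp: ring_iso_def ring_hom_def Pi_def inj_on_restrict_eq bij_betw_def)
  have uniq: "\<sigma>1 = \<sigma>2" if "?P \<sigma>1" "?P \<sigma>2" for \<sigma>1 \<sigma>2
    using that right_fractions_hom_eqI[OF right_fractions_ring, of \<sigma>1 \<sigma>2]
    by (intro extensionalityI[of _ "carrier Q"]) (auto simp: ring_iso_def)
  have "?P (THE \<sigma>. ?P \<sigma>)" by (rule theI[of ?P, OF restr uniq[OF _ restr]])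
  then show "induced_aut S X \<tau> \<in> ring_aut Q"
    and "s \<in> carrier S \<Longrightarrow> induced_aut S X \<tau> (emb s) = emb (\<tau> s)"
    by (simp_all add: induced_aut_def)
qed

lemma induced_der:
  assumes "\<tau> \<in> ring_aut S" and "\<tau> ` X = X" and "left_derivation S \<tau> \<delta>"
  shows "left_derivation Q (induced_aut S X \<tau>) (induced_der S X \<tau> \<delta>)"
    and "s \<in> carrier S \<Longrightarrow> induced_der S X \<tau> \<delta> (emb s) = emb (\<delta> s)"
proof -
  have \<sigma>: "induced_aut S X \<tau> \<in> ring_hom Q Q" using induced_aut(1)[OF assms(1,2)] by (simp add: ring_iso_def)
  have \<tau>: "\<tau> \<in> ring_hom S S" using assms(1) by (simp add: ring_iso_def)
  obtain \<epsilon> where \<epsilon>: "left_derivation Q (induced_aut S X \<tau>) \<epsilon>"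
      "\<And>s. s \<in> carrier S \<Longrightarrow> \<epsilon> (emb s) = emb (\<delta> s)"
    using right_fractions_der[OF \<tau> assms(3) _ \<sigma>] induced_aut(2)[OF assms(1,2)] assms(2) by (metis order_refl)
  let ?P = "\<lambda>\<epsilon>. \<epsilon> \<in> extensional (carrier Q) \<and> left_derivation Q (induced_aut S X \<tau>) \<epsilon> \<and>
    (\<forall>r\<in>carrier S. \<epsilon> (emb r) = emb (\<delta> r))"
  have restr: "?P (restrict \<epsilon> (carrier Q))"
    using \<epsilon> emb_closed by (auto simp: left_derivation_def Pi_def)
  have uniq: "\<epsilon>1 = \<epsilon>2" if "?P \<epsilon>1" "?P \<epsilon>2" for \<epsilon>1 \<epsilon>2
    using that derivation_eqI[OF \<sigma>, of \<epsilon>1 \<epsilon>2] by (intro extensionalityI[of _ "carrier Q"]) auto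
  have "?P (THE \<epsilon>. ?P \<epsilon>)" by (rule theI[of ?P, OF restr uniq[OF _ restr]])
  then show "left_derivation Q (induced_aut S X \<tau>) (induced_der S X \<tau> \<delta>)"
    and "s \<in> carrier S \<Longrightarrow> induced_der S X \<tau> \<delta> (emb s) = emb (\<delta> s)"
    by (simp_all add: induced_der_def)
qed

end


section \<open>Generators and universal properties of Ore extensions and amalgams\<close>

context skew
begin

text \<open>Every element is a sum of products \<open>r x\<^sup>i\<close>, so \<open>R\<close> and \<open>x\<close> generate the Ore extension as a ring.\<close>

lemma ore_ext_induct [consumes 1, case_names const var add mult]:
  assumes "p \<in> carrier E"
    and const: "\<And>r. r \<in> carrier R \<Longrightarrow> Z (ore_const R r)"
    and var: "Z (ore_var R)"
    and add: "\<And>p q. \<lbrakk>p \<in> carrier E; q \<in> carrier E; Z p; Z q\<rbrakk> \<Longrightarrow> Z (p \<oplus>\<^bsub>E\<^esub> q)"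
    and mult: "\<And>p q. \<lbrakk>p \<in> carrier E; q \<in> carrier E; Z p; Z q\<rbrakk> \<Longrightarrow> Z (p \<otimes>\<^bsub>E\<^esub> q)"
  shows "Z p"
proof -
  interpret E: ring E by (rule ore_ext_ring)
  have p: "p \<in> carrier P" using assms(1) by (simp add: E_simps)
  have v: "ore_var R \<in> carrier E" by (simp add: ore_var_X X_closed E_simps del: monom_one)
  have c: "ore_const R r \<in> carrier E" if "r \<in> carrier R" for r
    using that by (simp add: E_simps ore_const_closed)
  have pow: "Z (ore_var R [^]\<^bsub>E\<^esub> i)" for i :: nat
  proof (induction i)
    case 0
    show ?case using const[OF R.one_closed] by (simp add: ore_const_def E_simps P_def)
  qed (simp add: mult v var)
  have summand: "Z (p i \<odot>\<^bsub>P\<^esub> (X ^^ i) (monom P \<one> 0))" "p i \<odot>\<^bsub>P\<^esub> (X ^^ i) (monom P \<one> 0) \<in> carrier E" for i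
  proof -
    have "p i \<odot>\<^bsub>P\<^esub> (X ^^ i) (monom P \<one> 0) = ore_const R (p i) \<otimes>\<^bsub>E\<^esub> ore_var R [^]\<^bsub>E\<^esub> i"
      using p by (simp add: Xn_monom ore_var_pow E_monom td del: monom_one)
    then show "Z (p i \<odot>\<^bsub>P\<^esub> (X ^^ i) (monom P \<one> 0))" "p i \<odot>\<^bsub>P\<^esub> (X ^^ i) (monom P \<one> 0) \<in> carrier E"
      using p by (simp_all add: mult c v const pow td)
  qed
  have "Z (L N p (monom P \<one> 0))" for N
  proof (induction N)
    case 0
    show ?case using summand(1)[of 0] p by (simp add: L_0 del: monom_one)
  next
    case (Suc N)
    have "L N p (monom P \<one> 0) \<in> carrier E" using p by (simp add: E_simps L_closed del: monom_one)
    then have "Z (p (Suc N) \<odot>\<^bsub>P\<^esub> (X ^^ Suc N) (monom P \<one> 0) \<oplus>\<^bsub>E\<^esub> L N p (monom P \<one> 0))"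
      using Suc summand[of "Suc N"] by (intro add) simp_all
    then show ?case using p by (simp add: L_Suc E_simps del: monom_one funpow.simps)
  qed
  then have "Z (L (deg R p) p (monom P \<one> 0))" .
  then show ?thesis using p by (simp add: L_bound E_one_r del: monom_one)
qed

text \<open>
  The homomorphism must be \<open>\<Sum> p\<^sub>i x\<^sup>i \<mapsto> \<Sum> h(p\<^sub>i) a\<^sup>i\<close>.  By \<open>comm\<close>, left multiplication by \<open>x\<close> corresponds to left
  multiplication by \<open>a\<close>, and as left multiplication by any polynomial is built from this and from left
  multiplication by constants, the map is multiplicative.
\<close>

lemma ore_ext_universal:
  assumes A: "ring A" and h: "h \<in> ring_hom R A" and a: "a \<in> carrier A"
    and comm: "\<And>r. r \<in> carrier R \<Longrightarrow> a \<otimes>\<^bsub>A\<^esub> h r = h (\<tau> r) \<otimes>\<^bsub>A\<^esub> a \<oplus>\<^bsub>A\<^esub> h (\<delta> r)"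
  obtains H where "H \<in> ring_hom E A" "\<And>r. r \<in> carrier R \<Longrightarrow> H (ore_const R r) = h r"
    "H (ore_var R) = a"
proof -
  interpret A: ring A by fact
  note hc = ring_hom_closed[OF h]
  have h0: "h \<zero> = \<zero>\<^bsub>A\<^esub>" using ring_hom_zero[OF h] R.ring_axioms A by blast
  \<comment> \<open>as for the product of the Ore extension, a summation bound \<open>N\<close> above the degree makes inductions possible\<close>
  define G where "G N p = (\<Oplus>\<^bsub>A\<^esub> i\<in>{..N}. h (p i) \<otimes>\<^bsub>A\<^esub> a [^]\<^bsub>A\<^esub> i)" for N :: nat and p
  define H where "H p = G (deg R p) p" for p
  have G_closed: "G N p \<in> carrier A" if "p \<in> carrier P" for N p
    unfolding G_def using that a by (intro A.finsum_closed) (auto simp: hc td)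
  have G_0: "G 0 p = h (p 0)" if "p \<in> carrier P" for p
    using that by (simp add: G_def hc td)
  have G_Suc: "G (Suc N) p = h (p (Suc N)) \<otimes>\<^bsub>A\<^esub> a [^]\<^bsub>A\<^esub> Suc N \<oplus>\<^bsub>A\<^esub> G N p"
    if "p \<in> carrier P" for N p
    using that a by (simp add: G_def hc td Pi_def)
  have G_H: "G N p = H p" if "p \<in> carrier P" "deg R p \<le> N" for N p
    using that(2) unfolding H_def
  proof (induction N rule: dec_induct)
    case (step N)
    have "p (Suc N) = \<zero>" using deg_aboveD[of p "Suc N"] that step by simp
    then show ?case using step that a by (simp add: G_Suc h0 G_closed)
  qed simp
  have H_closed: "H p \<in> carrier A" if "p \<in> carrier P" for p
    using that by (simp add: H_def G_closed)
  have G_add: "G N (p \<oplus>\<^bsub>P\<^esub> q) = G N p \<oplus>\<^bsub>A\<^esub> G N q" if "p \<in> carrier P" "q \<in> carrier P" for N p q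
    unfolding G_def using that a
    by (subst A.finsum_addf[symmetric])
       (auto simp: td hc nth_add ring_hom_add[OF h] A.l_distr intro!: A.finsum_cong)
  have H_add: "H (p \<oplus>\<^bsub>P\<^esub> q) = H p \<oplus>\<^bsub>A\<^esub> H q" if "p \<in> carrier P" "q \<in> carrier P" for p q
    using G_add[OF that, of "max (deg R (p \<oplus>\<^bsub>P\<^esub> q)) (max (deg R p) (deg R q))"] that
    by (simp add: G_H)
  have G_smult: "G N (r \<odot>\<^bsub>P\<^esub> p) = h r \<otimes>\<^bsub>A\<^esub> G N p" if "r \<in> carrier R" "p \<in> carrier P" for N r p
  proof (induction N)
    case 0
    show ?case using that by (simp add: G_0 nth_smult[of _ _ 0] ring_hom_mult[OF h] td)
  next
    case (Suc N)
    then show ?case using that a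
      by (simp add: G_Suc nth_smult[of _ _ "Suc N"] ring_hom_mult[OF h] td hc G_closed A.r_distr A.m_assoc
          del: A.nat_pow_Suc)
  qed
  have H_smult: "H (r \<odot>\<^bsub>P\<^esub> p) = h r \<otimes>\<^bsub>A\<^esub> H p" if "r \<in> carrier R" "p \<in> carrier P" for r p
    using G_smult[OF that, of "max (deg R p) (deg R (r \<odot>\<^bsub>P\<^esub> p))"] that by (simp add: G_H)
  have apow: "a \<otimes>\<^bsub>A\<^esub> (h r \<otimes>\<^bsub>A\<^esub> a [^]\<^bsub>A\<^esub> n) =
      h (\<tau> r) \<otimes>\<^bsub>A\<^esub> a [^]\<^bsub>A\<^esub> Suc n \<oplus>\<^bsub>A\<^esub> h (\<delta> r) \<otimes>\<^bsub>A\<^esub> a [^]\<^bsub>A\<^esub> n" if "r \<in> carrier R" for r and n :: nat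
  proof -
    have "a \<otimes>\<^bsub>A\<^esub> (h r \<otimes>\<^bsub>A\<^esub> a [^]\<^bsub>A\<^esub> n) = (a \<otimes>\<^bsub>A\<^esub> h r) \<otimes>\<^bsub>A\<^esub> a [^]\<^bsub>A\<^esub> n"
      using that a hc by (simp add: A.m_assoc)
    also have "\<dots> = h (\<tau> r) \<otimes>\<^bsub>A\<^esub> (a \<otimes>\<^bsub>A\<^esub> a [^]\<^bsub>A\<^esub> n) \<oplus>\<^bsub>A\<^esub> h (\<delta> r) \<otimes>\<^bsub>A\<^esub> a [^]\<^bsub>A\<^esub> n"
      unfolding comm[OF that] using that a by (simp add: hc td A.l_distr A.m_assoc)
    also have "a \<otimes>\<^bsub>A\<^esub> a [^]\<^bsub>A\<^esub> n = a [^]\<^bsub>A\<^esub> Suc n" using a by (rule A.nat_pow_Suc2[symmetric])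
    finally show ?thesis .
  qed
  have G_X: "G (Suc N) (X p) = a \<otimes>\<^bsub>A\<^esub> G N p \<oplus>\<^bsub>A\<^esub> h (\<delta> (p (Suc N))) \<otimes>\<^bsub>A\<^esub> a [^]\<^bsub>A\<^esub> Suc N"
    if p: "p \<in> carrier P" for N p
  proof (induction N)
    case 0
    have "a \<otimes>\<^bsub>A\<^esub> h (p 0) = h (\<tau> (p 0)) \<otimes>\<^bsub>A\<^esub> a \<oplus>\<^bsub>A\<^esub> h (\<delta> (p 0))" by (rule comm[OF nth_closed[OF p]])
    moreover have "X p (Suc 0) = \<tau> (p 0) \<oplus> \<delta> (p (Suc 0))" "X p 0 = \<delta> (p 0)"
      using p by (simp_all add: X_Suc X_0 td)
    ultimately show ?case using p a
      by (simp add: G_Suc G_0 X_closed td hc ring_hom_add[OF h] A.l_distr A.a_ac)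
  next
    case (Suc N)
    have "G (Suc (Suc N)) (X p) = (h (\<tau> (p (Suc N))) \<otimes>\<^bsub>A\<^esub> a [^]\<^bsub>A\<^esub> Suc (Suc N) \<oplus>\<^bsub>A\<^esub>
        h (\<delta> (p (Suc (Suc N)))) \<otimes>\<^bsub>A\<^esub> a [^]\<^bsub>A\<^esub> Suc (Suc N)) \<oplus>\<^bsub>A\<^esub> G (Suc N) (X p)"
      using p a by (simp add: G_Suc[of _ "Suc N"] X_closed X_Suc td hc ring_hom_add[OF h] A.l_distr del: A.nat_pow_Suc)
    moreover have "a \<otimes>\<^bsub>A\<^esub> G (Suc N) p = (h (\<tau> (p (Suc N))) \<otimes>\<^bsub>A\<^esub> a [^]\<^bsub>A\<^esub> Suc (Suc N) \<oplus>\<^bsub>A\<^esub>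
        h (\<delta> (p (Suc N))) \<otimes>\<^bsub>A\<^esub> a [^]\<^bsub>A\<^esub> Suc N) \<oplus>\<^bsub>A\<^esub> a \<otimes>\<^bsub>A\<^esub> G N p"
      using p a apow[of "p (Suc N)" "Suc N"] by (simp add: G_Suc A.r_distr td hc G_closed)
    ultimately show ?case using p a Suc
      by (simp add: A.a_ac td hc G_closed del: A.nat_pow_Suc)
  qed
  have H_X: "H (X p) = a \<otimes>\<^bsub>A\<^esub> H p" if p: "p \<in> carrier P" for p
  proof -
    let ?N = "max (deg R p) (deg R (X p))"
    have "p (Suc ?N) = \<zero>" using deg_aboveD[of p "Suc ?N"] p by simp
    then show ?thesis using G_X[OF p, of ?N] p a by (simp add: G_H X_closed td h0 H_closed)
  qed
  have H_Xn: "H ((X ^^ n) p) = a [^]\<^bsub>A\<^esub> n \<otimes>\<^bsub>A\<^esub> H p" if p: "p \<in> carrier P" for n p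
  proof (induction n)
    case (Suc n)
    have "H ((X ^^ Suc n) p) = a \<otimes>\<^bsub>A\<^esub> (a [^]\<^bsub>A\<^esub> n \<otimes>\<^bsub>A\<^esub> H p)"
      using p Suc by (simp add: H_X Xn_closed)
    also have "\<dots> = a [^]\<^bsub>A\<^esub> Suc n \<otimes>\<^bsub>A\<^esub> H p"
      using p a by (simp add: A.m_assoc[symmetric] H_closed A.nat_pow_Suc2[symmetric] del: A.nat_pow_Suc)
    finally show ?case .
  qed (use p in \<open>simp add: H_closed\<close>)
  have H_L: "H (L N p q) = G N p \<otimes>\<^bsub>A\<^esub> H q" if "p \<in> carrier P" "q \<in> carrier P" for N p q
  proof (induction N)
    case 0
    show ?case using that by (simp add: L_0 G_0 H_smult td)
  next
    case (Suc N)
    then show ?case using that a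
      by (simp add: L_Suc G_Suc H_add H_smult H_Xn Xn_closed L_closed td hc H_closed G_closed
          A.l_distr A.m_assoc del: funpow.simps A.nat_pow_Suc)
  qed
  have H_const: "H (ore_const R r) = h r" if "r \<in> carrier R" for r
    using that by (simp add: H_def ore_const_def P_def[symmetric] deg_monom_le G_0 nth_monom)
  have H_1: "H (monom P \<one> 0) = \<one>\<^bsub>A\<^esub>"
    using H_const[OF R.one_closed] ring_hom_one[OF h] by (simp add: ore_const_def P_def)
  have "H \<in> ring_hom E A"
  proof (rule ring_hom_memI)
    fix p q assume pq: "p \<in> carrier E" "q \<in> carrier E"
    then show "H (p \<otimes>\<^bsub>E\<^esub> q) = H p \<otimes>\<^bsub>A\<^esub> H q"
      using H_L[of p q "deg R p"] by (simp add: E_simps L_bound G_H)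
    show "H (p \<oplus>\<^bsub>E\<^esub> q) = H p \<oplus>\<^bsub>A\<^esub> H q" using pq by (simp add: E_simps H_add)
  qed (simp_all add: E_simps H_closed H_1 del: monom_one)
  moreover have "H (ore_var R) = a"
    using a by (simp add: ore_var_X H_X H_1 del: monom_one)
  ultimately show thesis using that H_const by blast
qed

end

text \<open>
  Zero, one and negatives need no cases of their own: they are obtained from elements of \<open>S1\<close>, the
  negative of \<open>t\<close> as \<open>(- 1) t\<close>.
\<close>

lemma amalgam_induct [consumes 1, case_names ring inl inr add mult]:
  fixes R :: "('r, 'k) ring_scheme" and S1 :: "('a, 'm) ring_scheme" and S2 :: "('b, 'n) ring_scheme"
    and f :: "'r \<Rightarrow> 'a" and g :: "'r \<Rightarrow> 'b"
  defines "A \<equiv> amalgam R S1 S2 f g"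
  assumes "s \<in> carrier A" and "ring S1"
    and inl: "\<And>a. a \<in> carrier S1 \<Longrightarrow> Z (amalgam_inl R S1 S2 f g a)"
    and inr: "\<And>b. b \<in> carrier S2 \<Longrightarrow> Z (amalgam_inr R S1 S2 f g b)"
    and add: "\<And>s t. \<lbrakk>s \<in> carrier A; t \<in> carrier A; Z s; Z t\<rbrakk> \<Longrightarrow> Z (s \<oplus>\<^bsub>A\<^esub> t)"
    and mult: "\<And>s t. \<lbrakk>s \<in> carrier A; t \<in> carrier A; Z s; Z t\<rbrakk> \<Longrightarrow> Z (s \<otimes>\<^bsub>A\<^esub> t)"
  shows "Z s"
proof -
  interpret S1: ring S1 by fact
  interpret A: ring A unfolding A_def by (rule amalgam_ring)
  let ?c = "aclass R S1 S2 f g"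
  have i: "amalgam_inl R S1 S2 f g \<in> ring_hom S1 A" unfolding A_def by (rule amalgam_inl_hom)
  have car: "carrier A = ?c ` aterms S1 S2" by (simp add: A_def amalgam_def)
  have cl: "?c t \<in> carrier A" if "t \<in> aterms S1 S2" for t using that by (simp add: car)
  have zero: "?c AZero = amalgam_inl R S1 S2 f g \<zero>\<^bsub>S1\<^esub>"
    using ring_hom_zero[OF i S1.ring_axioms A.ring_axioms] by (simp add: A_def amalgam_def)
  have one: "?c AOne = amalgam_inl R S1 S2 f g \<one>\<^bsub>S1\<^esub>"
    using ring_hom_one[OF i] by (simp add: A_def amalgam_def)
  have neg: "?c (ANeg t) = amalgam_inl R S1 S2 f g (\<ominus>\<^bsub>S1\<^esub> \<one>\<^bsub>S1\<^esub>) \<otimes>\<^bsub>A\<^esub> ?c t" if t: "t \<in> aterms S1 S2" for t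
  proof -
    have "?c (ANeg t) \<oplus>\<^bsub>A\<^esub> ?c t = \<zero>\<^bsub>A\<^esub>"
      using t unfolding A_def
      by (simp add: amalgam_add aterms.intros) (simp add: amalgam_def aclass_eq_iff aterms.intros aeq.add_neg)
    moreover have "amalgam_inl R S1 S2 f g (\<ominus>\<^bsub>S1\<^esub> \<one>\<^bsub>S1\<^esub>) = \<ominus>\<^bsub>A\<^esub> \<one>\<^bsub>A\<^esub>"
      using ring_hom_add[OF i, of "\<ominus>\<^bsub>S1\<^esub> \<one>\<^bsub>S1\<^esub>" "\<one>\<^bsub>S1\<^esub>"] ring_hom_one[OF i] ring_hom_closed[OF i]
        ring_hom_zero[OF i S1.ring_axioms A.ring_axioms]
      by (intro A.minus_equality[symmetric]) (simp_all add: S1.l_neg)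
    ultimately show ?thesis
      using A.minus_equality[of "?c (ANeg t)" "?c t"] cl[OF t] cl[OF aterms.intros(6)[OF t]]
      by (simp add: A.l_minus)
  qed
  have "Z (?c t)" if "t \<in> aterms S1 S2" for t
    using that
  proof induction
    case (5 t u)
    then show ?case using add[OF cl cl, of t u] unfolding A_def by (simp add: amalgam_add)
  next
    case (7 t u)
    then show ?case using mult[OF cl cl, of t u] unfolding A_def by (simp add: amalgam_mult)
  next
    case (6 t)
    then show ?case using mult inl[of "\<ominus>\<^bsub>S1\<^esub> \<one>\<^bsub>S1\<^esub>"] ring_hom_closed[OF i, of "\<ominus>\<^bsub>S1\<^esub> \<one>\<^bsub>S1\<^esub>"]
      by (simp add: neg car)
  qed (use inl inr in \<open>simp_all add: zero one amalgam_inl_def[symmetric] amalgam_inr_def[symmetric]\<close>)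
  then show ?thesis using assms(2) by (auto simp: car)
qed

text \<open>
  The two variables are indexed by \<open>bool\<close>, with \<open>True\<close> for \<open>x\<close>, so that what holds for both is proved once.
\<close>

locale ore_pair = ring R for R (structure) +
  fixes \<tau> \<delta> :: "bool \<Rightarrow> 'a \<Rightarrow> 'a"
  assumes tau_hom: "\<tau> b \<in> ring_hom R R"
    and der: "left_derivation R (\<tau> b) (\<delta> b)"
begin

abbreviation S where "S \<equiv> ore_amalgam R (\<tau> True) (\<delta> True) (\<tau> False) (\<delta> False)"
abbreviation \<iota> where "\<iota> \<equiv> ore_amalgam_emb R (\<tau> True) (\<delta> True) (\<tau> False) (\<delta> False)"
abbreviation Ext where "Ext b \<equiv> ore_ext R (\<tau> b) (\<delta> b)"
abbreviation inl where "inl \<equiv> amalgam_inl R (Ext True) (Ext False) (ore_const R) (ore_const R)"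
abbreviation inr where "inr \<equiv> amalgam_inr R (Ext True) (Ext False) (ore_const R) (ore_const R)"

definition component where "component b = (if b then inl else inr)"

definition gen where "gen b = component b (ore_var R)"

lemma skew: "skew R (\<tau> b) (\<delta> b)"
  using tau_hom der by (intro skew.intro UP_ring.intro ring_axioms skew_axioms.intro) auto

sublocale S: ring S unfolding ore_amalgam_def by (rule amalgam_ring)

lemma component_hom: "component b \<in> ring_hom (Ext b) S"
  by (auto simp: component_def ore_amalgam_def amalgam_inl_hom amalgam_inr_hom)

lemma const_closed: "r \<in> carrier R \<Longrightarrow> ore_const R r \<in> carrier (Ext b)"
  using ring_hom_closed[OF skew.ore_const_hom[OF skew]] .

lemma component_const: "r \<in> carrier R \<Longrightarrow> component b (ore_const R r) = \<iota> r"
  using amalgam_commutes[of "ore_const R" r "Ext True" R "Ext False" "ore_const R"] const_closed[of r True]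
  by (auto simp: component_def ore_amalgam_emb_def)

lemma emb_hom: "\<iota> \<in> ring_hom R S"
proof -
  have "component True \<circ> ore_const R \<in> ring_hom R S"
    using skew.ore_const_hom[OF skew] component_hom by (rule ring_hom_trans)
  moreover have "\<iota> = component True \<circ> ore_const R" by (simp add: fun_eq_iff component_def ore_amalgam_emb_def)
  ultimately show ?thesis by simp
qed

lemma emb_closed: "r \<in> carrier R \<Longrightarrow> \<iota> r \<in> carrier S"
  by (rule ring_hom_closed[OF emb_hom])

lemma emb_zero: "\<iota> \<zero> = \<zero>\<^bsub>S\<^esub>"
  using ring_hom_zero[OF emb_hom ring_axioms S.ring_axioms] .

lemma var_closed: "ore_var R \<in> carrier (Ext b)"
proof -
  interpret skew R "UP R" "\<tau> b" "\<delta> b" by (rule skew)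
  show ?thesis by (simp add: E_simps ore_var_def)
qed

lemma gen_closed: "gen b \<in> carrier S"
  unfolding gen_def by (rule ring_hom_closed[OF component_hom var_closed])

lemma tau_closed: "r \<in> carrier R \<Longrightarrow> \<tau> b r \<in> carrier R"
  by (rule ring_hom_closed[OF tau_hom])

lemma delta_closed: "r \<in> carrier R \<Longrightarrow> \<delta> b r \<in> carrier R"
  using der[of b] by (auto simp: left_derivation_def)

lemma gen_comm:
  assumes "r \<in> carrier R"
  shows "gen b \<otimes>\<^bsub>S\<^esub> \<iota> r = \<iota> (\<tau> b r) \<otimes>\<^bsub>S\<^esub> gen b \<oplus>\<^bsub>S\<^esub> \<iota> (\<delta> b r)"
proof -
  interpret E: ring "Ext b" by (rule skew.ore_ext_ring[OF skew])
  note hom = ring_hom_mult[OF component_hom, of _ b] ring_hom_add[OF component_hom, of _ b]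
  have "gen b \<otimes>\<^bsub>S\<^esub> \<iota> r = component b (ore_var R \<otimes>\<^bsub>Ext b\<^esub> ore_const R r)"
    using assms by (simp add: gen_def hom var_closed const_closed component_const)
  also have "\<dots> = component b (ore_const R (\<tau> b r) \<otimes>\<^bsub>Ext b\<^esub> ore_var R \<oplus>\<^bsub>Ext b\<^esub> ore_const R (\<delta> b r))"
    using skew.ore_var_mult[OF skew assms] by simp
  also have "\<dots> = \<iota> (\<tau> b r) \<otimes>\<^bsub>S\<^esub> gen b \<oplus>\<^bsub>S\<^esub> \<iota> (\<delta> b r)"
    using assms by (simp add: gen_def hom var_closed const_closed component_const tau_closed delta_closed)
  finally show ?thesis .
qed

lemma amalgam_of_ore_induct [consumes 1, case_names emb gen add mult]:
  assumes "s \<in> carrier S"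
    and emb: "\<And>r. r \<in> carrier R \<Longrightarrow> Z (\<iota> r)"
    and gen: "\<And>b. Z (gen b)"
    and add: "\<And>s t. \<lbrakk>s \<in> carrier S; t \<in> carrier S; Z s; Z t\<rbrakk> \<Longrightarrow> Z (s \<oplus>\<^bsub>S\<^esub> t)"
    and mult: "\<And>s t. \<lbrakk>s \<in> carrier S; t \<in> carrier S; Z s; Z t\<rbrakk> \<Longrightarrow> Z (s \<otimes>\<^bsub>S\<^esub> t)"
  shows "Z s"
proof -
  have *: "Z (component b p)" if "p \<in> carrier (Ext b)" for b p
    using that
  proof (induction rule: skew.ore_ext_induct[OF skew, consumes 1, case_names const var add mult])
    case (const r)
    then show ?case using emb component_const by simp
  next
    case var
    show ?case using gen by (simp add: gen_def)
  next
    case (add p q)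
    then show ?case using assms(4) by (simp add: ring_hom_add[OF component_hom] ring_hom_closed[OF component_hom])
  next
    case (mult p q)
    then show ?case using assms(5) by (simp add: ring_hom_mult[OF component_hom] ring_hom_closed[OF component_hom])
  qed
  from assms(1) show ?thesis
    unfolding ore_amalgam_def
  proof (induction rule: amalgam_induct)
    case ring
    show ?case by (rule skew.ore_ext_ring[OF skew])
  next
    case (inl a)
    then show ?case using *[of a True] by (simp add: component_def)
  next
    case (inr a)
    then show ?case using *[of a False] by (simp add: component_def)
  next
    case (add s t)
    then show ?case using assms(4) by (simp add: ore_amalgam_def)
  next
    case (mult s t)
    then show ?case using assms(5) by (simp add: ore_amalgam_def)
  qed
qed

text \<open>
  The universal properties of both Ore extensions and of the pushout combined: a homomorphism from the
  amalgamated product is a homomorphism on \<open>R\<close> together with images of \<open>x\<close> and \<open>y\<close> that obey the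
  commutation rules.
\<close>

lemma amalgam_of_ore_universal:
  assumes A: "ring A" and h: "h \<in> ring_hom R A" and a: "\<And>b. a b \<in> carrier A"
    and comm: "\<And>b r. r \<in> carrier R \<Longrightarrow> a b \<otimes>\<^bsub>A\<^esub> h r = h (\<tau> b r) \<otimes>\<^bsub>A\<^esub> a b \<oplus>\<^bsub>A\<^esub> h (\<delta> b r)"
  obtains H where "H \<in> ring_hom S A" "\<And>r. r \<in> carrier R \<Longrightarrow> H (\<iota> r) = h r"
    "\<And>b. H (gen b) = a b"
proof -
  have "\<exists>H. H \<in> ring_hom (Ext b) A \<and> (\<forall>r\<in>carrier R. H (ore_const R r) = h r) \<and> H (ore_var R) = a b" for b
    using skew.ore_ext_universal[OF skew[of b] A h a[of b] comm[of _ b]] by metis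
  then obtain H where H: "\<And>b. H b \<in> ring_hom (Ext b) A"
      "\<And>b r. r \<in> carrier R \<Longrightarrow> H b (ore_const R r) = h r" "\<And>b. H b (ore_var R) = a b"
    by metis
  obtain K where K: "K \<in> ring_hom S A" "\<And>p. p \<in> carrier (Ext True) \<Longrightarrow> K (inl p) = H True p"
      "\<And>p. p \<in> carrier (Ext False) \<Longrightarrow> K (inr p) = H False p"
    using amalgam_universal[OF A H(1)[of True] H(1)[of False], of R "ore_const R" "ore_const R"] H(2)
    unfolding ore_amalgam_def by (metis (no_types, lifting))
  have KH: "K (component b p) = H b p" if "p \<in> carrier (Ext b)" for b p
    using K(2,3)[of p] that by (cases b) (auto simp: component_def)
  show thesis
  proof (rule that[OF K(1)])
    show "K (gen b) = a b" for b using KH[OF var_closed] H(3) by (simp add: gen_def)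
    show "K (\<iota> r) = h r" if "r \<in> carrier R" for r
      using KH[OF const_closed[OF that], of True] that H(2) by (simp add: component_const)
  qed
qed

end


section \<open>The free module on words\<close>

text \<open>
  The ring through which rings act on an abelian group.  The maps are \<open>extensional\<close> to make equality of
  endomorphisms equality of functions.
\<close>

definition additive_endos :: "('a, 'm) ring_scheme \<Rightarrow> ('a \<Rightarrow> 'a) ring" where
  "additive_endos M =
     \<lparr> carrier = {f \<in> extensional (carrier M) \<inter> (carrier M \<rightarrow> carrier M).
         \<forall>m\<in>carrier M. \<forall>n\<in>carrier M. f (m \<oplus>\<^bsub>M\<^esub> n) = f m \<oplus>\<^bsub>M\<^esub> f n},
       mult = (\<lambda>f g. \<lambda>m\<in>carrier M. f (g m)),
       one = (\<lambda>m\<in>carrier M. m),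
       zero = (\<lambda>m\<in>carrier M. \<zero>\<^bsub>M\<^esub>),
       add = (\<lambda>f g. \<lambda>m\<in>carrier M. f m \<oplus>\<^bsub>M\<^esub> g m) \<rparr>"

lemma (in abelian_group) additive_endos_ring: "ring (additive_endos G)"
proof -
  let ?E = "additive_endos G"
  note E = additive_endos_def
  have eqI: "f = g" if "f \<in> extensional (carrier G)" "g \<in> extensional (carrier G)"
    "\<And>m. m \<in> carrier G \<Longrightarrow> f m = g m" for f g :: "'a \<Rightarrow> 'a"
    using that by (rule extensionalityI)
  show ?thesis
  proof (rule ringI)
    show "abelian_group ?E"
    proof (rule abelian_groupI)
      fix f assume f: "f \<in> carrier ?E"
      then show "\<exists>g\<in>carrier ?E. g \<oplus>\<^bsub>?E\<^esub> f = \<zero>\<^bsub>?E\<^esub>"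
        by (intro bexI[of _ "\<lambda>m\<in>carrier G. \<ominus> f m"])
           (auto simp: E Pi_def l_neg minus_add intro!: eqI)
    qed (auto simp: E Pi_def a_assoc intro!: eqI intro: a_comm, auto simp: a_ac)
    show "Group.monoid ?E"
      by (rule monoidI) (auto simp: E Pi_def intro!: eqI)
  qed (auto simp: E Pi_def intro!: eqI)
qed

text \<open>
  The free left \<open>R\<close>-module on words in two letters, as finitely supported coefficient functions.  Only
  its additive group is used as a structure, so the multiplication of the record is left unspecified.
  The letter \<open>True\<close> stands for \<open>x\<close> and \<open>False\<close> for \<open>y\<close>.
\<close>

definition words :: "('a, 'm) ring_scheme \<Rightarrow> (bool list \<Rightarrow> 'a) ring" where
  "words R =
     \<lparr> carrier = {m \<in> UNIV \<rightarrow> carrier R. finite {w. m w \<noteq> \<zero>\<^bsub>R\<^esub>}},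
       mult = undefined, one = undefined,
       zero = (\<lambda>w. \<zero>\<^bsub>R\<^esub>),
       add = (\<lambda>m n w. m w \<oplus>\<^bsub>R\<^esub> n w) \<rparr>"

definition word_single :: "('a, 'm) ring_scheme \<Rightarrow> 'a \<Rightarrow> bool list \<Rightarrow> (bool list \<Rightarrow> 'a)" where
  "word_single R r w = (\<lambda>v. if v = w then r else \<zero>\<^bsub>R\<^esub>)"

definition word_smult :: "('a, 'm) ring_scheme \<Rightarrow> 'a \<Rightarrow> (bool list \<Rightarrow> 'a) \<Rightarrow> (bool list \<Rightarrow> 'a)" where
  "word_smult R r m = (\<lambda>w. r \<otimes>\<^bsub>R\<^esub> m w)"

text \<open>
  The action of a letter \<open>b\<close>, determined by \<open>b (r w) = \<tau>(r) b w + \<delta>(r) w\<close> (\<open>word_shift_single\<close>), read off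
  on coefficients.
\<close>

definition word_shift ::
    "('a, 'm) ring_scheme \<Rightarrow> ('a \<Rightarrow> 'a) \<Rightarrow> ('a \<Rightarrow> 'a) \<Rightarrow> bool \<Rightarrow> (bool list \<Rightarrow> 'a) \<Rightarrow> (bool list \<Rightarrow> 'a)" where
  "word_shift R \<tau> \<delta> b m =
     (\<lambda>w. (case w of [] \<Rightarrow> \<zero>\<^bsub>R\<^esub> | c # v \<Rightarrow> if c = b then \<tau> (m v) else \<zero>\<^bsub>R\<^esub>) \<oplus>\<^bsub>R\<^esub> \<delta> (m w))"

context ring
begin

abbreviation M where "M \<equiv> words R"

lemma words_nth: "m \<in> carrier M \<Longrightarrow> m w \<in> carrier R"
  by (auto simp: words_def)

lemma words_add_nth: "(m \<oplus>\<^bsub>M\<^esub> n) w = m w \<oplus> n w"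
  by (simp add: words_def)

lemma words_memI:
  assumes "\<And>w. m w \<in> carrier R" "finite A" "\<And>w. w \<notin> A \<Longrightarrow> m w = \<zero>"
  shows "m \<in> carrier M"
proof -
  have "{w. m w \<noteq> \<zero>} \<subseteq> A" using assms(3) by blast
  then show ?thesis using assms(1,2) finite_subset by (auto simp: words_def)
qed

lemma words_finite: "m \<in> carrier M \<Longrightarrow> finite {w. m w \<noteq> \<zero>}"
  by (simp add: words_def)

lemma words_abelian_group: "abelian_group M"
proof (rule abelian_groupI)
  fix m n assume m: "m \<in> carrier M" and n: "n \<in> carrier M"
  show "m \<oplus>\<^bsub>M\<^esub> n \<in> carrier M"
    by (rule words_memI[of _ "{w. m w \<noteq> \<zero>} \<union> {w. n w \<noteq> \<zero>}"])
       (use m n in \<open>auto simp: words_add_nth words_nth words_finite\<close>)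
  show "m \<oplus>\<^bsub>M\<^esub> n = n \<oplus>\<^bsub>M\<^esub> m"
    using m n by (auto simp: words_add_nth words_nth intro!: ext a_comm)
next
  fix m assume m: "m \<in> carrier M"
  have "(\<lambda>w. \<ominus> m w) \<in> carrier M"
    by (rule words_memI[of _ "{w. m w \<noteq> \<zero>}"]) (use m in \<open>auto simp: words_nth words_finite\<close>)
  then show "\<exists>n\<in>carrier M. n \<oplus>\<^bsub>M\<^esub> m = \<zero>\<^bsub>M\<^esub>"
    using m by (intro bexI[of _ "\<lambda>w. \<ominus> m w"] ext) (auto simp: words_add_nth words_nth l_neg, simp add: words_def)
  show "\<zero>\<^bsub>M\<^esub> \<oplus>\<^bsub>M\<^esub> m = m" using m words_nth[OF m] by (auto simp: words_def)
qed (auto simp: words_add_nth words_nth a_assoc, simp add: words_def)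

sublocale M: abelian_group M by (rule words_abelian_group)

lemma word_single_closed: "r \<in> carrier R \<Longrightarrow> word_single R r w \<in> carrier M"
  by (rule words_memI[of _ "{w}"]) (auto simp: word_single_def)

lemma words_induct [consumes 1, case_names zero single add]:
  assumes "m \<in> carrier M"
    and zero: "Z \<zero>\<^bsub>M\<^esub>"
    and single: "\<And>r w. r \<in> carrier R \<Longrightarrow> Z (word_single R r w)"
    and add: "\<And>m n. \<lbrakk>m \<in> carrier M; n \<in> carrier M; Z m; Z n\<rbrakk> \<Longrightarrow> Z (m \<oplus>\<^bsub>M\<^esub> n)"
  shows "Z m"
proof -
  have "Z m" if "finite A" "m \<in> carrier M" "{w. m w \<noteq> \<zero>} \<subseteq> A" for A m
    using that
  proof (induction A arbitrary: m rule: finite_induct)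
    case empty
    then have "m = \<zero>\<^bsub>M\<^esub>" by (auto simp: words_def)
    then show ?case using zero by simp
  next
    case (insert w A)
    have upd: "m(w := \<zero>) \<in> carrier M"
      by (rule words_memI[of _ "insert w A"]) (use insert.prems insert.hyps in \<open>auto simp: words_nth\<close>)
    moreover have "Z (m(w := \<zero>))" using insert.prems by (intro insert.IH[OF upd]) auto
    moreover have "m = word_single R (m w) w \<oplus>\<^bsub>M\<^esub> m(w := \<zero>)"
      using insert.prems(1) by (auto simp: words_add_nth word_single_def words_nth)
    ultimately show ?case
      using add[of "word_single R (m w) w" "m(w := \<zero>)"] single[of "m w" w] insert.prems(1)
      by (metis word_single_closed words_nth)
  qed
  then show ?thesis using words_finite assms(1) by blast
qed

lemma word_smult_nth: "word_smult R r m w = r \<otimes> m w"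
  by (simp add: word_smult_def)

lemma word_smult_closed:
  assumes "r \<in> carrier R" "m \<in> carrier M"
  shows "word_smult R r m \<in> carrier M"
  by (rule words_memI[of _ "{w. m w \<noteq> \<zero>}"])
     (use assms in \<open>auto simp: word_smult_def words_nth words_finite\<close>)

lemma word_smult_add:
  assumes "r \<in> carrier R" "m \<in> carrier M" "n \<in> carrier M"
  shows "word_smult R r (m \<oplus>\<^bsub>M\<^esub> n) = word_smult R r m \<oplus>\<^bsub>M\<^esub> word_smult R r n"
  using assms by (auto simp: word_smult_def words_add_nth words_nth r_distr)

lemma word_smult_single:
  "\<lbrakk>r \<in> carrier R; s \<in> carrier R\<rbrakk> \<Longrightarrow> word_smult R r (word_single R s w) = word_single R (r \<otimes> s) w"
  by (auto simp: word_smult_def word_single_def)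

end

context skew
begin

lemma word_shift_nth:
  assumes "m \<in> carrier R.M"
  shows "word_shift R \<tau> \<delta> b m [] = \<delta> (m [])"
    "word_shift R \<tau> \<delta> b m (c # v) = (if c = b then \<tau> (m v) \<oplus> \<delta> (m (c # v)) else \<delta> (m (c # v)))"
  using assms by (simp_all add: word_shift_def td R.words_nth)

lemma word_shift_closed:
  assumes m: "m \<in> carrier R.M"
  shows "word_shift R \<tau> \<delta> b m \<in> carrier R.M"
proof (rule R.words_memI[of _ "{w. m w \<noteq> \<zero>} \<union> Cons b ` {w. m w \<noteq> \<zero>}"])
  fix w
  show "word_shift R \<tau> \<delta> b m w \<in> carrier R"
    using m by (cases w) (auto simp: word_shift_nth td R.words_nth)
  assume "w \<notin> {w. m w \<noteq> \<zero>} \<union> Cons b ` {w. m w \<noteq> \<zero>}"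
  then show "word_shift R \<tau> \<delta> b m w = \<zero>"
    using m by (cases w) (auto simp: word_shift_nth td R.words_nth)
qed (use m in \<open>auto simp: R.words_finite\<close>)

lemma word_shift_add:
  assumes "m \<in> carrier R.M" "n \<in> carrier R.M"
  shows "word_shift R \<tau> \<delta> b (m \<oplus>\<^bsub>R.M\<^esub> n) = word_shift R \<tau> \<delta> b m \<oplus>\<^bsub>R.M\<^esub> word_shift R \<tau> \<delta> b n"
proof
  fix w
  show "word_shift R \<tau> \<delta> b (m \<oplus>\<^bsub>R.M\<^esub> n) w = (word_shift R \<tau> \<delta> b m \<oplus>\<^bsub>R.M\<^esub> word_shift R \<tau> \<delta> b n) w"
    using assms by (cases w) (simp_all add: word_shift_nth R.words_add_nth td R.words_nth R.a_ac)
qed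

text \<open>
  This is the commutation rule \<open>b r = \<tau>(r) b + \<delta>(r)\<close> for the action on words.
\<close>

lemma word_shift_smult:
  assumes "r \<in> carrier R" "m \<in> carrier R.M"
  shows "word_shift R \<tau> \<delta> b (word_smult R r m) =
    word_smult R (\<tau> r) (word_shift R \<tau> \<delta> b m) \<oplus>\<^bsub>R.M\<^esub> word_smult R (\<delta> r) m"
proof
  fix w
  note wn = word_shift_nth[OF assms(2)] word_shift_nth[OF R.word_smult_closed[OF assms]]
  show "word_shift R \<tau> \<delta> b (word_smult R r m) w =
    (word_smult R (\<tau> r) (word_shift R \<tau> \<delta> b m) \<oplus>\<^bsub>R.M\<^esub> word_smult R (\<delta> r) m) w"
    using assms
    by (cases w) (simp_all add: wn R.words_add_nth td R.words_nth R.r_distr R.a_assoc R.word_smult_nth)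
qed

lemma word_shift_single:
  assumes "r \<in> carrier R"
  shows "word_shift R \<tau> \<delta> b (word_single R r w) =
    word_single R (\<tau> r) (b # w) \<oplus>\<^bsub>R.M\<^esub> word_single R (\<delta> r) w"
proof
  fix v
  show "word_shift R \<tau> \<delta> b (word_single R r w) v =
    (word_single R (\<tau> r) (b # w) \<oplus>\<^bsub>R.M\<^esub> word_single R (\<delta> r) w) v"
    using assms R.word_single_closed[OF assms]
    by (cases v) (auto simp: word_shift_nth R.words_add_nth td word_single_def)
qed

end


section \<open>Words as a basis of the amalgamated product\<close>

context ore_pair
begin

lemma word_action:
  obtains \<Phi> where "\<Phi> \<in> ring_hom S (additive_endos M)"
    "\<And>r m. \<lbrakk>r \<in> carrier R; m \<in> carrier M\<rbrakk> \<Longrightarrow> \<Phi> (\<iota> r) m = word_smult R r m"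
    "\<And>b m. m \<in> carrier M \<Longrightarrow> \<Phi> (gen b) m = word_shift R (\<tau> b) (\<delta> b) b m"
proof -
  let ?A = "additive_endos M"
  let ?h = "\<lambda>r. restrict (word_smult R r) (carrier M)"
  let ?a = "\<lambda>b. restrict (word_shift R (\<tau> b) (\<delta> b) b) (carrier M)"
  note sc = skew.word_shift_closed[OF skew] and sa = skew.word_shift_add[OF skew]
  have A: "ring ?A" by (rule M.additive_endos_ring)
  have eqI: "f = g" if "f \<in> extensional (carrier M)" "g \<in> extensional (carrier M)"
    "\<And>m. m \<in> carrier M \<Longrightarrow> f m = g m" for f g :: "(bool list \<Rightarrow> 'a) \<Rightarrow> bool list \<Rightarrow> 'a"
    using that by (rule extensionalityI)
  have a: "?a b \<in> carrier ?A" for b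
    by (auto simp: additive_endos_def sc sa)
  have h: "?h \<in> ring_hom R ?A"
    by (rule ring_hom_memI)
       (auto simp: additive_endos_def word_smult_closed word_smult_add words_nth m_assoc l_distr
         word_smult_nth words_add_nth intro!: eqI ext)
  have comm: "?a b \<otimes>\<^bsub>?A\<^esub> ?h r = ?h (\<tau> b r) \<otimes>\<^bsub>?A\<^esub> ?a b \<oplus>\<^bsub>?A\<^esub> ?h (\<delta> b r)" if r: "r \<in> carrier R" for b r
    using r by (intro eqI) (simp_all add: additive_endos_def word_smult_closed sc skew.word_shift_smult[OF skew])
  obtain H where H: "H \<in> ring_hom S ?A" "\<And>r. r \<in> carrier R \<Longrightarrow> H (\<iota> r) = ?h r" "\<And>b. H (gen b) = ?a b"
    using amalgam_of_ore_universal[OF A h a comm] by metis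
  show thesis by (rule that[OF H(1)]) (simp_all add: H(2,3))
qed

text \<open>
  By \<open>amalgam_of_ore_induct\<close> the conditions determine the action, so the choice is immaterial.
\<close>

definition action where
  "action = (SOME \<Phi>. \<Phi> \<in> ring_hom S (additive_endos M) \<and>
    (\<forall>r\<in>carrier R. \<forall>m\<in>carrier M. \<Phi> (\<iota> r) m = word_smult R r m) \<and>
    (\<forall>b. \<forall>m\<in>carrier M. \<Phi> (gen b) m = word_shift R (\<tau> b) (\<delta> b) b m))"

lemma action:
  "action \<in> ring_hom S (additive_endos M)"
  "\<lbrakk>r \<in> carrier R; m \<in> carrier M\<rbrakk> \<Longrightarrow> action (\<iota> r) m = word_smult R r m"
  "m \<in> carrier M \<Longrightarrow> action (gen b) m = word_shift R (\<tau> b) (\<delta> b) b m"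
proof -
  have "\<exists>\<Phi>. \<Phi> \<in> ring_hom S (additive_endos M) \<and>
    (\<forall>r\<in>carrier R. \<forall>m\<in>carrier M. \<Phi> (\<iota> r) m = word_smult R r m) \<and>
    (\<forall>b. \<forall>m\<in>carrier M. \<Phi> (gen b) m = word_shift R (\<tau> b) (\<delta> b) b m)"
    using word_action by metis
  from someI_ex[OF this] show
    "action \<in> ring_hom S (additive_endos M)"
    "\<lbrakk>r \<in> carrier R; m \<in> carrier M\<rbrakk> \<Longrightarrow> action (\<iota> r) m = word_smult R r m"
    "m \<in> carrier M \<Longrightarrow> action (gen b) m = word_shift R (\<tau> b) (\<delta> b) b m"
    by (auto simp: action_def)
qed

lemma action_closed: "\<lbrakk>s \<in> carrier S; m \<in> carrier M\<rbrakk> \<Longrightarrow> action s m \<in> carrier M"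
  using ring_hom_closed[OF action(1), of s] by (auto simp: additive_endos_def)

lemma action_add: "\<lbrakk>s \<in> carrier S; t \<in> carrier S; m \<in> carrier M\<rbrakk> \<Longrightarrow>
    action (s \<oplus>\<^bsub>S\<^esub> t) m = action s m \<oplus>\<^bsub>M\<^esub> action t m"
  using ring_hom_add[OF action(1), of s t] by (simp add: additive_endos_def)

lemma action_mult: "\<lbrakk>s \<in> carrier S; t \<in> carrier S; m \<in> carrier M\<rbrakk> \<Longrightarrow>
    action (s \<otimes>\<^bsub>S\<^esub> t) m = action s (action t m)"
  using ring_hom_mult[OF action(1), of s t] by (simp add: additive_endos_def)

definition word :: "bool list \<Rightarrow> _" where
  "word w = foldr (\<lambda>b s. gen b \<otimes>\<^bsub>S\<^esub> s) w \<one>\<^bsub>S\<^esub>"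

definition word_sum where
  "word_sum m = (\<Oplus>\<^bsub>S\<^esub> w\<in>{w. m w \<noteq> \<zero>}. \<iota> (m w) \<otimes>\<^bsub>S\<^esub> word w)"

lemma word_closed: "word w \<in> carrier S"
  by (induction w) (auto simp: word_def gen_closed)

lemma word_sum_superset:
  assumes "m \<in> carrier M" "finite A" "{w. m w \<noteq> \<zero>} \<subseteq> A"
  shows "word_sum m = (\<Oplus>\<^bsub>S\<^esub> w\<in>A. \<iota> (m w) \<otimes>\<^bsub>S\<^esub> word w)"
  unfolding word_sum_def using assms
  by (intro S.add.finprod_mono_neutral_cong_left)
     (auto simp: emb_closed words_nth word_closed emb_zero)

lemma word_sum_closed: "m \<in> carrier M \<Longrightarrow> word_sum m \<in> carrier S"
  unfolding word_sum_def by (intro S.finsum_closed) (auto simp: emb_closed words_nth word_closed)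

lemma word_sum_add:
  assumes "m \<in> carrier M" "n \<in> carrier M"
  shows "word_sum (m \<oplus>\<^bsub>M\<^esub> n) = word_sum m \<oplus>\<^bsub>S\<^esub> word_sum n"
proof -
  let ?A = "{w. m w \<noteq> \<zero>} \<union> {w. n w \<noteq> \<zero>}"
  have "word_sum (m \<oplus>\<^bsub>M\<^esub> n) = (\<Oplus>\<^bsub>S\<^esub> w\<in>?A. \<iota> ((m \<oplus>\<^bsub>M\<^esub> n) w) \<otimes>\<^bsub>S\<^esub> word w)"
    using assms by (intro word_sum_superset) (auto simp: words_finite words_add_nth)
  also have "\<dots> = (\<Oplus>\<^bsub>S\<^esub> w\<in>?A. \<iota> (m w) \<otimes>\<^bsub>S\<^esub> word w \<oplus>\<^bsub>S\<^esub> \<iota> (n w) \<otimes>\<^bsub>S\<^esub> word w)"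
    using assms by (intro S.finsum_cong)
      (auto simp: words_add_nth words_nth ring_hom_add[OF emb_hom] S.l_distr emb_closed word_closed)
  also have "\<dots> = word_sum m \<oplus>\<^bsub>S\<^esub> word_sum n"
    using assms by (subst S.finsum_addf)
      (auto simp: words_nth emb_closed word_closed words_finite word_sum_superset[of _ ?A])
  finally show ?thesis .
qed

lemma word_sum_single:
  assumes "r \<in> carrier R"
  shows "word_sum (word_single R r w) = \<iota> r \<otimes>\<^bsub>S\<^esub> word w"
proof -
  have "{v. word_single R r w v \<noteq> \<zero>} \<subseteq> {w}" by (auto simp: word_single_def)
  then show ?thesis
    using assms word_sum_superset[OF word_single_closed[OF assms], of "{w}" w]
    by (simp add: word_single_def emb_closed word_closed)
qed

lemma word_sum_zero: "word_sum \<zero>\<^bsub>M\<^esub> = \<zero>\<^bsub>S\<^esub>"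
  by (simp add: word_sum_def words_def)

lemma word_sum_smult:
  assumes "r \<in> carrier R" "m \<in> carrier M"
  shows "word_sum (word_smult R r m) = \<iota> r \<otimes>\<^bsub>S\<^esub> word_sum m"
  using assms(2)
proof (induction rule: words_induct)
  case zero
  have "word_smult R r \<zero>\<^bsub>M\<^esub> = \<zero>\<^bsub>M\<^esub>" using assms by (simp add: word_smult_def words_def)
  then show ?case using assms by (simp add: word_sum_zero emb_closed)
next
  case (single s w)
  then show ?case using assms
    by (simp add: word_smult_single word_sum_single ring_hom_mult[OF emb_hom] S.m_assoc emb_closed word_closed)
next
  case (add m n)
  then show ?case using assms
    by (simp add: word_smult_add word_sum_add word_smult_closed S.r_distr emb_closed word_sum_closed)
qed

lemma word_sum_shift:
  assumes "m \<in> carrier M"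
  shows "word_sum (word_shift R (\<tau> b) (\<delta> b) b m) = gen b \<otimes>\<^bsub>S\<^esub> word_sum m"
  using assms
proof (induction rule: words_induct)
  case zero
  interpret B: skew R "UP R" "\<tau> b" "\<delta> b" by (rule skew)
  have "word_shift R (\<tau> b) (\<delta> b) b \<zero>\<^bsub>M\<^esub> = \<zero>\<^bsub>M\<^esub>"
    by (auto simp: word_shift_def words_def B.td fun_eq_iff split: list.split)
  then show ?case by (simp add: word_sum_zero gen_closed)
next
  case (single r w)
  have "gen b \<otimes>\<^bsub>S\<^esub> (\<iota> r \<otimes>\<^bsub>S\<^esub> word w) = (gen b \<otimes>\<^bsub>S\<^esub> \<iota> r) \<otimes>\<^bsub>S\<^esub> word w"
    using single by (simp add: S.m_assoc gen_closed emb_closed word_closed)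
  also have "\<dots> = \<iota> (\<tau> b r) \<otimes>\<^bsub>S\<^esub> word (b # w) \<oplus>\<^bsub>S\<^esub> \<iota> (\<delta> b r) \<otimes>\<^bsub>S\<^esub> word w"
    using single by (simp add: gen_comm word_def[of "b # w"] word_def[symmetric, of w] S.l_distr S.m_assoc
        gen_closed emb_closed word_closed tau_closed delta_closed)
  finally show ?case
    using single by (simp add: skew.word_shift_single[OF skew] word_sum_add word_sum_single
        word_single_closed tau_closed delta_closed)
next
  case (add m n)
  then show ?case
    by (simp add: skew.word_shift_add[OF skew] skew.word_shift_closed[OF skew] word_sum_add S.r_distr
        gen_closed word_sum_closed)
qed

text \<open>
  Summing up words turns the action of \<open>S\<close> on the word module into left multiplication.  It is enough to
  see this for the generators, where it is \<open>word_sum_smult\<close> and \<open>word_sum_shift\<close>.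
\<close>

lemma word_sum_action:
  assumes "s \<in> carrier S" "m \<in> carrier M"
  shows "word_sum (action s m) = s \<otimes>\<^bsub>S\<^esub> word_sum m"
  using assms
proof (induction s arbitrary: m rule: amalgam_of_ore_induct)
  case (emb r)
  then show ?case by (simp add: action word_sum_smult)
next
  case (gen b)
  then show ?case by (simp add: action word_sum_shift)
next
  case (add s t)
  then show ?case by (simp add: action_add action_closed word_sum_add S.l_distr word_sum_closed)
next
  case (mult s t)
  then show ?case by (simp add: action_mult action_closed S.m_assoc word_sum_closed)
qed

text \<open>
  The coefficients of \<open>s\<close> with respect to the words: \<open>s\<close> applied to the empty word, which represents
  \<open>1\<close>.
\<close>

definition coords where "coords s = action s (word_single R \<one> [])"

lemma word_sum_coords:
  assumes "s \<in> carrier S"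
  shows "word_sum (coords s) = s"
  using assms word_sum_action[OF assms word_single_closed[OF one_closed, of "[]"]]
  by (simp add: coords_def word_sum_single word_def ring_hom_one[OF emb_hom])

lemma coords_inj: "inj_on coords (carrier S)"
  by (rule inj_on_inverseI[of _ word_sum]) (rule word_sum_coords)

text \<open>
  The coordinates of \<open>r s\<close> are those of \<open>s\<close> multiplied by \<open>r\<close>, so \<open>r\<close> cancels in \<open>S\<close> because it cancels
  in \<open>R\<close>.
\<close>

lemma emb_mult_eq_zero:
  assumes "r \<in> carrier R" "s \<in> carrier S" "\<iota> r \<otimes>\<^bsub>S\<^esub> s = \<zero>\<^bsub>S\<^esub>"
    and reg: "\<And>a. \<lbrakk>a \<in> carrier R; r \<otimes> a = \<zero>\<rbrakk> \<Longrightarrow> a = \<zero>"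
  shows "s = \<zero>\<^bsub>S\<^esub>"
proof -
  have 1: "word_single R \<one> [] \<in> carrier M" by (simp add: word_single_closed)
  have cl: "coords s \<in> carrier M" using 1 assms by (simp add: coords_def action_closed)
  have "action \<zero>\<^bsub>S\<^esub> = \<zero>\<^bsub>additive_endos M\<^esub>"
    by (rule ring_hom_zero[OF action(1) S.ring_axioms M.additive_endos_ring])
  then have "coords \<zero>\<^bsub>S\<^esub> = \<zero>\<^bsub>M\<^esub>" using 1 by (simp add: coords_def additive_endos_def)
  moreover have "coords (\<iota> r \<otimes>\<^bsub>S\<^esub> s) = word_smult R r (coords s)"
    using assms(1,2) 1 by (simp add: coords_def action_mult emb_closed action action_closed)
  ultimately have "word_smult R r (coords s) = \<zero>\<^bsub>M\<^esub>" using assms by simp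
  then have "word_smult R r (coords s) w = \<zero>" for w by (simp add: words_def)
  then have "r \<otimes> coords s w = \<zero>" for w by (simp add: word_smult_nth)
  then have "coords s = \<zero>\<^bsub>M\<^esub>" using reg words_nth[OF cl] by (auto simp: words_def)
  then show ?thesis using word_sum_coords[OF assms(2)] word_sum_zero by simp
qed

end


section \<open>Denominators and change of the base ring\<close>

context ore_pair
begin

text \<open>
  The elements \<open>s\<close> satisfying the Ore condition against all of \<open>X\<close> form a subring, so it is enough to
  treat \<open>R\<close> and the variables.  Reversibility holds since \<open>X\<close> cancels on the left in \<open>S\<close>.
\<close>

lemma right_denominator_set_emb:
  assumes X: "right_denominator_set X R" and \<tau>X: "\<And>b. \<tau> b ` X = X"
    and reg: "\<And>x a. \<lbrakk>x \<in> X; a \<in> carrier R; x \<otimes> a = \<zero>\<rbrakk> \<Longrightarrow> a = \<zero>"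
  shows "right_denominator_set (\<iota> ` X) S"
proof -
  interpret D: right_denom R X using X by unfold_locales
  note em = ring_hom_mult[OF emb_hom, symmetric]
  have Xcl: "\<iota> x \<in> carrier S" if "x \<in> X" for x using D.X_sub[OF that] by (rule emb_closed)
  have ore: "\<forall>x\<in>X. \<exists>s'\<in>carrier S. \<exists>x'\<in>X. s \<otimes>\<^bsub>S\<^esub> \<iota> x' = \<iota> x \<otimes>\<^bsub>S\<^esub> s'" if "s \<in> carrier S" for s
    using that
  proof (induction rule: amalgam_of_ore_induct)
    case (emb r)
    show ?case
    proof
      fix x assume x: "x \<in> X"
      obtain r' x' where r: "r' \<in> carrier R" "x' \<in> X" "r \<otimes> x' = x \<otimes> r'"
        using D.right_ore[OF emb x] by metis
      have "\<iota> r \<otimes>\<^bsub>S\<^esub> \<iota> x' = \<iota> x \<otimes>\<^bsub>S\<^esub> \<iota> r'" using r emb x D.X_sub by (simp add: em)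
      then show "\<exists>s'\<in>carrier S. \<exists>x'\<in>X. \<iota> r \<otimes>\<^bsub>S\<^esub> \<iota> x' = \<iota> x \<otimes>\<^bsub>S\<^esub> s'"
        using r emb_closed by blast
    qed
  next
    case (gen b)
    show ?case
    proof
      fix x assume x: "x \<in> X"
      \<comment> \<open>\<open>b z = x b + \<delta>(z)\<close>, and multiplication by \<open>c\<close> moves also \<open>\<delta>(z)\<close> into \<open>x R\<close>; so the denominator is \<open>z c\<close>\<close>
      obtain z where z: "z \<in> X" "\<tau> b z = x" using \<tau>X[of b] x by (metis imageE)
      note zc = D.X_sub[OF z(1)]
      obtain d c where c: "d \<in> carrier R" "c \<in> X" "\<delta> b z \<otimes> c = x \<otimes> d"
        using D.right_ore[OF delta_closed[OF zc, of b] x] by metis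
      note cl = zc D.X_sub[OF c(2)] D.X_sub[OF x] c(1)
      have "gen b \<otimes>\<^bsub>S\<^esub> \<iota> (z \<otimes> c) = (gen b \<otimes>\<^bsub>S\<^esub> \<iota> z) \<otimes>\<^bsub>S\<^esub> \<iota> c"
        using cl by (simp add: ring_hom_mult[OF emb_hom] S.m_assoc emb_closed gen_closed)
      also have "\<dots> = \<iota> x \<otimes>\<^bsub>S\<^esub> (gen b \<otimes>\<^bsub>S\<^esub> \<iota> c) \<oplus>\<^bsub>S\<^esub> \<iota> (\<delta> b z \<otimes> c)"
        using cl z by (simp add: gen_comm ring_hom_mult[OF emb_hom] S.m_assoc S.l_distr emb_closed
            gen_closed delta_closed)
      also have "\<dots> = \<iota> x \<otimes>\<^bsub>S\<^esub> (gen b \<otimes>\<^bsub>S\<^esub> \<iota> c \<oplus>\<^bsub>S\<^esub> \<iota> d)"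
        using cl c by (simp add: ring_hom_mult[OF emb_hom] S.r_distr emb_closed gen_closed)
      finally show "\<exists>s'\<in>carrier S. \<exists>x'\<in>X. gen b \<otimes>\<^bsub>S\<^esub> \<iota> x' = \<iota> x \<otimes>\<^bsub>S\<^esub> s'"
        using cl c(2) z(1) by (intro bexI[of _ "gen b \<otimes>\<^bsub>S\<^esub> \<iota> c \<oplus>\<^bsub>S\<^esub> \<iota> d"] bexI[of _ "z \<otimes> c"])
          (auto simp: emb_closed gen_closed D.X_mult)
    qed
  next
    case (add s t)
    show ?case
    proof
      fix x assume x: "x \<in> X"
      obtain s' y where s: "s' \<in> carrier S" "y \<in> X" "s \<otimes>\<^bsub>S\<^esub> \<iota> y = \<iota> x \<otimes>\<^bsub>S\<^esub> s'" using add x by blast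
      obtain t' z where t: "t' \<in> carrier S" "z \<in> X" "t \<otimes>\<^bsub>S\<^esub> \<iota> z = \<iota> x \<otimes>\<^bsub>S\<^esub> t'" using add x by blast
      obtain d c where c: "d \<in> carrier R" "c \<in> X" "y \<otimes> c = z \<otimes> d"
        using D.right_ore[OF D.X_sub[OF s(2)] t(2)] by metis
      note cl = add(1,2) s(1) t(1) Xcl[OF x] Xcl[OF s(2)] Xcl[OF t(2)] Xcl[OF c(2)] emb_closed[OF c(1)]
      have y: "\<iota> (y \<otimes> c) = \<iota> y \<otimes>\<^bsub>S\<^esub> \<iota> c" and z: "\<iota> (y \<otimes> c) = \<iota> z \<otimes>\<^bsub>S\<^esub> \<iota> d"
        using s t c D.X_sub by (simp add: em, unfold c(3), simp add: em)
      have "(s \<oplus>\<^bsub>S\<^esub> t) \<otimes>\<^bsub>S\<^esub> \<iota> (y \<otimes> c) = s \<otimes>\<^bsub>S\<^esub> \<iota> (y \<otimes> c) \<oplus>\<^bsub>S\<^esub> t \<otimes>\<^bsub>S\<^esub> \<iota> (y \<otimes> c)"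
        using cl by (simp add: y S.l_distr)
      also have "\<dots> = (s \<otimes>\<^bsub>S\<^esub> \<iota> y) \<otimes>\<^bsub>S\<^esub> \<iota> c \<oplus>\<^bsub>S\<^esub> (t \<otimes>\<^bsub>S\<^esub> \<iota> z) \<otimes>\<^bsub>S\<^esub> \<iota> d"
        using cl by (subst (2) z) (simp add: y S.m_assoc)
      also have "\<dots> = \<iota> x \<otimes>\<^bsub>S\<^esub> (s' \<otimes>\<^bsub>S\<^esub> \<iota> c \<oplus>\<^bsub>S\<^esub> t' \<otimes>\<^bsub>S\<^esub> \<iota> d)"
        using cl by (simp add: s(3) t(3) S.m_assoc S.r_distr)
      finally show "\<exists>s'\<in>carrier S. \<exists>x'\<in>X. (s \<oplus>\<^bsub>S\<^esub> t) \<otimes>\<^bsub>S\<^esub> \<iota> x' = \<iota> x \<otimes>\<^bsub>S\<^esub> s'"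
        using cl s(2) c(2) by (intro bexI[of _ "s' \<otimes>\<^bsub>S\<^esub> \<iota> c \<oplus>\<^bsub>S\<^esub> t' \<otimes>\<^bsub>S\<^esub> \<iota> d"] bexI[of _ "y \<otimes> c"])
          (auto simp: D.X_mult)
    qed
  next
    case (mult s t)
    show ?case
    proof
      fix x assume x: "x \<in> X"
      obtain s' y where s: "s' \<in> carrier S" "y \<in> X" "s \<otimes>\<^bsub>S\<^esub> \<iota> y = \<iota> x \<otimes>\<^bsub>S\<^esub> s'" using mult x by blast
      obtain t' z where t: "t' \<in> carrier S" "z \<in> X" "t \<otimes>\<^bsub>S\<^esub> \<iota> z = \<iota> y \<otimes>\<^bsub>S\<^esub> t'" using mult s by blast
      note cl = mult(1,2) s(1) t(1) Xcl[OF x] Xcl[OF s(2)] Xcl[OF t(2)]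
      have "s \<otimes>\<^bsub>S\<^esub> t \<otimes>\<^bsub>S\<^esub> \<iota> z = (s \<otimes>\<^bsub>S\<^esub> \<iota> y) \<otimes>\<^bsub>S\<^esub> t'"
        using cl by (simp add: S.m_assoc t(3))
      also have "\<dots> = \<iota> x \<otimes>\<^bsub>S\<^esub> (s' \<otimes>\<^bsub>S\<^esub> t')" using cl by (simp add: s(3) S.m_assoc)
      finally show "\<exists>s'\<in>carrier S. \<exists>x'\<in>X. (s \<otimes>\<^bsub>S\<^esub> t) \<otimes>\<^bsub>S\<^esub> \<iota> x' = \<iota> x \<otimes>\<^bsub>S\<^esub> s'"
        using cl t(2) by blast
    qed
  qed
  have one: "\<one>\<^bsub>S\<^esub> \<in> \<iota> ` X" using D.X_one ring_hom_one[OF emb_hom] by (metis imageI)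
  have "submonoid (\<iota> ` X) S"
  proof
    show "\<iota> ` X \<subseteq> carrier S" using Xcl by auto
    show "x \<otimes>\<^bsub>S\<^esub> y \<in> \<iota> ` X" if "x \<in> \<iota> ` X" "y \<in> \<iota> ` X" for x y
      using that D.X_sub D.X_mult by (auto simp: em)
  qed (rule one)
  moreover have "\<exists>y\<in>\<iota> ` X. s \<otimes>\<^bsub>S\<^esub> y = \<zero>\<^bsub>S\<^esub>" if "s \<in> carrier S" "x \<in> X" "\<iota> x \<otimes>\<^bsub>S\<^esub> s = \<zero>\<^bsub>S\<^esub>" for s x
    using emb_mult_eq_zero[OF D.X_sub[OF that(2)] that(1,3) reg[OF that(2)]] one
    by (intro bexI[of _ "\<one>\<^bsub>S\<^esub>"]) auto
  ultimately show ?thesis using ore unfolding right_denominator_set_def by blast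
qed

end

text \<open>
  The map \<open>\<alpha>\<close> exists by the universal property.  It is injective because applying \<open>k\<close> to coefficients
  is compatible with the two actions on words, so that the coordinates of \<open>\<alpha>(s)\<close> are the images
  under \<open>k\<close> of those of \<open>s\<close>.
\<close>

lemma ore_pair_base_change:
  fixes R :: "('a, 'm) ring_scheme" and D :: "('b, 'n) ring_scheme"
  assumes R: "ore_pair R \<tau> \<delta>" and D: "ore_pair D \<tau>' \<delta>'"
    and k: "k \<in> ring_hom R D" and inj: "inj_on k (carrier R)"
    and \<tau>: "\<And>b r. r \<in> carrier R \<Longrightarrow> k (\<tau> b r) = \<tau>' b (k r)"
    and \<delta>: "\<And>b r. r \<in> carrier R \<Longrightarrow> k (\<delta> b r) = \<delta>' b (k r)"
  obtains \<alpha> where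
    "\<alpha> \<in> ring_hom (ore_amalgam R (\<tau> True) (\<delta> True) (\<tau> False) (\<delta> False))
      (ore_amalgam D (\<tau>' True) (\<delta>' True) (\<tau>' False) (\<delta>' False))"
    "\<And>r. r \<in> carrier R \<Longrightarrow> \<alpha> (ore_amalgam_emb R (\<tau> True) (\<delta> True) (\<tau> False) (\<delta> False) r) =
      ore_amalgam_emb D (\<tau>' True) (\<delta>' True) (\<tau>' False) (\<delta>' False) (k r)"
    "\<And>b. \<alpha> (ore_pair.gen R \<tau> \<delta> b) = ore_pair.gen D \<tau>' \<delta>' b"
    "inj_on \<alpha> (carrier (ore_amalgam R (\<tau> True) (\<delta> True) (\<tau> False) (\<delta> False)))"
proof -
  interpret A: ore_pair R \<tau> \<delta> by fact
  interpret B: ore_pair D \<tau>' \<delta>' by fact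
  note kc = ring_hom_closed[OF k]
  have k0: "k \<zero>\<^bsub>R\<^esub> = \<zero>\<^bsub>D\<^esub>" by (rule ring_hom_zero[OF k A.ring_axioms B.ring_axioms])
  have h: "B.\<iota> \<circ> k \<in> ring_hom R B.S" using k B.emb_hom by (rule ring_hom_trans)
  have comm: "B.gen b \<otimes>\<^bsub>B.S\<^esub> (B.\<iota> \<circ> k) r =
      (B.\<iota> \<circ> k) (\<tau> b r) \<otimes>\<^bsub>B.S\<^esub> B.gen b \<oplus>\<^bsub>B.S\<^esub> (B.\<iota> \<circ> k) (\<delta> b r)" if "r \<in> carrier R" for b r
    using B.gen_comm[OF kc[OF that]] that by (simp add: \<tau> \<delta>)
  obtain \<alpha> where \<alpha>: "\<alpha> \<in> ring_hom A.S B.S" "\<And>r. r \<in> carrier R \<Longrightarrow> \<alpha> (A.\<iota> r) = (B.\<iota> \<circ> k) r"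
      "\<And>b. \<alpha> (A.gen b) = B.gen b"
    using A.amalgam_of_ore_universal[OF B.S.ring_axioms h B.gen_closed comm] by metis
  note \<alpha>c = ring_hom_closed[OF \<alpha>(1)]
  have km: "k \<circ> m \<in> carrier B.M" if "m \<in> carrier A.M" for m
    using that by (intro B.words_memI[of _ "{w. m w \<noteq> \<zero>\<^bsub>R\<^esub>}"])
      (auto simp: kc A.words_nth A.words_finite k0)
  have act: "k \<circ> A.action s m = B.action (\<alpha> s) (k \<circ> m)" if "s \<in> carrier A.S" "m \<in> carrier A.M" for s m
    using that
  proof (induction s arbitrary: m rule: A.amalgam_of_ore_induct)
    case (emb r)
    have "k \<circ> word_smult R r m = word_smult D (k r) (k \<circ> m)"
      using emb by (auto simp: A.word_smult_nth B.word_smult_nth ring_hom_mult[OF k] A.words_nth)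
    moreover have "B.action (\<alpha> (A.\<iota> r)) (k \<circ> m) = word_smult D (k r) (k \<circ> m)"
      unfolding \<alpha>(2)[OF emb(1)] comp_apply[of B.\<iota>] by (rule B.action(2)[OF kc[OF emb(1)] km[OF emb(2)]])
    ultimately show ?case using emb by (simp only: A.action(2))
  next
    case (gen b)
    show ?case
    proof
      fix w
      show "(k \<circ> A.action (A.gen b) m) w = B.action (\<alpha> (A.gen b)) (k \<circ> m) w"
        using gen
        by (cases w) (simp_all add: A.action B.action \<alpha> km skew.word_shift_nth[OF A.skew]
            skew.word_shift_nth[OF B.skew] A.words_nth \<tau> \<delta> ring_hom_add[OF k] A.tau_closed A.delta_closed)
    qed
  next
    case (add s t)
    have "k \<circ> A.action (s \<oplus>\<^bsub>A.S\<^esub> t) m = (k \<circ> A.action s m) \<oplus>\<^bsub>B.M\<^esub> (k \<circ> A.action t m)"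
      using add by (auto simp: A.action_add A.words_add_nth B.words_add_nth ring_hom_add[OF k]
          A.words_nth[OF A.action_closed])
    also have "\<dots> = B.action (\<alpha> (s \<oplus>\<^bsub>A.S\<^esub> t)) (k \<circ> m)"
      unfolding add.IH(1)[OF add.prems] add.IH(2)[OF add.prems]
      using add.hyps add.prems by (simp add: ring_hom_add[OF \<alpha>(1)] B.action_add \<alpha>c km)
    finally show ?case .
  next
    case (mult s t)
    have "k \<circ> A.action (s \<otimes>\<^bsub>A.S\<^esub> t) m = k \<circ> A.action s (A.action t m)"
      using mult.hyps mult.prems by (simp add: A.action_mult)
    also have "\<dots> = B.action (\<alpha> s) (B.action (\<alpha> t) (k \<circ> m))"
      unfolding mult.IH(1)[OF A.action_closed[OF mult.hyps(2) mult.prems]] mult.IH(2)[OF mult.prems] ..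
    also have "\<dots> = B.action (\<alpha> (s \<otimes>\<^bsub>A.S\<^esub> t)) (k \<circ> m)"
      using mult.hyps mult.prems by (simp add: ring_hom_mult[OF \<alpha>(1)] B.action_mult \<alpha>c km)
    finally show ?case .
  qed
  have "inj_on \<alpha> (carrier A.S)"
  proof (rule inj_onI)
    fix s t assume st: "s \<in> carrier A.S" "t \<in> carrier A.S" "\<alpha> s = \<alpha> t"
    have 1: "word_single R \<one>\<^bsub>R\<^esub> [] \<in> carrier A.M" by (simp add: A.word_single_closed)
    have "k \<circ> A.coords s = k \<circ> A.coords t"
      using st act[OF _ 1] by (simp add: A.coords_def)
    then have "k (A.coords s w) = k (A.coords t w)" for w by (metis comp_apply)
    moreover have "A.coords s w \<in> carrier R" "A.coords t w \<in> carrier R" for w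
      using st 1 by (simp_all add: A.coords_def A.words_nth[OF A.action_closed])
    ultimately have "A.coords s w = A.coords t w" for w using inj by (blast dest: inj_onD)
    then have "A.coords s = A.coords t" by (rule ext)
    then show "s = t" using A.coords_inj st by (auto dest: inj_onD)
  qed
  then show thesis using that \<alpha> by simp
qed


section \<open>Fractions of the amalgamated product\<close>

text \<open>
  Two fractions have a common denominator, whose image is invertible and can be cancelled.
\<close>

lemma (in right_denom) right_fractions_hom_inj:
  assumes A: "ring A" and H: "H \<in> ring_hom Q A" and inj: "inj_on (\<lambda>s. H (emb s)) (carrier S)"
  shows "inj_on H (carrier Q)"
proof (rule inj_onI)
  fix B C assume BC: "B \<in> carrier Q" "C \<in> carrier Q" "H B = H C"
  obtain b c x where b: "b \<in> carrier S" "c \<in> carrier S" "x \<in> X" "B = F b x" "C = F c x"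
    using common2 BC by metis
  note x = emb_Units[OF b(3)] emb_closed[OF X_sub[OF b(3)]]
  have "B \<otimes>\<^bsub>Q\<^esub> emb x = emb b" "C \<otimes>\<^bsub>Q\<^esub> emb x = emb c"
    using b x emb_closed by (simp_all add: F_eq_emb_inv Q.m_assoc)
  then have "H (emb b) = H (emb c)"
    using BC x by (metis ring_hom_mult[OF H])
  then show "B = C" using inj b by (auto dest: inj_onD)
qed

text \<open>
  The embedding of \<open>S\<close> into the amalgamated product over the fractions of \<open>R\<close> extends to the fractions of \<open>S\<close>,
  and the image of the extension contains all \<open>r x\<^sup>-\<^sup>1\<close> as well as both variables.
\<close>

theorem ore_amalgam_right_fractions:
  fixes R :: "('a, 'm) ring_scheme" and \<tau> \<delta> :: "bool \<Rightarrow> 'a \<Rightarrow> 'a" and X :: "'a set"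
  assumes R: "nc_noetherian_domain R"
    and aut: "\<And>b. \<tau> b \<in> ring_aut R" and der: "\<And>b. left_derivation R (\<tau> b) (\<delta> b)"
  defines "X \<equiv> carrier R - {\<zero>\<^bsub>R\<^esub>}"
    and "S \<equiv> ore_amalgam R (\<tau> True) (\<delta> True) (\<tau> False) (\<delta> False)"
    and "XS \<equiv> ore_amalgam_emb R (\<tau> True) (\<delta> True) (\<tau> False) (\<delta> False) ` X"
  shows "right_denominator_set XS S"
    and "right_fractions S XS \<simeq>
      ore_amalgam (right_fractions R X)
        (induced_aut R X (\<tau> True)) (induced_der R X (\<tau> True) (\<delta> True))
        (induced_aut R X (\<tau> False)) (induced_der R X (\<tau> False) (\<delta> False))"
proof -
  interpret R: ring R using R by (simp add: nc_noetherian_domain_def)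
  have nzd: "b = \<zero>\<^bsub>R\<^esub>" if "a \<in> X" "b \<in> carrier R" "a \<otimes>\<^bsub>R\<^esub> b = \<zero>\<^bsub>R\<^esub>" for a b
    using R that by (auto simp: nc_noetherian_domain_def X_def)
  have nzd': "a = \<zero>\<^bsub>R\<^esub>" if "b \<in> X" "a \<in> carrier R" "a \<otimes>\<^bsub>R\<^esub> b = \<zero>\<^bsub>R\<^esub>" for a b
    using R that by (auto simp: nc_noetherian_domain_def X_def)
  have hom: "\<tau> b \<in> ring_hom R R" for b using aut by (simp add: ring_iso_def)
  have \<tau>X: "\<tau> b ` X = X" for b
  proof -
    have bij: "bij_betw (\<tau> b) (carrier R) (carrier R)" using aut by (simp add: ring_iso_def)
    have "\<tau> b \<zero>\<^bsub>R\<^esub> = \<zero>\<^bsub>R\<^esub>" using hom R.ring_axioms by (metis ring_hom_zero)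
    then have "bij_betw (\<tau> b) X (carrier R - {\<zero>\<^bsub>R\<^esub>})"
      unfolding X_def using bij by (metis R.zero_closed bij_betw_DiffI bij_betw_singletonI empty_subsetI insert_subset)
    then show ?thesis by (simp add: bij_betw_def X_def)
  qed
  have XR: "right_denominator_set X R"
    unfolding X_def using R by (rule noetherian_domain_right_denominator_set)
  interpret D: right_denom R X using XR by unfold_locales
  interpret A: ore_pair R \<tau> \<delta> using hom der by unfold_locales
  let ?\<sigma> = "\<lambda>b. induced_aut R X (\<tau> b)" and ?\<epsilon> = "\<lambda>b. induced_der R X (\<tau> b) (\<delta> b)"
  note \<sigma> = D.induced_aut[OF aut \<tau>X] and \<epsilon> = D.induced_der[OF aut \<tau>X der]
  interpret B: ore_pair D.Q ?\<sigma> ?\<epsilon>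
    using \<sigma>(1) \<epsilon>(1) by unfold_locales (simp_all add: ring_iso_def)
  have XS: "right_denominator_set XS A.S"
    unfolding XS_def using A.right_denominator_set_emb[OF XR \<tau>X nzd] .
  then show "right_denominator_set XS S" by (simp add: S_def)
  interpret DS: right_denom A.S XS using XS by unfold_locales
  have "inj_on D.emb (carrier R)"
  proof (rule inj_onI)
    fix r s assume rs: "r \<in> carrier R" "s \<in> carrier R" "D.emb r = D.emb s"
    then obtain c where c: "c \<in> X" "r \<otimes>\<^bsub>R\<^esub> c = s \<otimes>\<^bsub>R\<^esub> c"
      using D.F_eq_iff[of r s "\<one>\<^bsub>R\<^esub>" "\<one>\<^bsub>R\<^esub>"] D.X_one by (auto simp: rfrac_emb_def D.rel_def)
    have "(r \<ominus>\<^bsub>R\<^esub> s) \<otimes>\<^bsub>R\<^esub> c = \<zero>\<^bsub>R\<^esub>"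
      using rs c D.X_sub by (simp add: a_minus_def R.l_distr R.l_minus R.r_neg)
    then have "r \<ominus>\<^bsub>R\<^esub> s = \<zero>\<^bsub>R\<^esub>" using nzd'[OF c(1)] rs by simp
    moreover have "r = (r \<ominus>\<^bsub>R\<^esub> s) \<oplus>\<^bsub>R\<^esub> s" using rs by (simp add: a_minus_def R.a_assoc R.l_neg)
    ultimately show "r = s" using rs by simp
  qed
  then obtain \<alpha> where \<alpha>: "\<alpha> \<in> ring_hom A.S B.S" "\<And>r. r \<in> carrier R \<Longrightarrow> \<alpha> (A.\<iota> r) = B.\<iota> (D.emb r)"
      "\<And>b. \<alpha> (A.gen b) = B.gen b" "inj_on \<alpha> (carrier A.S)"
    using ore_pair_base_change[of R \<tau> \<delta> D.Q ?\<sigma> ?\<epsilon> D.emb] A.ore_pair_axioms B.ore_pair_axioms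
      D.rfrac_emb_hom \<sigma>(2) \<epsilon>(2) by auto
  have unit: "\<alpha> x \<in> Units B.S" if "x \<in> XS" for x
    using that ring_hom_Units(1)[OF D.Q.monoid_axioms B.S.monoid_axioms B.emb_hom D.emb_Units] \<alpha>(2) D.X_sub
    by (auto simp: XS_def)
  obtain H where H: "H \<in> ring_hom DS.Q B.S"
      "\<And>s x. \<lbrakk>s \<in> carrier A.S; x \<in> XS\<rbrakk> \<Longrightarrow> H (DS.F s x) = \<alpha> s \<otimes>\<^bsub>B.S\<^esub> inv\<^bsub>B.S\<^esub> \<alpha> x"
      "\<And>s. s \<in> carrier A.S \<Longrightarrow> H (DS.emb s) = \<alpha> s"
    using DS.right_fractions_universal[OF B.S.ring_axioms \<alpha>(1) unit] by metis
  have "inj_on H (carrier DS.Q)"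
    using \<alpha>(4) H(3) by (intro DS.right_fractions_hom_inj[OF B.S.ring_axioms H(1)]) (simp cong: inj_on_cong)
  moreover have "t \<in> H ` carrier DS.Q" if "t \<in> carrier B.S" for t
    using that
  proof (induction rule: B.amalgam_of_ore_induct)
    case (emb d)
    then obtain r x where r: "r \<in> carrier R" "x \<in> X" "d = D.F r x" by (auto simp: D.Q_simps)
    note x = D.X_sub[OF r(2)]
    have "B.\<iota> d = B.\<iota> (D.emb r) \<otimes>\<^bsub>B.S\<^esub> B.\<iota> (inv\<^bsub>D.Q\<^esub> (D.emb x))"
      using r D.emb_Units D.emb_closed by (simp add: D.F_eq_emb_inv ring_hom_mult[OF B.emb_hom])
    also have "\<dots> = \<alpha> (A.\<iota> r) \<otimes>\<^bsub>B.S\<^esub> inv\<^bsub>B.S\<^esub> \<alpha> (A.\<iota> x)"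
      using r x ring_hom_Units(2)[OF D.Q.monoid_axioms B.S.monoid_axioms B.emb_hom D.emb_Units] \<alpha>(2) by simp
    also have "\<dots> = H (DS.F (A.\<iota> r) (A.\<iota> x))"
      using r A.emb_closed by (intro H(2)[symmetric]) (auto simp: XS_def)
    finally show ?case
      using r A.emb_closed DS.F_closed[of "A.\<iota> r" "A.\<iota> x"] by (simp add: XS_def)
  next
    case (gen b)
    have "B.gen b = H (DS.emb (A.gen b))" using H(3)[OF A.gen_closed] \<alpha>(3) by simp
    then show ?case using DS.emb_closed[OF A.gen_closed] by (rule image_eqI)
  next
    case (add s t)
    then show ?case by (auto simp: ring_hom_add[OF H(1), symmetric])
  next
    case (mult s t)
    then show ?case by (auto simp: ring_hom_mult[OF H(1), symmetric])
  qed
  ultimately have "H \<in> ring_iso DS.Q B.S"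
    using H(1) ring_hom_closed[OF H(1)] by (auto simp: ring_iso_def bij_betw_def)
  then show "right_fractions S XS \<simeq> ore_amalgam (right_fractions R X)
      (induced_aut R X (\<tau> True)) (induced_der R X (\<tau> True) (\<delta> True))
      (induced_aut R X (\<tau> False)) (induced_der R X (\<tau> False) (\<delta> False))"
    unfolding is_ring_iso_def S_def by blast
qed

theorem theorem1p2:
  fixes R :: "('a, 'm) ring_scheme"
    and \<tau>1 \<tau>2 \<delta>1 \<delta>2 :: "'a \<Rightarrow> 'a"
  assumes "nc_noetherian_domain R"
    and "\<tau>1 \<in> ring_aut R" and "\<tau>2 \<in> ring_aut R"
    and "left_derivation R \<tau>1 \<delta>1" and "left_derivation R \<tau>2 \<delta>2"
  shows "let X = carrier R - {\<zero>\<^bsub>R\<^esub>};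
             S = ore_amalgam R \<tau>1 \<delta>1 \<tau>2 \<delta>2;
             XS = ore_amalgam_emb R \<tau>1 \<delta>1 \<tau>2 \<delta>2 ` X
         in right_denominator_set XS S \<and>
            right_fractions S XS \<simeq>
              ore_amalgam (right_fractions R X)
                (induced_aut R X \<tau>1) (induced_der R X \<tau>1 \<delta>1)
                (induced_aut R X \<tau>2) (induced_der R X \<tau>2 \<delta>2)"
  using ore_amalgam_right_fractions[of R "\<lambda>b. if b then \<tau>1 else \<tau>2" "\<lambda>b. if b then \<delta>1 else \<delta>2"] assms
  unfolding Let_def by simp

end
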